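(* Let $n \ge 2$ and let $\{X_t\}_{t\ge 0}$ be Kac's walk on $\mathrm{S}^{n-1}$, and let $\mu$ be the normalized Haar (uniform) probability measure on $\mathrm{S}^{n-1}$. (i) Fix $C_1 < \frac{1}{2}$. If a sequence of times $\{T_1(n)\}_{n \in \mathbb{N}}$ satisfies $T_1(n) < C_1 n \log(n)$ for all $n$, then $$\lim_{n\to\infty} \inf_{X_0 \in \mathrm{S}^{n-1}} \| \mathcal{L}(X_{T_1(n)}) - \mu \|_{\mathrm{TV}} = 1.$$ (ii) Fix $C_2 > 200$. If a sequence of times $\{T_2(n)\}_{n \in \mathbb{N}}$ satisfies $T_2(n) > C_2 n \log(n)$ for all $n$, then $$\lim_{n\to\infty} \sup_{X_0 \in \mathrm{S}^{n-1}} \| \mathcal{L}(X_{T_2(n)}) - \mu \|_{\mathrm{TV}} = 0.$$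
   Context: $\mathrm{S}^{n-1} = \{X \in \mathbb{R}^n : \sum_{i=1}^n X[i]^2 = 1\}$. Kac's walk on $\mathrm{S}^{n-1}$ is the discrete-time Markov chain $\{X_t\}_{t \ge 0}$ on $\mathrm{S}^{n-1}$ evolving as follows: at each step $t$, independently of the past, choose a pair of indices $1 \le i_t < j_t \le n$ uniformly at random among all such pairs and an angle $\theta_t \in [0,2\pi)$ uniformly at random, and set $X_{t+1}[i_t] = \cos(\theta_t) X_t[i_t] - \sin(\theta_t) X_t[j_t]$, $X_{t+1}[j_t] = \sin(\theta_t) X_t[i_t] + \cos(\theta_t) X_t[j_t]$, and $X_{t+1}[k] = X_t[k]$ for $k \notin \{i_t, j_t\}$. $\mathcal{L}(Z)$ denotes the law of a random variable $Z$, and for probability measures $\nu_1,\nu_2$ on the same measurable space, $\|\nu_1 - \nu_2\|_{\mathrm{TV}} = \sup_A (\nu_1(A) - \nu_2(A))$. The walk is started deterministically at $X_0$. *)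

theory Defs
  imports "HOL-Probability.Probability"
begin

text \<open>Points of R^n are represented as functions nat => real, extensional on {..<n}
  (the carrier of the product measure below). The ambient measurable space is
  R^n with its Borel sigma-algebra.\<close>

definition Rn :: "nat \<Rightarrow> (nat \<Rightarrow> real) measure" where
  "Rn n = PiM {..<n} (\<lambda>_. lborel)"

definition sqnorm :: "nat \<Rightarrow> (nat \<Rightarrow> real) \<Rightarrow> real" where
  "sqnorm n x = (\<Sum>i<n. (x i)\<^sup>2)"

definition sphere_n :: "nat \<Rightarrow> (nat \<Rightarrow> real) set" where
  "sphere_n n = {x \<in> space (Rn n). sqnorm n x = 1}"

definition ball_n :: "nat \<Rightarrow> (nat \<Rightarrow> real) set" where
  "ball_n n = {x \<in> space (Rn n). sqnorm n x \<le> 1}"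

text \<open>Normalised Haar (uniform) probability measure on S^{n-1}, defined as the
  cone measure: mu(A) = Lebesgue measure of {r x : x in A, 0 < r <= 1} divided by
  the volume of the unit ball, i.e. the push-forward of the uniform measure on the
  unit ball under radial projection x |-> x/|x|.\<close>
definition haar :: "nat \<Rightarrow> (nat \<Rightarrow> real) measure" where
  "haar n = distr (uniform_measure (Rn n) (ball_n n)) (Rn n)
      (\<lambda>x. restrict (\<lambda>i. x i / sqrt (sqnorm n x)) {..<n})"

definition kac_rot :: "nat \<times> nat \<Rightarrow> real \<Rightarrow> (nat \<Rightarrow> real) \<Rightarrow> (nat \<Rightarrow> real)" where
  "kac_rot p \<theta> x = (case p of (i, j) \<Rightarrow>
      x(i := cos \<theta> * x i - sin \<theta> * x j, j := sin \<theta> * x i + cos \<theta> * x j))"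

definition kac_noise :: "nat \<Rightarrow> ((nat \<times> nat) \<times> real) measure" where
  "kac_noise n = measure_pmf (pmf_of_set {(i, j). i < j \<and> j < n})
      \<Otimes>\<^sub>M uniform_measure lborel {0..<2 * pi}"

primrec kac_traj :: "(nat \<Rightarrow> (nat \<times> nat) \<times> real) \<Rightarrow> (nat \<Rightarrow> real) \<Rightarrow> nat \<Rightarrow> (nat \<Rightarrow> real)" where
  "kac_traj \<omega> x0 0 = x0"
| "kac_traj \<omega> x0 (Suc t) = kac_rot (fst (\<omega> t)) (snd (\<omega> t)) (kac_traj \<omega> x0 t)"

definition kac_law :: "nat \<Rightarrow> (nat \<Rightarrow> real) \<Rightarrow> nat \<Rightarrow> (nat \<Rightarrow> real) measure" where
  "kac_law n x0 t = distr (PiM {..<t} (\<lambda>_. kac_noise n)) (Rn n) (\<lambda>\<omega>. kac_traj \<omega> x0 t)"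

definition tv_dist :: "'a measure \<Rightarrow> 'a measure \<Rightarrow> real" where
  "tv_dist M N = (SUP A \<in> sets M. measure M A - measure N A)"

end

theory Submission
  imports Defs "HOL-Real_Asymp.Real_Asymp"
begin

text \<open>
  Lower bound: with fewer than \<open>C n ln n\<close> steps, \<open>C < 1/2\<close>, the second moment method shows that with
  high probability some coordinate has never been touched and still has its initial value, an event
  that is null for the uniform measure.

  Upper bound: let \<open>D k = (x k)\<^sup>2 - (y k)\<^sup>2\<close> for a state \<open>x\<close> of the walk and a stationary state \<open>y\<close>.
  Using the same index pair and the same polar angle after the rotation for both, the sum of the \<open>(D k)\<^sup>2\<close>
  contracts by \<open>1 - 1/(2n)\<close> per step, so after order \<open>n ln n\<close> steps all \<open>D k\<close> are
  polynomially small. For the remaining steps fix the sequence of index pairs in advance and let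
  \<open>P\<^sub>t\<close> be the partition of the indices into components of the graph formed by the pairs used
  after time \<open>t\<close>. Forward in time these partitions get finer, from a single class
  (with high probability) to singletons, and the coupling maintains that \<open>D\<close> sums to zero over
  every class: it uses equal angles when the class stays whole, and when it splits it matches
  the total squared weight of the halves, at the price of a small total variation error between two
  nearby arcsine laws. At the end \<open>D = 0\<close>. All of this is phrased with averaging operators
  acting on functions, so no coupling is ever constructed.
\<close>

section \<open>Uniform angles and the arcsine law\<close>

text \<open>A coupling that sees only the present step brings the squares close but not equal. The
  later pairs reveal when two groups of indices interact for the last time; that step is the last
  chance to equate their masses, so the partition is read off the future pairs. Two arcsine laws are
  close only if their intervals are long compared with the discrepancy, which can fail when a
  coordinate of \<open>y\<close> is tiny. But \<open>y\<close> stays uniform, so failures are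
  counted under \<open>haar\<close>, and every error of this stage is a function of \<open>y\<close>
  alone. Squares fix a coordinate only up to sign, so signs are matched too, at the latest at the
  step that isolates an index. Each coupling statement becomes a one-sided inequality
  \<open>G x \<le> G y + error\<close> for a test function with values in [0,1]; integrating
  \<open>y\<close> over \<open>haar\<close> turns it into a bound on probabilities of sets, and
  one-sided bounds suffice for the supremum in \<open>tv_dist\<close>. The contraction stage gets at
  least 100 n ln n steps and the matching stage 100 n ln n steps up to rounding, which is where 200
  comes from.\<close>

definition angle :: "real measure" where
  "angle = uniform_measure lborel {0..<2 * pi}"

lemma sets_angle [measurable_cong, simp]: "sets angle = sets borel"
  by (simp add: angle_def)

lemma space_angle [simp]: "space angle = UNIV"
  by (simp add: angle_def)

lemma prob_space_angle: "prob_space angle"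
  unfolding angle_def by (rule prob_space_uniform_measure) auto

lemma measurable_angle_eq [simp]: "measurable angle N = measurable borel N"
  by (rule measurable_cong_sets) auto

lemma emeasure_angle_UNIV [simp]: "emeasure angle UNIV = 1"
  using prob_space.emeasure_space_1[OF prob_space_angle] by simp

lemma nn_integral_angle_const [simp]: "(\<integral>\<^sup>+\<theta>. c \<partial>angle) = c"
  using prob_space.emeasure_space_1[OF prob_space_angle] by simp

lemma nn_integral_angle:
  assumes [measurable]: "h \<in> borel_measurable borel"
  shows "(\<integral>\<^sup>+\<theta>. h \<theta> \<partial>angle) = ennreal (1 / (2 * pi)) * (\<integral>\<^sup>+\<theta>. h \<theta> * indicator {0..<2 * pi} \<theta> \<partial>lborel)"
proof -
  have "(\<integral>\<^sup>+\<theta>. h \<theta> \<partial>angle) = (\<integral>\<^sup>+\<theta>. h \<theta> * indicator {0..<2 * pi} \<theta> \<partial>lborel) / ennreal (2 * pi)"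
    unfolding angle_def by (subst nn_integral_uniform_measure) auto
  also have "\<dots> = ennreal (1 / (2 * pi)) * (\<integral>\<^sup>+\<theta>. h \<theta> * indicator {0..<2 * pi} \<theta> \<partial>lborel)"
    by (subst mult.commute) (simp add: divide_ennreal_def inverse_ennreal inverse_eq_divide)
  finally show ?thesis .
qed

lemma nn_integral_lborel_translate:
  fixes f :: "real \<Rightarrow> ennreal"
  assumes "f \<in> borel_measurable borel"
  shows "(\<integral>\<^sup>+x. f (x + t) \<partial>lborel) = (\<integral>\<^sup>+x. f x \<partial>lborel)"
  using nn_integral_real_affine[OF assms, of 1 t] by (simp add: add.commute)

text \<open>The window of length 2 pi now starts at \<alpha>; its part beyond 2 pi is carried back
  to the beginning by periodicity.\<close>

lemma nn_integral_angle_shift: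
  assumes [measurable]: "h \<in> borel_measurable borel"
    and per: "\<And>\<theta>. h (\<theta> + 2 * pi) = h \<theta>" and \<alpha>: "0 \<le> \<alpha>" "\<alpha> < 2 * pi"
  shows "(\<integral>\<^sup>+\<theta>. h (\<theta> + \<alpha>) \<partial>angle) = (\<integral>\<^sup>+\<theta>. h \<theta> \<partial>angle)"
proof -
  have "(\<integral>\<^sup>+\<theta>. h (\<theta> + \<alpha>) * indicator {0..<2 * pi} \<theta> \<partial>lborel)
      = (\<integral>\<^sup>+\<theta>. h (\<theta> + \<alpha>) * indicator {\<alpha>..<2 * pi + \<alpha>} (\<theta> + \<alpha>) \<partial>lborel)"
    by (rule nn_integral_cong) (simp add: indicator_def)
  also have "\<dots> = (\<integral>\<^sup>+\<theta>. h \<theta> * indicator {\<alpha>..<2 * pi + \<alpha>} \<theta> \<partial>lborel)"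
    by (rule nn_integral_lborel_translate) simp
  also have "\<dots> = (\<integral>\<^sup>+\<theta>. h \<theta> * indicator {\<alpha>..<2 * pi} \<theta> + h \<theta> * indicator {2 * pi..<2 * pi + \<alpha>} \<theta> \<partial>lborel)"
    using \<alpha> by (intro nn_integral_cong) (simp add: indicator_def)
  also have "\<dots> = (\<integral>\<^sup>+\<theta>. h \<theta> * indicator {\<alpha>..<2 * pi} \<theta> \<partial>lborel)
      + (\<integral>\<^sup>+\<theta>. h \<theta> * indicator {2 * pi..<2 * pi + \<alpha>} \<theta> \<partial>lborel)"
    by (rule nn_integral_add) simp_all
  also have "(\<integral>\<^sup>+\<theta>. h \<theta> * indicator {2 * pi..<2 * pi + \<alpha>} \<theta> \<partial>lborel)
      = (\<integral>\<^sup>+\<theta>. h (\<theta> + 2 * pi) * indicator {2 * pi..<2 * pi + \<alpha>} (\<theta> + 2 * pi) \<partial>lborel)"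
    by (rule nn_integral_lborel_translate[symmetric]) simp
  also have "\<dots> = (\<integral>\<^sup>+\<theta>. h \<theta> * indicator {0..<\<alpha>} \<theta> \<partial>lborel)"
    by (rule nn_integral_cong) (simp add: indicator_def per)
  also have "(\<integral>\<^sup>+\<theta>. h \<theta> * indicator {\<alpha>..<2 * pi} \<theta> \<partial>lborel) + \<dots>
      = (\<integral>\<^sup>+\<theta>. h \<theta> * indicator {\<alpha>..<2 * pi} \<theta> + h \<theta> * indicator {0..<\<alpha>} \<theta> \<partial>lborel)"
    by (rule nn_integral_add[symmetric]) simp_all
  also have "\<dots> = (\<integral>\<^sup>+\<theta>. h \<theta> * indicator {0..<2 * pi} \<theta> \<partial>lborel)"
    using \<alpha> by (intro nn_integral_cong) (simp add: indicator_def)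
  finally show ?thesis
    by (subst (1 2) nn_integral_angle) simp_all
qed

section \<open>Folding the circle onto the first quadrant\<close>

definition quadrant :: "real measure" where
  "quadrant = uniform_measure lborel {0..pi / 2}"

lemma sets_quadrant [measurable_cong, simp]: "sets quadrant = sets borel"
  by (simp add: quadrant_def)

lemma space_quadrant [simp]: "space quadrant = UNIV"
  by (simp add: quadrant_def)

lemma measurable_quadrant_eq [simp]: "measurable quadrant N = measurable borel N"
  by (rule measurable_cong_sets) auto

lemma prob_space_quadrant: "prob_space quadrant"
  unfolding quadrant_def by (rule prob_space_uniform_measure) auto

lemma nn_integral_quadrant:
  assumes [measurable]: "h \<in> borel_measurable borel"
  shows "(\<integral>\<^sup>+\<theta>. h \<theta> \<partial>quadrant) = ennreal (2 / pi) * (\<integral>\<^sup>+\<theta>. h \<theta> * indicator {0..pi / 2} \<theta> \<partial>lborel)"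
proof -
  have "(\<integral>\<^sup>+\<theta>. h \<theta> \<partial>quadrant) = (\<integral>\<^sup>+\<theta>. h \<theta> * indicator {0..pi / 2} \<theta> \<partial>lborel) / ennreal (pi / 2)"
    unfolding quadrant_def by (subst nn_integral_uniform_measure) auto
  also have "\<dots> = ennreal (2 / pi) * (\<integral>\<^sup>+\<theta>. h \<theta> * indicator {0..pi / 2} \<theta> \<partial>lborel)"
    by (subst mult.commute) (simp add: divide_ennreal_def inverse_ennreal inverse_eq_divide)
  finally show ?thesis .
qed

text \<open>Reflections carry each quadrant onto the first, where the squared sine is monotone and
  can serve as a variable of integration. The four summands are the four sign patterns of cosine and
  sine.\<close>

lemma angle_quadrants:
  assumes [measurable]: "h \<in> borel_measurable borel"
  shows "(\<integral>\<^sup>+\<theta>. h \<theta> \<partial>angle)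
    = ennreal (1 / 4) * (\<integral>\<^sup>+\<phi>. h \<phi> + h (pi - \<phi>) + h (pi + \<phi>) + h (2 * pi - \<phi>) \<partial>quadrant)"
proof -
  let ?i = "\<lambda>a b \<theta>. indicator {a..b} \<theta> :: ennreal"
  have *: "(\<integral>\<^sup>+\<theta>. h \<theta> * ?i (pi/2) pi \<theta> \<partial>lborel) = (\<integral>\<^sup>+\<theta>. h (pi - \<theta>) * ?i 0 (pi/2) \<theta> \<partial>lborel)"
    by (subst nn_integral_real_affine[where c = "-1" and t = pi])
       (auto intro!: nn_integral_cong simp: indicator_def)
  have **: "(\<integral>\<^sup>+\<theta>. h \<theta> * ?i pi (3*pi/2) \<theta> \<partial>lborel) = (\<integral>\<^sup>+\<theta>. h (pi + \<theta>) * ?i 0 (pi/2) \<theta> \<partial>lborel)"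
    by (subst nn_integral_real_affine[where c = 1 and t = pi])
       (auto intro!: nn_integral_cong simp: indicator_def)
  have ***: "(\<integral>\<^sup>+\<theta>. h \<theta> * ?i (3*pi/2) (2*pi) \<theta> \<partial>lborel) = (\<integral>\<^sup>+\<theta>. h (2*pi - \<theta>) * ?i 0 (pi/2) \<theta> \<partial>lborel)"
    by (subst nn_integral_real_affine[where c = "-1" and t = "2*pi"])
       (auto intro!: nn_integral_cong simp: indicator_def)
  \<comment> \<open>The closed quarter intervals overlap at their endpoints, and the last one
    contains 2 pi; these points are null.\<close>
  have "AE \<theta> in lborel. \<theta> \<notin> {pi/2, pi, 3*pi/2, 2*pi}"
    by (intro AE_I[where N="{pi/2, pi, 3*pi/2, 2*pi}"]) (auto intro: emeasure_lborel_countable)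
  moreover have "h \<theta> * indicator {0..<2 * pi} \<theta> = h \<theta> * ?i 0 (pi/2) \<theta> + h \<theta> * ?i (pi/2) pi \<theta>
      + h \<theta> * ?i pi (3*pi/2) \<theta> + h \<theta> * ?i (3*pi/2) (2*pi) \<theta>"
    if "\<theta> \<notin> {pi/2, pi, 3*pi/2, 2*pi}" for \<theta>
  proof -
    have "\<theta> < 0 \<or> (0 \<le> \<theta> \<and> \<theta> < pi/2) \<or> (pi/2 < \<theta> \<and> \<theta> < pi) \<or> (pi < \<theta> \<and> \<theta> < 3*pi/2)
      \<or> (3*pi/2 < \<theta> \<and> \<theta> < 2*pi) \<or> 2*pi < \<theta>"
      using that by simp linarith
    thus ?thesis
      using pi_gt_zero by (elim disjE conjE) (simp_all add: indicator_def)
  qed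
  ultimately have "(\<integral>\<^sup>+\<theta>. h \<theta> * indicator {0..<2 * pi} \<theta> \<partial>lborel)
    = (\<integral>\<^sup>+\<theta>. h \<theta> * ?i 0 (pi/2) \<theta> + h \<theta> * ?i (pi/2) pi \<theta> + h \<theta> * ?i pi (3*pi/2) \<theta> + h \<theta> * ?i (3*pi/2) (2*pi) \<theta> \<partial>lborel)"
    by (intro nn_integral_cong_AE) (rule eventually_mono)
  also have "\<dots> = (\<integral>\<^sup>+\<theta>. h \<theta> * ?i 0 (pi/2) \<theta> \<partial>lborel) + (\<integral>\<^sup>+\<theta>. h (pi - \<theta>) * ?i 0 (pi/2) \<theta> \<partial>lborel)
    + (\<integral>\<^sup>+\<theta>. h (pi + \<theta>) * ?i 0 (pi/2) \<theta> \<partial>lborel) + (\<integral>\<^sup>+\<theta>. h (2*pi - \<theta>) * ?i 0 (pi/2) \<theta> \<partial>lborel)"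
    by (simp add: nn_integral_add * ** ***)
  also have "\<dots> = (\<integral>\<^sup>+\<phi>. h \<phi> * ?i 0 (pi/2) \<phi> + h (pi - \<phi>) * ?i 0 (pi/2) \<phi> + h (pi + \<phi>) * ?i 0 (pi/2) \<phi>
      + h (2 * pi - \<phi>) * ?i 0 (pi/2) \<phi> \<partial>lborel)"
    by (simp add: nn_integral_add)
  also have "\<dots> = (\<integral>\<^sup>+\<phi>. (h \<phi> + h (pi - \<phi>) + h (pi + \<phi>) + h (2 * pi - \<phi>)) * ?i 0 (pi/2) \<phi> \<partial>lborel)"
    by (simp add: distrib_right)
  finally have "(\<integral>\<^sup>+\<theta>. h \<theta> \<partial>angle) = ennreal (1 / (2 * pi)) *
      (\<integral>\<^sup>+\<phi>. (h \<phi> + h (pi - \<phi>) + h (pi + \<phi>) + h (2 * pi - \<phi>)) * ?i 0 (pi/2) \<phi> \<partial>lborel)"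
    by (simp add: nn_integral_angle)
  moreover have "ennreal (1 / (2 * pi)) = ennreal (1 / 4) * ennreal (2 / pi)"
    by (subst ennreal_mult[symmetric]) auto
  ultimately show ?thesis
    by (simp add: nn_integral_quadrant mult.assoc)
qed

text \<open>The density of the arcsine law on the interval from \<open>p\<close> to
  \<open>q\<close>, that is, of \<open>p + (q - p) * (sin \<phi>)\<^sup>2\<close> for a uniform
  angle.\<close>

definition arcsine :: "real \<Rightarrow> real \<Rightarrow> real \<Rightarrow> real" where
  "arcsine p q w = (if p < w \<and> w < q then 1 / (pi * sqrt ((w - p) * (q - w))) else 0)"

lemma arcsine_nonneg [simp]: "0 \<le> arcsine p q w"
  by (simp add: arcsine_def)

lemma measurable_arcsine [measurable]: "arcsine p q \<in> borel_measurable borel"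
  unfolding arcsine_def by measurable

lemma arcsine_mono:
  assumes "p \<le> a" "b \<le> q" "a < w" "w < b"
  shows "arcsine p q w \<le> arcsine a b w"
proof -
  have "0 < (w - a) * (b - w)" using assms by simp
  moreover have "(w - a) * (b - w) \<le> (w - p) * (q - w)"
    using assms by (intro mult_mono) auto
  ultimately show ?thesis
    using assms by (auto simp: arcsine_def intro!: divide_left_mono mult_left_mono)
qed

text \<open>Substituting \<open>w = a + r * (sin \<phi>)\<^sup>2\<close>, the square root in the
  density is \<open>r * sin \<phi> * cos \<phi>\<close>, half the derivative of the substitution.
  The product is the constant 2/pi, the uniform density on the quadrant.\<close>

lemma distr_sin2:
  assumes r: "0 < r"
  shows "distr quadrant borel (\<lambda>\<phi>. a + r * (sin \<phi>)\<^sup>2) = density lborel (arcsine a (a + r))"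
proof (rule measure_eqI)
  fix A assume "A \<in> sets (distr quadrant borel (\<lambda>\<phi>. a + r * (sin \<phi>)\<^sup>2))"
  hence [measurable]: "A \<in> sets borel" by simp
  let ?g = "\<lambda>\<phi>. a + r * (sin \<phi>)\<^sup>2" and ?g' = "\<lambda>\<phi>. r * (2 * sin \<phi> * cos \<phi>)"
  let ?f = "\<lambda>w. arcsine a (a + r) w * indicator A w :: real"
  have "emeasure (density lborel (arcsine a (a + r))) A = (\<integral>\<^sup>+w. ennreal (arcsine a (a+r) w) * indicator A w \<partial>lborel)"
    by (subst emeasure_density) auto
  also have "\<dots> = (\<integral>\<^sup>+w. ennreal (?f w * indicator {?g 0..?g (pi/2)} w) \<partial>lborel)"
    by (intro nn_integral_cong) (auto simp: indicator_def arcsine_def)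
  also have "\<dots> = (\<integral>\<^sup>+\<phi>. ennreal (?f (?g \<phi>) * ?g' \<phi> * indicator {0..pi/2} \<phi>) \<partial>lborel)"
  
  proof (rule nn_integral_substitution[where g = ?g and g' = ?g' and f = ?f and a = 0 and b = "pi/2"])
    show "set_borel_measurable borel {?g 0..?g (pi/2)} ?f"
      unfolding set_borel_measurable_def by measurable
    show "(?g has_real_derivative ?g' x) (at x)" for x
      by (auto intro!: derivative_eq_intros)
    show "0 \<le> ?g' x" if "x \<in> {0..pi/2}" for x
      using that r by (auto intro!: mult_nonneg_nonneg sin_ge_zero cos_ge_zero)
  qed (auto intro!: continuous_intros)
  also have "\<dots> = (\<integral>\<^sup>+\<phi>. ennreal (2 / pi) * (indicator A (?g \<phi>) * indicator {0..pi/2} \<phi>) \<partial>lborel)"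
  proof (rule nn_integral_cong_AE)
    \<comment> \<open>At the endpoints the derivative vanishes and \<open>arcsine\<close> takes its
      default value 0, so the two integrands may differ there.\<close>
    have "AE \<theta> in lborel. \<theta> \<notin> {0, pi/2}"
      by (intro AE_I[where N="{0, pi/2}"]) (auto intro: emeasure_lborel_countable)
    moreover have "ennreal (?f (?g \<phi>) * ?g' \<phi> * indicator {0..pi/2} \<phi>)
       = ennreal (2 / pi) * (indicator A (?g \<phi>) * indicator {0..pi/2} \<phi>)" if "\<phi> \<notin> {0, pi/2}" for \<phi>
    proof (cases "\<phi> \<in> {0..pi/2}")
      case True
      hence sc: "0 < sin \<phi>" "0 < cos \<phi>" using that by (auto intro!: sin_gt_zero cos_gt_zero)
      have eq: "r - r * (sin \<phi>)\<^sup>2 = r * (cos \<phi>)\<^sup>2" by (simp add: sin_squared_eq algebra_simps)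
      have lt: "r * (sin \<phi>)\<^sup>2 < r" using eq r sc by (smt (verit) zero_less_power mult_pos_pos)
      have "sqrt (r * (sin \<phi>)\<^sup>2 * (r * (cos \<phi>)\<^sup>2)) = r * sin \<phi> * cos \<phi>"
        using sc r by (intro real_sqrt_unique) (auto simp: power2_eq_square)
      hence "arcsine a (a + r) (?g \<phi>) = 1 / (pi * (r * sin \<phi> * cos \<phi>))"
        using sc r lt by (simp add: arcsine_def eq)
      hence "arcsine a (a + r) (?g \<phi>) * ?g' \<phi> = 2 / pi" using sc r by (simp add: field_simps)
      thus ?thesis using True by (auto simp: indicator_def)
    qed auto
    ultimately show "AE \<phi> in lborel. ennreal (?f (?g \<phi>) * ?g' \<phi> * indicator {0..pi/2} \<phi>)
       = ennreal (2 / pi) * (indicator A (?g \<phi>) * indicator {0..pi/2} \<phi>)"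
      by (rule eventually_mono)
  qed
  also have "\<dots> = ennreal (2 / pi) * (\<integral>\<^sup>+\<phi>. (indicator A (?g \<phi>) * indicator {0..pi/2} \<phi>) \<partial>lborel)"
    by (rule nn_integral_cmult) measurable
  also have "\<dots> = (\<integral>\<^sup>+\<phi>. indicator A (?g \<phi>) \<partial>quadrant)"
    by (subst nn_integral_quadrant) auto
  also have "\<dots> = (\<integral>\<^sup>+w. indicator A w \<partial>distr quadrant borel ?g)"
    by (subst nn_integral_distr) auto
  also have "\<dots> = emeasure (distr quadrant borel ?g) A"
    by simp
  finally show "emeasure (distr quadrant borel ?g) A = emeasure (density lborel (arcsine a (a + r))) A" ..
qed simp

lemma nn_integral_arcsine:
  assumes r: "0 < r" and [measurable]: "G \<in> borel_measurable borel"
  shows "(\<integral>\<^sup>+\<phi>. G (a + r * (sin \<phi>)\<^sup>2) \<partial>quadrant) = (\<integral>\<^sup>+w. ennreal (arcsine a (a + r) w) * G w \<partial>lborel)"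
proof -
  have "(\<integral>\<^sup>+\<phi>. G (a + r * (sin \<phi>)\<^sup>2) \<partial>quadrant) = (\<integral>\<^sup>+w. G w \<partial>distr quadrant borel (\<lambda>\<phi>. a + r * (sin \<phi>)\<^sup>2))"
    by (subst nn_integral_distr) auto
  also have "\<dots> = (\<integral>\<^sup>+w. ennreal (arcsine a (a + r) w) * G w \<partial>lborel)"
    by (subst distr_sin2[OF r]) (simp add: nn_integral_density)
  finally show ?thesis .
qed

text \<open>Jordan's inequality: the sine is concave on the quadrant and so lies above its
  chord.\<close>

lemma jordan_sin:
  assumes "0 \<le> x" "x \<le> pi / 2"
  shows "2 / pi * x \<le> sin x"
proof -
  have "convex_on {0..pi/2} (\<lambda>x. - sin x)"
  proof (rule f''_ge0_imp_convex)
    show "((\<lambda>x. - sin x) has_real_derivative - cos x) (at x)" for x :: real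
      by (auto intro!: derivative_eq_intros)
    show "((\<lambda>x. - cos x) has_real_derivative sin x) (at x)" for x :: real
      by (auto intro!: derivative_eq_intros)
    show "0 \<le> sin x" if "x \<in> {0..pi/2}" for x
      using that by (auto intro: sin_ge_zero)
  qed auto
  from convex_onD[OF this, of "2 / pi * x" 0 "pi/2"] assms show ?thesis
    by (simp add: field_simps)
qed

text \<open>Jordan's inequality confines the event to an initial interval of length
  \<open>pi / 2 * sqrt \<eta>\<close>. The square root is what the inverse square root singularity
  of the arcsine density produces.\<close>

lemma quadrant_sin2_le:
  assumes "0 \<le> \<eta>"
  shows "emeasure quadrant {\<phi>. (sin \<phi>)\<^sup>2 \<le> \<eta>} \<le> ennreal (sqrt \<eta>)"
proof -
  have "emeasure quadrant {\<phi>. (sin \<phi>)\<^sup>2 \<le> \<eta>} = (\<integral>\<^sup>+\<phi>. indicator {\<phi>. (sin \<phi>)\<^sup>2 \<le> \<eta>} \<phi> \<partial>quadrant)"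
    by simp
  also have "\<dots> = ennreal (2 / pi) * (\<integral>\<^sup>+\<phi>. indicator {\<phi>. (sin \<phi>)\<^sup>2 \<le> \<eta>} \<phi> * indicator {0..pi / 2} \<phi> \<partial>lborel)"
    by (rule nn_integral_quadrant) measurable
  also have "\<dots> \<le> ennreal (2 / pi) * (\<integral>\<^sup>+\<phi>. indicator {0..pi / 2 * sqrt \<eta>} \<phi> \<partial>lborel)"
  proof (intro mult_left_mono nn_integral_mono)
    fix \<phi> :: real
    have "\<phi> \<le> pi / 2 * sqrt \<eta>" if "(sin \<phi>)\<^sup>2 \<le> \<eta>" "0 \<le> \<phi>" "\<phi> \<le> pi / 2"
    proof -
      have "2 / pi * \<phi> \<le> sqrt \<eta>"
        using jordan_sin[OF that(2,3)] real_le_rsqrt[OF that(1)] by simp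
      thus ?thesis by (simp add: field_simps)
    qed
    thus "(indicator {\<phi>. (sin \<phi>)\<^sup>2 \<le> \<eta>} \<phi> * indicator {0..pi / 2} \<phi> :: ennreal) \<le> indicator {0..pi / 2 * sqrt \<eta>} \<phi>"
      by (auto simp: indicator_def)
  qed simp
  also have "\<dots> = ennreal (2 / pi) * ennreal (pi / 2 * sqrt \<eta>)"
    using assms by simp
  also have "\<dots> = ennreal (sqrt \<eta>)"
    using assms by (subst ennreal_mult[symmetric]) auto
  finally show ?thesis .
qed

lemma nn_integral_quadrant_reflect:
  assumes [measurable]: "h \<in> borel_measurable borel"
  shows "(\<integral>\<^sup>+\<phi>. h (pi / 2 - \<phi>) \<partial>quadrant) = (\<integral>\<^sup>+\<phi>. h \<phi> \<partial>quadrant)"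
proof -
  have "(\<integral>\<^sup>+\<phi>. h \<phi> * indicator {0..pi / 2} \<phi> \<partial>lborel)
      = ennreal \<bar>-1\<bar> * (\<integral>\<^sup>+\<phi>. h (pi / 2 + -1 * \<phi>) * indicator {0..pi / 2} (pi / 2 + -1 * \<phi>) \<partial>lborel)"
    by (rule nn_integral_real_affine) auto
  also have "\<dots> = (\<integral>\<^sup>+\<phi>. h (pi / 2 - \<phi>) * indicator {0..pi / 2} \<phi> \<partial>lborel)"
    by (simp add: indicator_def conj_commute)
  finally show ?thesis
    by (subst (1 2) nn_integral_quadrant) simp_all
qed

lemma quadrant_cos2_le:
  assumes "0 \<le> \<eta>"
  shows "emeasure quadrant {\<phi>. (cos \<phi>)\<^sup>2 \<le> \<eta>} \<le> ennreal (sqrt \<eta>)"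
proof -
  have "(\<integral>\<^sup>+\<phi>. indicator {\<phi>. (sin \<phi>)\<^sup>2 \<le> \<eta>} (pi / 2 - \<phi>) \<partial>quadrant)
     = (\<integral>\<^sup>+\<phi>. indicator {\<phi>. (sin \<phi>)\<^sup>2 \<le> \<eta>} \<phi> \<partial>quadrant)"
    by (rule nn_integral_quadrant_reflect) measurable
  moreover have "indicator {\<phi>. (sin \<phi>)\<^sup>2 \<le> \<eta>} (pi / 2 - \<phi>) = (indicator {\<phi>. (cos \<phi>)\<^sup>2 \<le> \<eta>} \<phi> :: ennreal)" for \<phi>
    by (simp add: indicator_def sin_cos_eq)
  ultimately have "emeasure quadrant {\<phi>. (cos \<phi>)\<^sup>2 \<le> \<eta>} = emeasure quadrant {\<phi>. (sin \<phi>)\<^sup>2 \<le> \<eta>}"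
    by simp
  thus ?thesis using quadrant_sin2_le[OF assms] by simp
qed

lemma AE_quadrant: "AE \<phi> in quadrant. \<phi> \<in> {0..pi / 2}"
  unfolding quadrant_def by (rule AE_uniform_measureI) auto

text \<open>Conditional expectation given the two squares: the signs of cosine and sine of a uniform
  angle are fair and independent of each other and of the squares.\<close>

definition sign_avg :: "(real \<Rightarrow> real \<Rightarrow> ennreal) \<Rightarrow> real \<Rightarrow> real \<Rightarrow> ennreal" where
  "sign_avg F u v = ennreal (1 / 4) * (F u v + F (- u) v + F (- u) (- v) + F u (- v))"

lemma nn_integral_angle_sign_avg:
  assumes [measurable]: "case_prod F \<in> borel_measurable (borel \<Otimes>\<^sub>M borel)"
  shows "(\<integral>\<^sup>+\<theta>. F (c * cos \<theta>) (c * sin \<theta>) \<partial>angle) = (\<integral>\<^sup>+\<phi>. sign_avg F (c * cos \<phi>) (c * sin \<phi>) \<partial>quadrant)"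
  by (subst angle_quadrants) (simp_all add: sign_avg_def nn_integral_cmult)

lemma measurable_sign_avg [measurable]:
  assumes [measurable]: "case_prod F \<in> borel_measurable (borel \<Otimes>\<^sub>M borel)"
    and [measurable]: "u \<in> borel_measurable M" "v \<in> borel_measurable M"
  shows "(\<lambda>x. sign_avg F (u x) (v x)) \<in> borel_measurable M"
  unfolding sign_avg_def by measurable

text \<open>The offset \<open>a\<close> is free. It will be the squared mass of the other indices in
  the half containing the second index, so that \<open>w\<close> is the mass of that whole half
  after the step, the quantity to be matched.\<close>

lemma nn_integral_angle_arcsine:
  assumes [measurable]: "case_prod F \<in> borel_measurable (borel \<Otimes>\<^sub>M borel)" and r: "0 < r"
  shows "(\<integral>\<^sup>+\<theta>. F (sqrt r * cos \<theta>) (sqrt r * sin \<theta>) \<partial>angle)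
    = (\<integral>\<^sup>+w. ennreal (arcsine a (a + r) w) * sign_avg F (sqrt (a + r - w)) (sqrt (w - a)) \<partial>lborel)"
proof -
  let ?G = "\<lambda>w. sign_avg F (sqrt (a + r - w)) (sqrt (w - a))"
  have "(\<integral>\<^sup>+\<theta>. F (sqrt r * cos \<theta>) (sqrt r * sin \<theta>) \<partial>angle)
      = (\<integral>\<^sup>+\<phi>. sign_avg F (sqrt r * cos \<phi>) (sqrt r * sin \<phi>) \<partial>quadrant)"
    by (rule nn_integral_angle_sign_avg) simp
  also have "\<dots> = (\<integral>\<^sup>+\<phi>. ?G (a + r * (sin \<phi>)\<^sup>2) \<partial>quadrant)"
  proof (intro nn_integral_cong_AE eventually_mono[OF AE_quadrant])
    fix \<phi> assume "\<phi> \<in> {0..pi / 2}"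
    hence "0 \<le> sin \<phi>" "0 \<le> cos \<phi>" by (auto intro!: sin_ge_zero cos_ge_zero)
    moreover have "a + r - (a + r * (sin \<phi>)\<^sup>2) = r * (cos \<phi>)\<^sup>2"
      by (simp add: sin_squared_eq algebra_simps)
    ultimately show "sign_avg F (sqrt r * cos \<phi>) (sqrt r * sin \<phi>) = ?G (a + r * (sin \<phi>)\<^sup>2)"
      by (simp add: real_sqrt_mult)
  qed
  also have "\<dots> = (\<integral>\<^sup>+w. ennreal (arcsine a (a + r) w) * ?G w \<partial>lborel)"
    by (rule nn_integral_arcsine[OF r]) simp
  finally show ?thesis .
qed

lemma nn_integral_arcsine_total:
  assumes "p < q"
  shows "(\<integral>\<^sup>+w. ennreal (arcsine p q w) \<partial>lborel) = 1"
  using nn_integral_arcsine[of "q - p" "\<lambda>_. 1" p] assms prob_space.emeasure_space_1[OF prob_space_quadrant]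
  by simp

text \<open>Near an endpoint either the squared sine or the squared cosine is at most \<epsilon>/L;
  each of the two events has probability at most the square root of this.\<close>

lemma arcsine_ends:
  assumes L: "0 < L" "L \<le> q - p" and \<epsilon>: "0 \<le> \<epsilon>"
  shows "(\<integral>\<^sup>+w. ennreal (arcsine p q w) * indicator (- {p + \<epsilon><..<q - \<epsilon>}) w \<partial>lborel) \<le> ennreal (2 * sqrt (\<epsilon> / L))"
proof -
  define r where "r = q - p"
  have r: "0 < r" "L \<le> r" "q = p + r" using L by (auto simp: r_def)
  have "(\<integral>\<^sup>+w. ennreal (arcsine p q w) * indicator (- {p + \<epsilon><..<q - \<epsilon>}) w \<partial>lborel)
     = (\<integral>\<^sup>+\<phi>. indicator (- {p + \<epsilon><..<q - \<epsilon>}) (p + r * (sin \<phi>)\<^sup>2) \<partial>quadrant)"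
    unfolding \<open>q = p + r\<close> by (rule nn_integral_arcsine[OF r(1), symmetric]) simp
  also have "\<dots> \<le> (\<integral>\<^sup>+\<phi>. indicator {\<phi>. (sin \<phi>)\<^sup>2 \<le> \<epsilon> / L} \<phi> + indicator {\<phi>. (cos \<phi>)\<^sup>2 \<le> \<epsilon> / L} \<phi> \<partial>quadrant)"
  proof (rule nn_integral_mono)
    fix \<phi> :: real
    have *: "t \<le> \<epsilon> / L" if "r * t \<le> \<epsilon>" "0 \<le> t" for t
    proof -
      have "L * t \<le> \<epsilon>" using that r(2) mult_right_mono[of L r t] by linarith
      thus ?thesis using L by (simp add: field_simps)
    qed
    have "r * (sin \<phi>)\<^sup>2 + r * (cos \<phi>)\<^sup>2 = r" by (simp add: sin_squared_eq algebra_simps)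
    hence "(sin \<phi>)\<^sup>2 \<le> \<epsilon> / L \<or> (cos \<phi>)\<^sup>2 \<le> \<epsilon> / L" if "p + r * (sin \<phi>)\<^sup>2 \<notin> {p + \<epsilon><..<q - \<epsilon>}"
      using that *[of "(sin \<phi>)\<^sup>2"] *[of "(cos \<phi>)\<^sup>2"] r by auto
    thus "indicator (- {p + \<epsilon><..<q - \<epsilon>}) (p + r * (sin \<phi>)\<^sup>2)
      \<le> (indicator {\<phi>. (sin \<phi>)\<^sup>2 \<le> \<epsilon> / L} \<phi> + indicator {\<phi>. (cos \<phi>)\<^sup>2 \<le> \<epsilon> / L} \<phi> :: ennreal)"
      by (cases "p + r * (sin \<phi>)\<^sup>2 \<in> {p + \<epsilon><..<q - \<epsilon>}") (auto simp: indicator_def)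
  qed
  also have "\<dots> = emeasure quadrant {\<phi>. (sin \<phi>)\<^sup>2 \<le> \<epsilon> / L} + emeasure quadrant {\<phi>. (cos \<phi>)\<^sup>2 \<le> \<epsilon> / L}"
    by (subst nn_integral_add) auto
  also have "\<dots> \<le> ennreal (sqrt (\<epsilon> / L)) + ennreal (sqrt (\<epsilon> / L))"
    using L \<epsilon> by (intro add_mono quadrant_sin2_le quadrant_cos2_le) auto
  also have "\<dots> = ennreal (2 * sqrt (\<epsilon> / L))"
    using L \<epsilon> by (subst ennreal_plus[symmetric]) auto
  finally show ?thesis .
qed

text \<open>The arcsine density of an interval decreases when the interval grows, so the density of the
  hull of two intervals is a common minorant of both densities on their overlap.\<close>

lemma nn_integral_angle_swap:
  assumes [measurable]: "case_prod F \<in> borel_measurable (borel \<Otimes>\<^sub>M borel)"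
    "case_prod G \<in> borel_measurable (borel \<Otimes>\<^sub>M borel)" "case_prod H \<in> borel_measurable (borel \<Otimes>\<^sub>M borel)"
    and rs: "0 < r" "0 < s" and F1: "\<And>u v. F u v \<le> 1"
    and ab: "\<bar>a - b\<bar> \<le> \<epsilon>" "\<bar>(a + r) - (b + s)\<bar> \<le> \<epsilon>"
    and match: "\<And>w \<sigma> \<tau>. \<sigma> \<in> {1, -1} \<Longrightarrow> \<tau> \<in> {1, -1} \<Longrightarrow> a < w \<Longrightarrow> w < a + r \<Longrightarrow> b < w \<Longrightarrow> w < b + s \<Longrightarrow>
      F (\<sigma> * sqrt (a + r - w)) (\<tau> * sqrt (w - a))
      \<le> G (\<sigma> * sqrt (b + s - w)) (\<tau> * sqrt (w - b)) + H (\<sigma> * sqrt (b + s - w)) (\<tau> * sqrt (w - b))"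
  shows "(\<integral>\<^sup>+\<theta>. F (sqrt r * cos \<theta>) (sqrt r * sin \<theta>) \<partial>angle)
    \<le> (\<integral>\<^sup>+\<theta>. G (sqrt s * cos \<theta>) (sqrt s * sin \<theta>) \<partial>angle)
      + (\<integral>\<^sup>+\<theta>. H (sqrt s * cos \<theta>) (sqrt s * sin \<theta>) \<partial>angle) + ennreal (2 * sqrt (\<epsilon> / s))"
proof -
  define p where "p = min a b"
  define q where "q = max (a + r) (b + s)"
  define I where "I = {max a b <..< min (a + r) (b + s)}"
  have I[measurable]: "I \<in> sets borel" by (simp add: I_def)
  let ?F = "\<lambda>w. sign_avg F (sqrt (a + r - w)) (sqrt (w - a))"
  let ?G = "\<lambda>w. sign_avg G (sqrt (b + s - w)) (sqrt (w - b))"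
  let ?H = "\<lambda>w. sign_avg H (sqrt (b + s - w)) (sqrt (w - b))"
  let ?x = "\<lambda>w. ennreal (arcsine a (a + r) w)" and ?y = "\<lambda>w. ennreal (arcsine b (b + s) w)"
    and ?h = "\<lambda>w. ennreal (arcsine p q w) * indicator I w"
  have hx: "?h w \<le> ?x w" and hy: "?h w \<le> ?y w" for w
    by (auto simp: indicator_def I_def p_def q_def intro!: ennreal_leI arcsine_mono)
  have F1': "?F w \<le> 1" for w
  proof -
    have "?F w \<le> ennreal (1 / 4) * (1 + 1 + 1 + 1)"
      unfolding sign_avg_def by (intro mult_left_mono add_mono F1) auto
    also have "\<dots> = ennreal (1 / 4) * ennreal 4" by simp
    also have "\<dots> = 1" by (subst ennreal_mult[symmetric]) auto
    finally show ?thesis .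
  qed
  have FGH: "?F w \<le> ?G w + ?H w" if "w \<in> I" for w
  proof -
    have w: "a < w" "w < a + r" "b < w" "w < b + s" using that by (auto simp: I_def)
    have "?F w \<le> ennreal (1 / 4) *
      ((G (sqrt (b + s - w)) (sqrt (w - b)) + H (sqrt (b + s - w)) (sqrt (w - b)))
       + (G (- sqrt (b + s - w)) (sqrt (w - b)) + H (- sqrt (b + s - w)) (sqrt (w - b)))
       + (G (- sqrt (b + s - w)) (- sqrt (w - b)) + H (- sqrt (b + s - w)) (- sqrt (w - b)))
       + (G (sqrt (b + s - w)) (- sqrt (w - b)) + H (sqrt (b + s - w)) (- sqrt (w - b))))"
      unfolding sign_avg_def
      using match[of 1 1 w] match[of "-1" 1 w] match[of "-1" "-1" w] match[of 1 "-1" w] w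
      by (intro mult_left_mono add_mono) auto
    also have "\<dots> = ?G w + ?H w"
      by (simp add: sign_avg_def algebra_simps)
    finally show ?thesis .
  qed
  have pq: "s \<le> q - p" "p < q" using rs by (auto simp: p_def q_def)
  \<comment> \<open>Both \<open>?x\<close> and the hull density have total mass 1 and
    \<open>?h\<close> is part of both, so what remains has the same mass in either case. For the
    hull this remainder sits outside the overlap, where it can be estimated.\<close>
  have split: "(\<integral>\<^sup>+w. ?x w - ?h w \<partial>lborel) = (\<integral>\<^sup>+w. ennreal (arcsine p q w) * indicator (- I) w \<partial>lborel)"
  proof -
    have "(\<integral>\<^sup>+w. ?x w - ?h w \<partial>lborel) + (\<integral>\<^sup>+w. ?h w \<partial>lborel) = (\<integral>\<^sup>+w. (?x w - ?h w) + ?h w \<partial>lborel)"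
      by (rule nn_integral_add[symmetric]) auto
    also have "\<dots> = 1"
      using hx nn_integral_arcsine_total[of a "a + r"] rs by (simp add: diff_add_cancel_ennreal)
    also have "\<dots> = (\<integral>\<^sup>+w. ennreal (arcsine p q w) * indicator (- I) w + ?h w \<partial>lborel)"
    proof -
      have "ennreal (arcsine p q w) * indicator (- I) w + ?h w = ennreal (arcsine p q w)" for w
        by (cases "w \<in> I") auto
      thus ?thesis using nn_integral_arcsine_total[OF pq(2)] by simp
    qed
    also have "\<dots> = (\<integral>\<^sup>+w. ennreal (arcsine p q w) * indicator (- I) w \<partial>lborel) + (\<integral>\<^sup>+w. ?h w \<partial>lborel)"
      by (rule nn_integral_add) auto
    finally have "(\<integral>\<^sup>+w. ?h w \<partial>lborel) + (\<integral>\<^sup>+w. ?x w - ?h w \<partial>lborel)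
       = (\<integral>\<^sup>+w. ?h w \<partial>lborel) + (\<integral>\<^sup>+w. ennreal (arcsine p q w) * indicator (- I) w \<partial>lborel)"
      by (simp only: add.commute)
    moreover have "(\<integral>\<^sup>+w. ?h w \<partial>lborel) \<le> (\<integral>\<^sup>+w. ?x w \<partial>lborel)"
      by (intro nn_integral_mono hx)
    hence "(\<integral>\<^sup>+w. ?h w \<partial>lborel) \<noteq> \<infinity>"
      using nn_integral_arcsine_total[of a "a + r"] rs by (auto simp: top_unique)
    ultimately show ?thesis
      unfolding ennreal_add_left_cancel by simp
  qed
  \<comment> \<open>Corresponding endpoints are \<epsilon>-close, so the overlap misses at most a
    strip of width \<epsilon> at each end of the hull.\<close>
  have "- I \<subseteq> - {p + \<epsilon><..<q - \<epsilon>}" using ab by (auto simp: I_def p_def q_def)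
  hence ends: "(\<integral>\<^sup>+w. ennreal (arcsine p q w) * indicator (- I) w \<partial>lborel) \<le> ennreal (2 * sqrt (\<epsilon> / s))"
    using ab by (intro order.trans[OF nn_integral_mono arcsine_ends[OF rs(2) pq(1), of \<epsilon>]])
      (auto simp: indicator_def)
  have "(\<integral>\<^sup>+w. ?h w * ?F w \<partial>lborel) \<le> (\<integral>\<^sup>+w. ?y w * ?G w + ?y w * ?H w \<partial>lborel)"
  proof (rule nn_integral_mono)
    fix w
    show "?h w * ?F w \<le> ?y w * ?G w + ?y w * ?H w"
    proof (cases "w \<in> I")
      case True
      hence "?h w * ?F w \<le> ?y w * (?G w + ?H w)" by (intro mult_mono hy FGH) auto
      thus ?thesis by (simp add: distrib_left)
    qed simp
  qed
  also have "\<dots> = (\<integral>\<^sup>+w. ?y w * ?G w \<partial>lborel) + (\<integral>\<^sup>+w. ?y w * ?H w \<partial>lborel)"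
    by (rule nn_integral_add) auto
  also have "(\<integral>\<^sup>+w. ?y w * ?G w \<partial>lborel) = (\<integral>\<^sup>+\<theta>. G (sqrt s * cos \<theta>) (sqrt s * sin \<theta>) \<partial>angle)"
    by (rule nn_integral_angle_arcsine[symmetric]) (use rs in auto)
  also have "(\<integral>\<^sup>+w. ?y w * ?H w \<partial>lborel) = (\<integral>\<^sup>+\<theta>. H (sqrt s * cos \<theta>) (sqrt s * sin \<theta>) \<partial>angle)"
    by (rule nn_integral_angle_arcsine[symmetric]) (use rs in auto)
  finally have common: "(\<integral>\<^sup>+w. ?h w * ?F w \<partial>lborel) \<le>
    (\<integral>\<^sup>+\<theta>. G (sqrt s * cos \<theta>) (sqrt s * sin \<theta>) \<partial>angle)
      + (\<integral>\<^sup>+\<theta>. H (sqrt s * cos \<theta>) (sqrt s * sin \<theta>) \<partial>angle)" .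
  have "(\<integral>\<^sup>+\<theta>. F (sqrt r * cos \<theta>) (sqrt r * sin \<theta>) \<partial>angle) = (\<integral>\<^sup>+w. ?x w * ?F w \<partial>lborel)"
    by (rule nn_integral_angle_arcsine) (use rs in auto)
  \<comment> \<open>The mass above the common minorant is charged in full, which is affordable
    because \<open>F\<close> is at most 1.\<close>
  also have "\<dots> \<le> (\<integral>\<^sup>+w. ?h w * ?F w + (?x w - ?h w) \<partial>lborel)"
  proof (rule nn_integral_mono)
    fix w
    have "?x w * ?F w = (?h w + (?x w - ?h w)) * ?F w" using hx by (simp add: add_diff_inverse_ennreal)
    also have "\<dots> \<le> ?h w * ?F w + (?x w - ?h w) * 1"
      unfolding distrib_right by (intro add_mono mult_left_mono F1') auto
    finally show "?x w * ?F w \<le> ?h w * ?F w + (?x w - ?h w)" by simp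
  qed
  also have "\<dots> = (\<integral>\<^sup>+w. ?h w * ?F w \<partial>lborel) + (\<integral>\<^sup>+w. (?x w - ?h w) \<partial>lborel)"
    by (rule nn_integral_add) auto
  also have "(\<integral>\<^sup>+w. (?x w - ?h w) \<partial>lborel) = (\<integral>\<^sup>+w. ennreal (arcsine p q w) * indicator (- I) w \<partial>lborel)"
    by (rule split)
  finally show ?thesis
    using add_mono[OF common ends] by (rule order.trans)
qed

section \<open>Averages over rotations\<close>

definition edges :: "nat \<Rightarrow> (nat \<times> nat) set" where
  "edges n = {(i, j). i < j \<and> j < n}"

lemma finite_edges [simp]: "finite (edges n)"
  by (rule finite_subset[of _ "{..<n} \<times> {..<n}"]) (auto simp: edges_def)

lemma card_edges: "2 * card (edges n) = n * (n - 1)"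
proof -
  have "edges n = (SIGMA j:{..<n}. {..<j})\<inverse>"
    by (auto simp: edges_def)
  hence "card (edges n) = card (SIGMA j:{..<n}. {..<j})"
    by simp
  also have "\<dots> = (\<Sum>j<n. j)"
    by simp
  finally have card: "card (edges n) = (\<Sum>j<n. j)" .
  show ?thesis
    unfolding card by (induction n) (auto simp: algebra_simps)
qed

lemma Rn_component [measurable]: "i < n \<Longrightarrow> (\<lambda>x. x i) \<in> borel_measurable (Rn n)"
  unfolding Rn_def by (simp add: measurable_component_singleton[of i "{..<n}" "\<lambda>_. lborel", simplified])

lemma measurable_Rn_upd:
  assumes "i < n" "f \<in> M \<rightarrow>\<^sub>M Rn n" "g \<in> borel_measurable M"
  shows "(\<lambda>x. (f x)(i := g x)) \<in> M \<rightarrow>\<^sub>M Rn n"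
  using assms unfolding Rn_def by (intro measurable_fun_upd[where J = "{..<n}"]) auto

lemma measurable_pair_upd:
  assumes "i < n" "j < n" "f \<in> M \<rightarrow>\<^sub>M Rn n" "u \<in> borel_measurable M" "v \<in> borel_measurable M"
  shows "(\<lambda>x. (f x)(i := u x, j := v x)) \<in> M \<rightarrow>\<^sub>M Rn n"
  using assms by (intro measurable_Rn_upd)

lemma space_Rn_upd: "x \<in> space (Rn n) \<Longrightarrow> i < n \<Longrightarrow> x(i := u) \<in> space (Rn n)"
  by (auto simp: Rn_def space_PiM PiE_def extensional_def)

lemma measurable_kac_rot:
  assumes "e \<in> edges n"
  shows "(\<lambda>(x, \<theta>). kac_rot e \<theta> x) \<in> Rn n \<Otimes>\<^sub>M borel \<rightarrow>\<^sub>M Rn n"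
proof -
  obtain i j where e: "e = (i, j)" "i < n" "j < n" using assms by (auto simp: edges_def)
  note [measurable] = Rn_component[OF e(2)] Rn_component[OF e(3)]
  show ?thesis
    unfolding e kac_rot_def split_beta fst_conv snd_conv by (rule measurable_pair_upd) (use e in measurable)
qed

lemma space_kac_rot: "e \<in> edges n \<Longrightarrow> x \<in> space (Rn n) \<Longrightarrow> kac_rot e \<theta> x \<in> space (Rn n)"
  by (auto simp: edges_def kac_rot_def space_Rn_upd)

lemma measurable_kac_rot_left:
  assumes "e \<in> edges n"
  shows "kac_rot e \<theta> \<in> Rn n \<rightarrow>\<^sub>M Rn n"
  using measurable_compose[OF _ measurable_kac_rot[OF assms], of "\<lambda>x. (x, \<theta>)" "Rn n"] by simp

lemma sum_remove_pair:
  fixes f :: "'a \<Rightarrow> 'b::comm_monoid_add"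
  assumes "finite A" "i \<in> A" "j \<in> A" "i \<noteq> j"
  shows "sum f A = sum f (A - {i, j}) + f i + f j"
proof -
  have "sum f A = f i + sum f (A - {i})" using assms by (intro sum.remove) auto
  also have "sum f (A - {i}) = f j + sum f (A - {i} - {j})" using assms by (intro sum.remove) auto
  also have "A - {i} - {j} = A - {i, j}" by auto
  finally show ?thesis by (simp add: ac_simps)
qed

lemma sqnorm_upd_pair:
  assumes "i < n" "j < n" "i \<noteq> j"
  shows "sqnorm n (x(i := u, j := v)) = sqnorm n x - (x i)\<^sup>2 - (x j)\<^sup>2 + u\<^sup>2 + v\<^sup>2"
  unfolding sqnorm_def using assms
  by (subst (1 2) sum_remove_pair[of _ i j]) auto

lemma sqnorm_kac_rot:
  assumes "e \<in> edges n"
  shows "sqnorm n (kac_rot e \<theta> x) = sqnorm n x"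
proof -
  obtain i j where e: "e = (i, j)" "i < n" "j < n" "i \<noteq> j" using assms by (auto simp: edges_def)
  have "(cos \<theta> * x i - sin \<theta> * x j)\<^sup>2 + (sin \<theta> * x i + cos \<theta> * x j)\<^sup>2
     = ((sin \<theta>)\<^sup>2 + (cos \<theta>)\<^sup>2) * ((x i)\<^sup>2 + (x j)\<^sup>2)"
    by algebra
  thus ?thesis using e by (simp add: kac_rot_def sqnorm_upd_pair)
qed

section \<open>Averaging operators for one step, a fixed path and the walk\<close>

definition rot_avg :: "nat \<times> nat \<Rightarrow> ((nat \<Rightarrow> real) \<Rightarrow> ennreal) \<Rightarrow> (nat \<Rightarrow> real) \<Rightarrow> ennreal" where
  "rot_avg e f x = (\<integral>\<^sup>+\<theta>. f (kac_rot e \<theta> x) \<partial>angle)"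

lemma measurable_rot_avg [measurable]:
  assumes "e \<in> edges n" and f: "f \<in> borel_measurable (Rn n)"
  shows "rot_avg e f \<in> borel_measurable (Rn n)"
proof -
  interpret angle: prob_space angle by (rule prob_space_angle)
  have "(\<lambda>(x, \<theta>). f (kac_rot e \<theta> x)) \<in> borel_measurable (Rn n \<Otimes>\<^sub>M angle)"
    using measurable_compose[OF measurable_kac_rot[OF assms(1)] f]
    by (simp add: split_beta cong: measurable_cong_sets sets_pair_measure_cong)
  thus ?thesis
    unfolding rot_avg_def by (intro angle.borel_measurable_nn_integral) simp
qed

lemma measurable_rot_angle:
  assumes "e \<in> edges n" "f \<in> borel_measurable (Rn n)" "x \<in> space (Rn n)"
  shows "(\<lambda>\<theta>. f (kac_rot e \<theta> x)) \<in> borel_measurable borel"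
  using measurable_compose[OF measurable_compose[OF measurable_Pair1'[OF assms(3)] measurable_kac_rot[OF assms(1)]] assms(2)]
  by simp

lemma measurable_upd_plane:
  assumes "i < n" "j < n" "f \<in> borel_measurable (Rn n)" "x \<in> space (Rn n)"
  shows "(\<lambda>(u, v). f (x(i := u, j := v))) \<in> borel_measurable (borel \<Otimes>\<^sub>M borel)"
proof -
  have "(\<lambda>p. x(i := fst p, j := snd p)) \<in> borel \<Otimes>\<^sub>M borel \<rightarrow>\<^sub>M Rn n"
    using assms by (intro measurable_pair_upd) auto
  from measurable_compose[OF this assms(3)] show ?thesis
    by (simp add: split_beta)
qed

text \<open>A uniform rotation forgets the previous polar angle, so only the radius of the pair
  matters. Two states can therefore be compared at equal angles after the rotation, even though
  their angles before it differ.\<close>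

lemma rot_avg_polar:
  assumes "(i, j) \<in> edges n" and f: "f \<in> borel_measurable (Rn n)" and x: "x \<in> space (Rn n)"
    and r: "r = (x i)\<^sup>2 + (x j)\<^sup>2"
  shows "rot_avg (i, j) f x = (\<integral>\<^sup>+\<theta>. f (x(i := sqrt r * cos \<theta>, j := sqrt r * sin \<theta>)) \<partial>angle)"
proof -
  have ij: "i < n" "j < n" "i \<noteq> j" using assms(1) by (auto simp: edges_def)
  obtain \<alpha> where \<alpha>: "0 \<le> \<alpha>" "\<alpha> < 2 * pi" "x i = sqrt r * cos \<alpha>" "x j = sqrt r * sin \<alpha>"
  proof (cases "r = 0")
    case True
    thus ?thesis using that[of 0] r by simp
  next
    case False
    hence "0 < r" using r by (smt (verit) zero_le_power2)
    have "(x i / sqrt r)\<^sup>2 + (x j / sqrt r)\<^sup>2 = ((x i)\<^sup>2 + (x j)\<^sup>2) / r"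
      using \<open>0 < r\<close> by (simp add: power_divide add_divide_distrib)
    also have "\<dots> = 1" unfolding r[symmetric] using \<open>0 < r\<close> by simp
    finally have "(x i / sqrt r)\<^sup>2 + (x j / sqrt r)\<^sup>2 = 1" .
    from sincos_total_2pi[OF this] show ?thesis
      using that \<open>0 < r\<close> by (metis less_irrefl nonzero_mult_div_cancel_left real_sqrt_gt_0_iff times_divide_eq_right)
  qed
  let ?h = "\<lambda>\<theta>. f (x(i := sqrt r * cos \<theta>, j := sqrt r * sin \<theta>))"
  have [measurable]: "?h \<in> borel_measurable borel"
    using measurable_compose[OF _ measurable_upd_plane[OF ij(1,2) f x], of "\<lambda>\<theta>. (sqrt r * cos \<theta>, sqrt r * sin \<theta>)" borel]
    by simp
  have "rot_avg (i, j) f x = (\<integral>\<^sup>+\<theta>. ?h (\<theta> + \<alpha>) \<partial>angle)"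
    unfolding rot_avg_def kac_rot_def by (simp add: \<alpha> cos_add sin_add algebra_simps)
  also have "\<dots> = (\<integral>\<^sup>+\<theta>. ?h \<theta> \<partial>angle)"
    by (rule nn_integral_angle_shift) (use \<alpha> in auto)
  finally show ?thesis .
qed

primrec path_avg :: "(nat \<times> nat) list \<Rightarrow> ((nat \<Rightarrow> real) \<Rightarrow> ennreal) \<Rightarrow> (nat \<Rightarrow> real) \<Rightarrow> ennreal" where
  "path_avg [] f = f"
| "path_avg (e # es) f = rot_avg e (path_avg es f)"

lemma measurable_path_avg:
  "set es \<subseteq> edges n \<Longrightarrow> f \<in> borel_measurable (Rn n) \<Longrightarrow> path_avg es f \<in> borel_measurable (Rn n)"
  by (induction es) (auto intro: measurable_rot_avg)

lemma rot_avg_le_const: "(\<And>\<theta>. f (kac_rot e \<theta> x) \<le> c) \<Longrightarrow> rot_avg e f x \<le> c"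
  unfolding rot_avg_def
  using nn_integral_mono[of angle "\<lambda>\<theta>. f (kac_rot e \<theta> x)" "\<lambda>_. c"] by simp

lemma path_avg_le_const: "(\<And>x. f x \<le> c) \<Longrightarrow> path_avg es f x \<le> c"
  by (induction es arbitrary: x) (auto intro: rot_avg_le_const)

definition kac_op :: "nat \<Rightarrow> ((nat \<Rightarrow> real) \<Rightarrow> ennreal) \<Rightarrow> (nat \<Rightarrow> real) \<Rightarrow> ennreal" where
  "kac_op n f x = ennreal (1 / card (edges n)) * (\<Sum>e\<in>edges n. rot_avg e f x)"

lemma measurable_kac_op [measurable]:
  "f \<in> borel_measurable (Rn n) \<Longrightarrow> kac_op n f \<in> borel_measurable (Rn n)"
  unfolding kac_op_def[abs_def] by (intro borel_measurable_times_ennreal borel_measurable_sum) auto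

lemma measurable_kac_op_funpow [measurable]:
  "f \<in> borel_measurable (Rn n) \<Longrightarrow> (kac_op n ^^ m) f \<in> borel_measurable (Rn n)"
  by (induction m) auto

definition paths :: "nat \<Rightarrow> nat \<Rightarrow> (nat \<times> nat) list set" where
  "paths n m = {es. set es \<subseteq> edges n \<and> length es = m}"

lemma finite_paths [simp]: "finite (paths n m)"
  unfolding paths_def by (rule finite_lists_length_eq) simp

lemma sum_paths_Suc: "(\<Sum>es\<in>paths n (Suc m). F es) = (\<Sum>e\<in>edges n. \<Sum>es\<in>paths n m. F (e # es))"
  unfolding paths_def lists_length_Suc_eq
  by (subst sum.swap, subst sum.reindex) (auto simp: inj_on_def split_beta sum.cartesian_product)

text \<open>All index pairs are drawn before any angle, so the walk is an average over fixed paths.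
  Along a fixed path a comparison may make use of the pairs still to come.\<close>

lemma kac_op_funpow:
  assumes f: "f \<in> borel_measurable (Rn n)" and x: "x \<in> space (Rn n)"
  shows "(kac_op n ^^ m) f x = ennreal (1 / card (edges n)) ^ m * (\<Sum>es\<in>paths n m. path_avg es f x)"
  using x
proof (induction m arbitrary: x)
  case 0
  have "paths n 0 = {[]}" by (auto simp: paths_def)
  thus ?case by simp
next
  case (Suc m)
  let ?c = "ennreal (1 / card (edges n))"
  have "rot_avg e ((kac_op n ^^ m) f) x = ?c ^ m * (\<Sum>es\<in>paths n m. path_avg (e # es) f x)" if e: "e \<in> edges n" for e
  proof -
    have "rot_avg e ((kac_op n ^^ m) f) x = (\<integral>\<^sup>+\<theta>. ?c ^ m * (\<Sum>es\<in>paths n m. path_avg es f (kac_rot e \<theta> x)) \<partial>angle)"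
      unfolding rot_avg_def using Suc.prems e by (intro nn_integral_cong Suc.IH space_kac_rot)
    also have "\<dots> = ?c ^ m * (\<integral>\<^sup>+\<theta>. (\<Sum>es\<in>paths n m. path_avg es f (kac_rot e \<theta> x)) \<partial>angle)"
      using Suc.prems e f
      by (intro nn_integral_cmult borel_measurable_sum)
         (auto simp: paths_def intro!: measurable_rot_angle measurable_path_avg)
    also have "\<dots> = ?c ^ m * (\<Sum>es\<in>paths n m. path_avg (e # es) f x)"
      using Suc.prems e f
      by (subst nn_integral_sum)
         (auto simp: paths_def rot_avg_def intro!: measurable_rot_angle measurable_path_avg)
    finally show ?thesis .
  qed
  hence "(kac_op n ^^ Suc m) f x = ?c * (\<Sum>e\<in>edges n. ?c ^ m * (\<Sum>es\<in>paths n m. path_avg (e # es) f x))"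
    by (simp add: kac_op_def)
  also have "\<dots> = ?c ^ Suc m * (\<Sum>es\<in>paths n (Suc m). path_avg es f x)"
    by (simp add: sum_paths_Suc sum_distrib_left[symmetric] mult.assoc)
  finally show ?case .
qed

section \<open>The uniform measure on the sphere\<close>

interpretation lborels: product_sigma_finite "\<lambda>_::nat. lborel :: real measure"
  by standard

text \<open>By Fubini the coordinate \<open>i\<close> can be integrated first, and for fixed values
  of the others the shear is a translation in it.\<close>

lemma nn_integral_Rn_shear:
  assumes ij: "i < n" "j < n" "i \<noteq> j" and f: "f \<in> borel_measurable (Rn n)"
  shows "(\<integral>\<^sup>+x. f (x(i := x i + c * x j)) \<partial>Rn n) = (\<integral>\<^sup>+x. f x \<partial>Rn n)"
proof -
  let ?I = "{..<n} - {i}"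
  have I: "{..<n} = insert i ?I" using ij by auto
  have fi: "f \<in> borel_measurable (PiM (insert i ?I) (\<lambda>_. lborel))"
    using f unfolding Rn_def I[symmetric] .
  have "(\<lambda>x. f (x(i := x i + c * x j))) \<in> borel_measurable (Rn n)"
    by (rule measurable_compose[OF measurable_Rn_upd f, of i "\<lambda>x. x"]) (use ij in auto)
  hence gi: "(\<lambda>x. f (x(i := x i + c * x j))) \<in> borel_measurable (PiM (insert i ?I) (\<lambda>_. lborel))"
    unfolding Rn_def I[symmetric] .
  have "(\<integral>\<^sup>+x. f (x(i := x i + c * x j)) \<partial>Rn n)
      = (\<integral>\<^sup>+x. \<integral>\<^sup>+y. f (x(i := y + c * x j)) \<partial>lborel \<partial>PiM ?I (\<lambda>_. lborel))"
    unfolding Rn_def by (subst I, subst lborels.product_nn_integral_insert[OF _ _ gi]) (use ij in auto)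
  also have "\<dots> = (\<integral>\<^sup>+x. \<integral>\<^sup>+y. f (x(i := y)) \<partial>lborel \<partial>PiM ?I (\<lambda>_. lborel))"
  proof (rule nn_integral_cong)
    fix x :: "nat \<Rightarrow> real" assume x: "x \<in> space (PiM ?I (\<lambda>_. lborel))"
    have "(\<lambda>y. x(i := y)) \<in> lborel \<rightarrow>\<^sub>M PiM (insert i ?I) (\<lambda>_. lborel)"
      by (rule measurable_fun_upd[where J = ?I]) (use x in auto)
    from measurable_compose[OF this fi]
    show "(\<integral>\<^sup>+y. f (x(i := y + c * x j)) \<partial>lborel) = (\<integral>\<^sup>+y. f (x(i := y)) \<partial>lborel)"
      by (intro nn_integral_lborel_translate[of "\<lambda>y. f (x(i := y))"]) simp
  qed
  also have "\<dots> = (\<integral>\<^sup>+x. f x \<partial>Rn n)"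
    unfolding Rn_def by (subst (2) I, subst lborels.product_nn_integral_insert[OF _ _ fi]) auto
  finally show ?thesis .
qed

text \<open>A plane rotation by an angle other than \<open>\<pi>\<close> is a product of three shears.\<close>

lemma nn_integral_Rn_kac_rot:
  assumes e: "e \<in> edges n" and f: "f \<in> borel_measurable (Rn n)"
  shows "(\<integral>\<^sup>+x. f (kac_rot e \<theta> x) \<partial>Rn n) = (\<integral>\<^sup>+x. f x \<partial>Rn n)"
proof -
  obtain i j where ij: "e = (i, j)" "i < n" "j < n" "i \<noteq> j" using e by (auto simp: edges_def)
  have shears: "(\<integral>\<^sup>+x. g (kac_rot e \<phi> x) \<partial>Rn n) = (\<integral>\<^sup>+x. g x \<partial>Rn n)"
    if c: "cos \<phi> \<noteq> -1" and g: "g \<in> borel_measurable (Rn n)" for \<phi> g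
  proof -
    \<comment> \<open>Minus the tangent of half the angle, the factor of the two outer
      shears.\<close>
    define t where "t = - sin \<phi> / (1 + cos \<phi>)"
    define S where "S = (\<lambda>x::nat \<Rightarrow> real. x(i := x i + t * x j))"
    define S' where "S' = (\<lambda>x::nat \<Rightarrow> real. x(j := x j + sin \<phi> * x i))"
    have Sx: "x(i := x i + t * x j) = S x" for x by (simp add: S_def)
    have [measurable]: "S \<in> Rn n \<rightarrow>\<^sub>M Rn n" "S' \<in> Rn n \<rightarrow>\<^sub>M Rn n"
      unfolding S_def S'_def using ij by (auto intro!: measurable_Rn_upd)
    have c': "1 + cos \<phi> \<noteq> 0" using c by (simp add: add_eq_0_iff)
    have "(sin \<phi>)\<^sup>2 = (1 + cos \<phi>) * (1 - cos \<phi>)"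
      by (simp add: sin_squared_eq algebra_simps power2_eq_square)
    hence st: "1 + sin \<phi> * t = cos \<phi>"
      using c' by (simp add: t_def field_simps power2_eq_square)
    have t: "t * (1 + cos \<phi>) = - sin \<phi>" using c' by (simp add: t_def)
    have "kac_rot e \<phi> x = S (S' (S x))" for x
    proof -
      have "x j + sin \<phi> * (x i + t * x j) = (1 + sin \<phi> * t) * x j + sin \<phi> * x i"
        by (simp add: algebra_simps)
      hence y: "x j + sin \<phi> * (x i + t * x j) = sin \<phi> * x i + cos \<phi> * x j"
        unfolding st by simp
      have "x i + t * x j + t * (sin \<phi> * x i + cos \<phi> * x j) = (1 + sin \<phi> * t) * x i + t * (1 + cos \<phi>) * x j"
        by (simp add: algebra_simps)
      hence z: "x i + t * x j + t * (sin \<phi> * x i + cos \<phi> * x j) = cos \<phi> * x i - sin \<phi> * x j"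
        unfolding st t by simp
      show ?thesis
        using ij y z by (auto simp: kac_rot_def S_def S'_def fun_eq_iff)
    qed
    hence "(\<integral>\<^sup>+x. g (kac_rot e \<phi> x) \<partial>Rn n) = (\<integral>\<^sup>+x. g (S (S' (S x))) \<partial>Rn n)" by simp
    also have "\<dots> = (\<integral>\<^sup>+x. g (S (S' x)) \<partial>Rn n)"
      using nn_integral_Rn_shear[OF ij(2-4), of "\<lambda>x. g (S (S' x))" t] g by (simp add: Sx)
    also have "\<dots> = (\<integral>\<^sup>+x. g (S x) \<partial>Rn n)"
      using nn_integral_Rn_shear[OF ij(3,2) ij(4)[symmetric], of "\<lambda>x. g (S x)" "sin \<phi>"] g
      by (simp add: S'_def)
    also have "\<dots> = (\<integral>\<^sup>+x. g x \<partial>Rn n)"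
      using nn_integral_Rn_shear[OF ij(2-4), of g t] g by (simp add: S_def)
    finally show ?thesis .
  qed
  show ?thesis
  proof (cases "cos \<theta> = -1")
    case True
    \<comment> \<open>The shear factor has its pole at cosine -1. Half of the angle has cosine 0,
      and the rotation by it is applied twice.\<close>
    define \<phi> where "\<phi> = \<theta> / 2"
    have "cos \<theta> = 2 * (cos \<phi>)\<^sup>2 - 1" unfolding \<phi>_def by (simp add: cos_double_cos[symmetric])
    hence c: "cos \<phi> = 0" using True by simp
    have \<theta>: "\<theta> = \<phi> + \<phi>" by (simp add: \<phi>_def)
    have "kac_rot e \<theta> x = kac_rot e \<phi> (kac_rot e \<phi> x)" for x
      using ij by (auto simp: kac_rot_def fun_eq_iff cos_add[of \<phi> \<phi>, folded \<theta>] sin_add[of \<phi> \<phi>, folded \<theta>] algebra_simps)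
    hence "(\<integral>\<^sup>+x. f (kac_rot e \<theta> x) \<partial>Rn n) = (\<integral>\<^sup>+x. f (kac_rot e \<phi> (kac_rot e \<phi> x)) \<partial>Rn n)" by simp
    also have "\<dots> = (\<integral>\<^sup>+x. f (kac_rot e \<phi> x) \<partial>Rn n)"
      by (rule shears) (use c f measurable_kac_rot_left[OF e] in auto)
    also have "\<dots> = (\<integral>\<^sup>+x. f x \<partial>Rn n)"
      by (rule shears) (use c f in auto)
    finally show ?thesis .
  qed (rule shears[OF _ f])
qed

lemma measurable_sqnorm [measurable]: "sqnorm n \<in> borel_measurable (Rn n)"
  unfolding sqnorm_def[abs_def] by (intro borel_measurable_sum borel_measurable_power) auto

lemma sets_ball_n [measurable]: "ball_n n \<in> sets (Rn n)"
  unfolding ball_n_def by measurable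

lemma sets_sphere_n [measurable]: "sphere_n n \<in> sets (Rn n)"
  unfolding sphere_n_def by measurable

lemma sqnorm_nonneg: "0 \<le> sqnorm n x"
  by (simp add: sqnorm_def sum_nonneg)

lemma sqnorm_ge_component: "i < n \<Longrightarrow> (x i)\<^sup>2 \<le> sqnorm n x"
  unfolding sqnorm_def by (intro member_le_sum) auto

lemma emeasure_ball_n_finite: "emeasure (Rn n) (ball_n n) < \<infinity>"
proof -
  have "ball_n n \<subseteq> PiE {..<n} (\<lambda>_. {-1..1})"
  proof
    fix x assume x: "x \<in> ball_n n"
    have "\<bar>x i\<bar> \<le> 1" if "i < n" for i
      using sqnorm_ge_component[OF that, of x] x by (simp add: ball_n_def abs_square_le_1[symmetric])
    hence "x i \<in> {-1..1}" if "i < n" for i using that by (fastforce simp: abs_le_iff)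
    thus "x \<in> PiE {..<n} (\<lambda>_. {-1..1})" using x by (auto simp: ball_n_def Rn_def space_PiM PiE_def)
  qed
  moreover have cube: "PiE {..<n} (\<lambda>_. {-1..1}) \<in> sets (Rn n)"
    unfolding Rn_def by (intro sets_PiM_I_finite) auto
  ultimately have "emeasure (Rn n) (ball_n n) \<le> emeasure (Rn n) (PiE {..<n} (\<lambda>_. {-1..1}))"
    by (rule emeasure_mono)
  also have "\<dots> = 2 ^ n"
    unfolding Rn_def by (subst lborels.emeasure_PiM) auto
  also have "\<dots> < \<infinity>" by (simp add: power_less_top_ennreal)
  finally show ?thesis .
qed

lemma emeasure_ball_n_pos:
  assumes "0 < n"
  shows "0 < emeasure (Rn n) (ball_n n)"
proof -
  let ?C = "PiE {..<n} (\<lambda>_. {0..1 / real n})"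
  have "?C \<subseteq> ball_n n"
  proof
    fix x assume x: "x \<in> ?C"
    have "sqnorm n x \<le> (\<Sum>i<n. (1 / real n)\<^sup>2)"
      unfolding sqnorm_def using x by (intro sum_mono power_mono) (auto simp: PiE_def Pi_def)
    also have "\<dots> \<le> 1" using assms by (simp add: power2_eq_square field_simps)
    finally show "x \<in> ball_n n" using x by (auto simp: ball_n_def Rn_def space_PiM PiE_def)
  qed
  have "0 < ennreal (1 / real n) ^ n" using assms by (simp add: ennreal_power)
  also have "\<dots> = emeasure (Rn n) ?C"
    unfolding Rn_def by (subst lborels.emeasure_PiM) auto
  also have "\<dots> \<le> emeasure (Rn n) (ball_n n)"
    using \<open>?C \<subseteq> ball_n n\<close> by (rule emeasure_mono) simp
  finally show ?thesis .
qed

definition radial :: "nat \<Rightarrow> (nat \<Rightarrow> real) \<Rightarrow> (nat \<Rightarrow> real)" where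
  "radial n x = restrict (\<lambda>i. x i / sqrt (sqnorm n x)) {..<n}"

lemma measurable_radial [measurable]: "radial n \<in> Rn n \<rightarrow>\<^sub>M Rn n"
proof -
  have "(\<lambda>x. x i / sqrt (sqnorm n x)) \<in> borel_measurable (Rn n)" if "i < n" for i
    using that by measurable
  thus ?thesis
    unfolding radial_def[abs_def] by (subst (2) Rn_def) (intro measurable_restrict, auto)
qed

lemma haar_eq: "haar n = distr (uniform_measure (Rn n) (ball_n n)) (Rn n) (radial n)"
  by (simp add: haar_def radial_def[abs_def])

lemma sets_haar [measurable_cong, simp]: "sets (haar n) = sets (Rn n)"
  by (simp add: haar_eq)

lemma space_haar [simp]: "space (haar n) = space (Rn n)"
  by (simp add: haar_eq)

lemma prob_space_haar: "0 < n \<Longrightarrow> prob_space (haar n)"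
  unfolding haar_eq using emeasure_ball_n_pos[of n] emeasure_ball_n_finite[of n]
  by (intro prob_space.prob_space_distr prob_space_uniform_measure) auto

lemma nn_integral_haar:
  assumes [measurable]: "f \<in> borel_measurable (Rn n)"
  shows "(\<integral>\<^sup>+x. f x \<partial>haar n)
    = (\<integral>\<^sup>+x. f (radial n x) * indicator (ball_n n) x \<partial>Rn n) / emeasure (Rn n) (ball_n n)"
  unfolding haar_eq by (subst nn_integral_distr) (simp_all add: nn_integral_uniform_measure)

lemma radial_kac_rot:
  assumes "e \<in> edges n"
  shows "radial n (kac_rot e \<theta> x) = kac_rot e \<theta> (radial n x)"
  unfolding radial_def sqnorm_kac_rot[OF assms] using assms
  by (auto simp: edges_def kac_rot_def fun_eq_iff add_divide_distrib diff_divide_distrib)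

text \<open>Rotations preserve Lebesgue measure and the ball and commute with the radial projection,
  so invariance descends to the sphere.\<close>

lemma nn_integral_haar_kac_rot:
  assumes e: "e \<in> edges n" and f [measurable]: "f \<in> borel_measurable (Rn n)"
  shows "(\<integral>\<^sup>+x. f (kac_rot e \<theta> x) \<partial>haar n) = (\<integral>\<^sup>+x. f x \<partial>haar n)"
proof -
  note [measurable] = measurable_kac_rot_left[OF e]
  have "(\<integral>\<^sup>+x. f (kac_rot e \<theta> (radial n x)) * indicator (ball_n n) x \<partial>Rn n)
    = (\<integral>\<^sup>+x. f (radial n (kac_rot e \<theta> x)) * indicator (ball_n n) (kac_rot e \<theta> x) \<partial>Rn n)"
    using e by (intro nn_integral_cong)
      (auto simp: radial_kac_rot ball_n_def indicator_def sqnorm_kac_rot space_kac_rot)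
  also have "\<dots> = (\<integral>\<^sup>+x. f (radial n x) * indicator (ball_n n) x \<partial>Rn n)"
    by (rule nn_integral_Rn_kac_rot[OF e]) measurable
  finally show ?thesis
    by (simp add: nn_integral_haar)
qed

lemma nn_integral_haar_rot_avg:
  assumes n: "0 < n" and e: "e \<in> edges n" and f: "f \<in> borel_measurable (Rn n)"
  shows "(\<integral>\<^sup>+x. rot_avg e f x \<partial>haar n) = (\<integral>\<^sup>+x. f x \<partial>haar n)"
proof -
  interpret angle: prob_space angle by (rule prob_space_angle)
  interpret haar: prob_space "haar n" using n by (rule prob_space_haar)
  interpret pair_sigma_finite "haar n" angle ..
  have "(\<lambda>(x, \<theta>). f (kac_rot e \<theta> x)) \<in> borel_measurable (haar n \<Otimes>\<^sub>M angle)"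
    using measurable_compose[OF measurable_kac_rot[OF e] f]
    by (simp add: split_beta cong: measurable_cong_sets sets_pair_measure_cong)
  hence "(\<integral>\<^sup>+x. rot_avg e f x \<partial>haar n) = (\<integral>\<^sup>+\<theta>. \<integral>\<^sup>+x. f (kac_rot e \<theta> x) \<partial>haar n \<partial>angle)"
    unfolding rot_avg_def by (subst Fubini') simp_all
  also have "\<dots> = (\<integral>\<^sup>+x. f x \<partial>haar n)"
    by (simp add: nn_integral_haar_kac_rot[OF e f])
  finally show ?thesis .
qed

lemma card_edges_pos: "2 \<le> n \<Longrightarrow> 0 < card (edges n)"
  using card_edges[of n] by (intro Nat.gr0I) simp

lemma ennreal_inverse_mult_of_nat: "0 < k \<Longrightarrow> ennreal (1 / real k) * of_nat k = 1"
  unfolding ennreal_of_nat_eq_real_of_nat by (subst ennreal_mult[symmetric]) auto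

lemma nn_integral_haar_kac_op:
  assumes n: "2 \<le> n" and f: "f \<in> borel_measurable (Rn n)"
  shows "(\<integral>\<^sup>+x. kac_op n f x \<partial>haar n) = (\<integral>\<^sup>+x. f x \<partial>haar n)"
proof -
  have "(\<integral>\<^sup>+x. kac_op n f x \<partial>haar n)
      = ennreal (1 / card (edges n)) * (\<integral>\<^sup>+x. (\<Sum>e\<in>edges n. rot_avg e f x) \<partial>haar n)"
    unfolding kac_op_def using f
    by (intro nn_integral_cmult borel_measurable_sum) (simp cong: measurable_cong_sets)
  also have "(\<integral>\<^sup>+x. (\<Sum>e\<in>edges n. rot_avg e f x) \<partial>haar n) = (\<Sum>e\<in>edges n. \<integral>\<^sup>+x. rot_avg e f x \<partial>haar n)"
    using f by (intro nn_integral_sum) (simp cong: measurable_cong_sets)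
  also have "\<dots> = of_nat (card (edges n)) * (\<integral>\<^sup>+x. f x \<partial>haar n)"
    using n f by (simp add: nn_integral_haar_rot_avg)
  finally show ?thesis
    using ennreal_inverse_mult_of_nat[OF card_edges_pos[OF n]] by (simp add: mult.assoc[symmetric])
qed

lemma nn_integral_haar_kac_op_funpow:
  assumes n: "2 \<le> n" and f: "f \<in> borel_measurable (Rn n)"
  shows "(\<integral>\<^sup>+x. (kac_op n ^^ m) f x \<partial>haar n) = (\<integral>\<^sup>+x. f x \<partial>haar n)"
  by (induction m) (simp_all add: nn_integral_haar_kac_op[OF n measurable_kac_op_funpow[OF f]])

text \<open>Only the origin is not projected onto the sphere: division by zero sends it to the zero
  vector. It is a Lebesgue null set.\<close>

lemma AE_haar_sphere:
  assumes n: "0 < n"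
  shows "AE x in haar n. x \<in> sphere_n n"
proof -
  let ?Z = "PiE {..<n} (\<lambda>_. {0::real})"
  have Z: "?Z \<in> null_sets (Rn n)"
  proof (rule null_setsI)
    show "?Z \<in> sets (Rn n)"
      unfolding Rn_def by (intro sets_PiM_I_finite) auto
    have "emeasure (Rn n) ?Z = (\<Prod>i<n. emeasure lborel {0::real})"
      unfolding Rn_def by (rule lborels.emeasure_PiM) auto
    thus "emeasure (Rn n) ?Z = 0" using n by simp
  qed
  have "AE x in Rn n. x \<in> ball_n n \<longrightarrow> radial n x \<in> sphere_n n"
  proof (rule AE_I[OF _ _ ])
    show "{x \<in> space (Rn n). \<not> (x \<in> ball_n n \<longrightarrow> radial n x \<in> sphere_n n)} \<subseteq> ?Z"
    proof (rule subsetI)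
      fix x assume "x \<in> {x \<in> space (Rn n). \<not> (x \<in> ball_n n \<longrightarrow> radial n x \<in> sphere_n n)}"
      hence x: "x \<in> space (Rn n)" "radial n x \<notin> sphere_n n" by auto
      have "sqnorm n x = 0"
      proof (rule ccontr)
        assume nz: "sqnorm n x \<noteq> 0"
        have "sqnorm n (radial n x) = (\<Sum>i<n. (x i)\<^sup>2 / sqnorm n x)"
          unfolding sqnorm_def[of n "radial n x"]
          by (intro sum.cong) (auto simp: radial_def power_divide sqnorm_nonneg)
        also have "\<dots> = 1" using nz by (simp add: sum_divide_distrib[symmetric] sqnorm_def[symmetric])
        finally show False
          using x measurable_space[OF measurable_radial x(1)] by (simp add: sphere_n_def)
      qed
      hence "x i = 0" if "i < n" for i
        using sqnorm_ge_component[OF that, of x] by simp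
      thus "x \<in> ?Z" using x by (intro PiE_I) (auto simp: Rn_def space_PiM PiE_def extensional_def)
    qed
  qed (use Z in auto)
  thus ?thesis
    unfolding haar_eq by (subst AE_distr_iff) (auto intro!: AE_uniform_measureI)
qed


section \<open>Small coordinates and hyperplanes under the uniform measure\<close>

lemma angle_cos2_le:
  assumes "0 \<le> \<eta>"
  shows "emeasure angle {\<theta>. (cos \<theta>)\<^sup>2 \<le> \<eta>} \<le> ennreal (sqrt \<eta>)"
    and "emeasure angle {\<theta>. (sin \<theta>)\<^sup>2 \<le> \<eta>} \<le> ennreal (sqrt \<eta>)"
proof -
  have [measurable, simp]: "{\<theta>. (cos \<theta>)\<^sup>2 \<le> \<eta>} \<in> sets borel" "{\<theta>. (sin \<theta>)\<^sup>2 \<le> \<eta>} \<in> sets borel"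
    by measurable
  have four: "ennreal (1 / 4) * (4 * c) = c" for c
  proof -
    have "ennreal (1 / 4) * 4 = ennreal (1 / 4) * ennreal 4" by simp
    also have "\<dots> = 1" by (subst ennreal_mult[symmetric]) auto
    finally show ?thesis by (simp add: mult.assoc[symmetric])
  qed
  have "(\<integral>\<^sup>+\<theta>. indicator {\<theta>. (cos \<theta>)\<^sup>2 \<le> \<eta>} \<theta> \<partial>angle)
      = ennreal (1 / 4) * (\<integral>\<^sup>+\<phi>. 4 * indicator {\<theta>. (cos \<theta>)\<^sup>2 \<le> \<eta>} \<phi> \<partial>quadrant)"
    by (subst angle_quadrants) (auto intro!: arg_cong2[where f = "(*)"] nn_integral_cong simp: indicator_def)
  also have "\<dots> = emeasure quadrant {\<theta>. (cos \<theta>)\<^sup>2 \<le> \<eta>}"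
    by (subst nn_integral_cmult) (simp_all add: four borel_measurable_indicator_iff)
  finally show "emeasure angle {\<theta>. (cos \<theta>)\<^sup>2 \<le> \<eta>} \<le> ennreal (sqrt \<eta>)"
    using quadrant_cos2_le[OF assms] by simp
  have "(\<integral>\<^sup>+\<theta>. indicator {\<theta>. (sin \<theta>)\<^sup>2 \<le> \<eta>} \<theta> \<partial>angle)
      = ennreal (1 / 4) * (\<integral>\<^sup>+\<phi>. 4 * indicator {\<theta>. (sin \<theta>)\<^sup>2 \<le> \<eta>} \<phi> \<partial>quadrant)"
    by (subst angle_quadrants) (auto intro!: arg_cong2[where f = "(*)"] nn_integral_cong simp: indicator_def)
  also have "\<dots> = emeasure quadrant {\<theta>. (sin \<theta>)\<^sup>2 \<le> \<eta>}"
    by (subst nn_integral_cmult) (simp_all add: four borel_measurable_indicator_iff)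
  finally show "emeasure angle {\<theta>. (sin \<theta>)\<^sup>2 \<le> \<eta>} \<le> ennreal (sqrt \<eta>)"
    using quadrant_sin2_le[OF assms] by simp
qed

text \<open>The squared sine has a density, hence no atoms; the squared cosine is one minus
  it.\<close>

lemma angle_atom:
  shows "emeasure angle {\<theta>. (sin \<theta>)\<^sup>2 = \<kappa>} = 0" and "emeasure angle {\<theta>. (cos \<theta>)\<^sup>2 = \<kappa>} = 0"
proof -
  have *: "emeasure angle {\<theta>. (sin \<theta>)\<^sup>2 = \<kappa>} = 0" for \<kappa>
  proof -
    have "(\<integral>\<^sup>+\<phi>. indicator {\<kappa>} (0 + 1 * (sin \<phi>)\<^sup>2) \<partial>quadrant) = (\<integral>\<^sup>+w. ennreal (arcsine 0 (0 + 1) w) * indicator {\<kappa>} w \<partial>lborel)"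
      by (rule nn_integral_arcsine) auto
    also have "\<dots> = (\<integral>\<^sup>+w. 0 \<partial>(lborel :: real measure))"
      by (intro nn_integral_cong_AE eventually_mono[OF AE_lborel_singleton[of \<kappa>]]) auto
    finally have q: "(\<integral>\<^sup>+\<phi>. indicator {\<kappa>} ((sin \<phi>)\<^sup>2) \<partial>quadrant) = 0" by simp
    have "emeasure angle {\<theta>. (sin \<theta>)\<^sup>2 = \<kappa>} = (\<integral>\<^sup>+\<theta>. indicator {\<theta>. (sin \<theta>)\<^sup>2 = \<kappa>} \<theta> \<partial>angle)"
      by simp
    also have "\<dots> = ennreal (1 / 4) * (\<integral>\<^sup>+\<phi>. 4 * indicator {\<kappa>} ((sin \<phi>)\<^sup>2) \<partial>quadrant)"
      by (subst angle_quadrants) (auto intro!: arg_cong2[where f = "(*)"] nn_integral_cong simp: indicator_def)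
    also have "\<dots> = 0"
      using q by (subst nn_integral_cmult) auto
    finally show ?thesis .
  qed
  show "emeasure angle {\<theta>. (sin \<theta>)\<^sup>2 = \<kappa>} = 0" by (rule *)
  have "{\<theta>. (cos \<theta>)\<^sup>2 = \<kappa>} = {\<theta>. (sin \<theta>)\<^sup>2 = 1 - \<kappa>}" by (auto simp: sin_squared_eq)
  thus "emeasure angle {\<theta>. (cos \<theta>)\<^sup>2 = \<kappa>} = 0" using * by simp
qed

text \<open>By invariance, \<open>(x i)\<^sup>2\<close> may be replaced by \<open>r cos\<^sup>2 \<theta>\<close> with \<open>r = (x i)\<^sup>2 + (x k)\<^sup>2\<close> and a uniform \<open>\<theta>\<close>.\<close>

lemma haar_invariant_bound:
  assumes n: "0 < n" and ik: "i < n" "k < n" "i \<noteq> k" and P: "Measurable.pred (borel \<Otimes>\<^sub>M borel) (\<lambda>(s, r). P s r)"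
    and bound: "\<And>r. 0 \<le> r \<Longrightarrow> emeasure angle {\<theta>. P (r * (cos \<theta>)\<^sup>2) r} \<le> b"
      "\<And>r. 0 \<le> r \<Longrightarrow> emeasure angle {\<theta>. P (r * (sin \<theta>)\<^sup>2) r} \<le> b"
  shows "emeasure (haar n) {x \<in> space (Rn n). P ((x i)\<^sup>2) ((x i)\<^sup>2 + (x k)\<^sup>2)} \<le> b"
proof -
  let ?A = "{x \<in> space (Rn n). P ((x i)\<^sup>2) ((x i)\<^sup>2 + (x k)\<^sup>2)}"
  note [measurable] = Rn_component[OF ik(1)] Rn_component[OF ik(2)]
  have "Measurable.pred (Rn n) (\<lambda>x. case ((x i)\<^sup>2, (x i)\<^sup>2 + (x k)\<^sup>2) of (s, r) \<Rightarrow> P s r)"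
    by (rule measurable_compose[OF _ P]) measurable
  hence A[measurable]: "?A \<in> sets (Rn n)" by simp
  interpret haar: prob_space "haar n" using n by (rule prob_space_haar)
  \<comment> \<open>Pairs are ordered, so \<open>i\<close> may come first or second and its new
    coordinate may carry the cosine or the sine. This is why both bounds are assumed.\<close>
  define e where "e = (min i k, max i k)"
  have e: "e \<in> edges n" using ik by (auto simp: e_def edges_def)
  have "rot_avg e (indicator ?A) x \<le> b" if x: "x \<in> space (Rn n)" for x
  proof -
    define r where "r = (x i)\<^sup>2 + (x k)\<^sup>2"
    have r: "0 \<le> r" by (simp add: r_def)
    have sq: "(sqrt r * u)\<^sup>2 = r * u\<^sup>2" for u using r by (simp add: power_mult_distrib)
    have sum: "r * (cos \<theta>)\<^sup>2 + r * (sin \<theta>)\<^sup>2 = r" for \<theta>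
      by (simp add: sin_squared_eq algebra_simps)
    have meas: "{\<theta>. P (r * (cos \<theta>)\<^sup>2) r} \<in> sets borel" "{\<theta>. P (r * (sin \<theta>)\<^sup>2) r} \<in> sets borel"
      using measurable_compose[OF _ P, of "\<lambda>\<theta>. (r * (cos \<theta>)\<^sup>2, r)" borel]
        measurable_compose[OF _ P, of "\<lambda>\<theta>. (r * (sin \<theta>)\<^sup>2, r)" borel] by auto
    show ?thesis
    proof (cases "i < k")
      case True
      hence e': "e = (i, k)" by (simp add: e_def)
      have "rot_avg e (indicator ?A) x = (\<integral>\<^sup>+\<theta>. indicator {\<theta>. P (r * (cos \<theta>)\<^sup>2) r} \<theta> \<partial>angle)"
        unfolding e' using e ik x
        by (subst rot_avg_polar[where n = n and r = r])
          (auto intro!: nn_integral_cong simp: e' r_def[symmetric] indicator_def space_Rn_upd sq sum)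
      thus ?thesis using bound(1)[OF r] meas by simp
    next
      case False
      hence e': "e = (k, i)" using ik by (simp add: e_def)
      have "rot_avg e (indicator ?A) x = (\<integral>\<^sup>+\<theta>. indicator {\<theta>. P (r * (sin \<theta>)\<^sup>2) r} \<theta> \<partial>angle)"
        unfolding e' using e ik x
        by (subst rot_avg_polar[where n = n and r = r])
          (auto intro!: nn_integral_cong simp: e' r_def indicator_def space_Rn_upd sq[unfolded r_def] sum[unfolded r_def] add.commute)
      thus ?thesis using bound(2)[OF r] meas by simp
    qed
  qed
  hence "(\<integral>\<^sup>+x. rot_avg e (indicator ?A) x \<partial>haar n) \<le> (\<integral>\<^sup>+x. b \<partial>haar n)"
    by (intro nn_integral_mono) simp
  hence "(\<integral>\<^sup>+x. indicator ?A x \<partial>haar n) \<le> b"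
    using haar.emeasure_space_1 by (simp add: nn_integral_haar_rot_avg[OF n e])
  thus ?thesis by simp
qed

text \<open>On the sphere some coordinate \<open>k\<close> has square at least 1/n, and \<delta> <
  1/n excludes \<open>k = i\<close>. After randomizing the pair of \<open>i\<close> and
  \<open>k\<close>, whose radius squared is at least 1/n, a small \<open>(x i)\<^sup>2\<close>
  forces a squared cosine or sine of at most n \<delta>. The union over \<open>k\<close> costs the
  outer factor n.\<close>

lemma haar_small_coordinate:
  assumes n: "2 \<le> n" and i: "i < n" and \<delta>: "0 \<le> \<delta>" "\<delta> < 1 / n"
  shows "emeasure (haar n) {x \<in> space (Rn n). (x i)\<^sup>2 \<le> \<delta>} \<le> ennreal (n * sqrt (n * \<delta>))"
proof -
  have pos: "0 < n" using n by simp
  let ?B = "\<lambda>k. {x \<in> space (Rn n). (x i)\<^sup>2 \<le> \<delta> \<and> 1 / n \<le> (x i)\<^sup>2 + (x k)\<^sup>2}"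
  have meas: "?B k \<in> sets (Rn n)" if "k < n" for k
    using i that by measurable
  have measA: "{x \<in> space (Rn n). (x i)\<^sup>2 \<le> \<delta>} \<in> sets (Rn n)"
    using i by measurable
  have small: "emeasure (haar n) (?B k) \<le> ennreal (sqrt (n * \<delta>))" if k: "k < n" "i \<noteq> k" for k
  proof (rule haar_invariant_bound[OF pos i k, where P = "\<lambda>s r. s \<le> \<delta> \<and> 1 / n \<le> r"])
    fix r :: real assume r: "0 \<le> r"
    have *: "t \<le> n * \<delta>" if "r * t \<le> \<delta>" "1 / n \<le> r" "0 \<le> t" for t
    proof -
      have "1 / n * t \<le> \<delta>" using that mult_right_mono[of "1 / n" r t] by linarith
      thus ?thesis using pos by (simp add: field_simps)
    qed
    have "emeasure angle {\<theta>. r * (cos \<theta>)\<^sup>2 \<le> \<delta> \<and> 1 / n \<le> r} \<le> emeasure angle {\<theta>. (cos \<theta>)\<^sup>2 \<le> n * \<delta>}"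
      using * by (intro emeasure_mono) auto
    also have "\<dots> \<le> ennreal (sqrt (n * \<delta>))" using \<delta> by (intro angle_cos2_le) auto
    finally show "emeasure angle {\<theta>. r * (cos \<theta>)\<^sup>2 \<le> \<delta> \<and> 1 / n \<le> r} \<le> ennreal (sqrt (n * \<delta>))" .
    have "emeasure angle {\<theta>. r * (sin \<theta>)\<^sup>2 \<le> \<delta> \<and> 1 / n \<le> r} \<le> emeasure angle {\<theta>. (sin \<theta>)\<^sup>2 \<le> n * \<delta>}"
      using * by (intro emeasure_mono) auto
    also have "\<dots> \<le> ennreal (sqrt (n * \<delta>))" using \<delta> by (intro angle_cos2_le) auto
    finally show "emeasure angle {\<theta>. r * (sin \<theta>)\<^sup>2 \<le> \<delta> \<and> 1 / n \<le> r} \<le> ennreal (sqrt (n * \<delta>))" .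
  qed measurable
  have "emeasure (haar n) {x \<in> space (Rn n). (x i)\<^sup>2 \<le> \<delta>} \<le> emeasure (haar n) (\<Union>k\<in>{..<n} - {i}. ?B k)"
  proof (rule emeasure_mono_AE)
    show "AE x in haar n. x \<in> {x \<in> space (Rn n). (x i)\<^sup>2 \<le> \<delta>} \<longrightarrow> x \<in> (\<Union>k\<in>{..<n} - {i}. ?B k)"
    proof (rule eventually_mono[OF AE_haar_sphere[OF pos]], rule impI)
      fix x assume x: "x \<in> sphere_n n" "x \<in> {x \<in> space (Rn n). (x i)\<^sup>2 \<le> \<delta>}"
      have "\<exists>k<n. 1 / n \<le> (x k)\<^sup>2"
      proof (rule ccontr)
        assume "\<not> ?thesis"
        hence "(\<Sum>k<n. (x k)\<^sup>2) < (\<Sum>k<n. 1 / n)"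
          using pos by (intro sum_strict_mono) (auto simp: not_le)
        thus False using x pos by (simp add: sphere_n_def sqnorm_def)
      qed
      then obtain k where k: "k < n" "1 / n \<le> (x k)\<^sup>2" by blast
      hence "k \<noteq> i" using x \<delta> by auto
      moreover have "1 / n \<le> (x i)\<^sup>2 + (x k)\<^sup>2" using k(2) by (simp add: add_increasing)
      ultimately show "x \<in> (\<Union>k\<in>{..<n} - {i}. ?B k)" using x k(1) by blast
    qed
  qed (use meas in auto)
  also have "\<dots> \<le> (\<Sum>k\<in>{..<n} - {i}. emeasure (haar n) (?B k))"
    by (rule emeasure_subadditive_finite) (use meas in auto)
  also have "\<dots> \<le> (\<Sum>k\<in>{..<n} - {i}. ennreal (sqrt (n * \<delta>)))"
    by (intro sum_mono small) auto
  also have "\<dots> \<le> (\<Sum>k<n. ennreal (sqrt (n * \<delta>)))"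
    by (intro sum_mono2) auto
  also have "\<dots> = ennreal (n * sqrt (n * \<delta>))"
    using \<delta> by (simp add: ennreal_of_nat_eq_real_of_nat ennreal_mult)
  finally show ?thesis .
qed

text \<open>Randomizing a pair shows nothing when its radius is zero, so that case is split off into
  a vanishing coordinate, which is null by the previous bound with \<delta> = 0. Elsewhere the
  squared cosine or sine would have to hit a single value.\<close>

lemma haar_hyperplane:
  assumes n: "2 \<le> n" and i: "i < n"
  shows "emeasure (haar n) {x \<in> space (Rn n). x i = c} = 0"
proof -
  have pos: "0 < n" using n by simp
  define k where "k = (if i = 0 then 1 else 0 :: nat)"
  have k: "k < n" "i \<noteq> k" using n by (auto simp: k_def)
  let ?Z = "{x \<in> space (Rn n). (x i)\<^sup>2 \<le> 0}"
  let ?N = "{x \<in> space (Rn n). (x i)\<^sup>2 = c\<^sup>2 \<and> (x i)\<^sup>2 + (x k)\<^sup>2 \<noteq> 0}"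
  have [measurable]: "?Z \<in> sets (Rn n)" "?N \<in> sets (Rn n)"
    using i k by measurable
  have "emeasure (haar n) ?Z = 0"
    using haar_small_coordinate[OF n i, of 0] pos by simp
  moreover have "emeasure (haar n) ?N \<le> 0"
  proof (rule haar_invariant_bound[OF pos i k, where P = "\<lambda>s r. s = c\<^sup>2 \<and> r \<noteq> 0"])
    fix r :: real
    have *: "t = c\<^sup>2 / r" if "r * t = c\<^sup>2" "r \<noteq> 0" for t
      using that by (simp add: field_simps)
    have "emeasure angle {\<theta>. r * (cos \<theta>)\<^sup>2 = c\<^sup>2 \<and> r \<noteq> 0} \<le> emeasure angle {\<theta>. (cos \<theta>)\<^sup>2 = c\<^sup>2 / r}"
      using * by (intro emeasure_mono) auto
    thus "emeasure angle {\<theta>. r * (cos \<theta>)\<^sup>2 = c\<^sup>2 \<and> r \<noteq> 0} \<le> 0" by (simp add: angle_atom)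
    have "emeasure angle {\<theta>. r * (sin \<theta>)\<^sup>2 = c\<^sup>2 \<and> r \<noteq> 0} \<le> emeasure angle {\<theta>. (sin \<theta>)\<^sup>2 = c\<^sup>2 / r}"
      using * by (intro emeasure_mono) auto
    thus "emeasure angle {\<theta>. r * (sin \<theta>)\<^sup>2 = c\<^sup>2 \<and> r \<noteq> 0} \<le> 0" by (simp add: angle_atom)
  qed measurable
  ultimately have "?Z \<union> ?N \<in> null_sets (haar n)"
    by (intro null_sets.Un null_setsI) (simp_all only: sets_haar le_zero_eq, measurable)
  moreover have "{x \<in> space (Rn n). x i = c} \<subseteq> ?Z \<union> ?N" by auto
  moreover have "{x \<in> space (Rn n). x i = c} \<in> sets (Rn n)"
    using i by measurable
  ultimately show ?thesis
    using null_sets_subset[of "?Z \<union> ?N" "haar n"] by (auto simp: null_sets_def)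
qed

section \<open>Coalescence along a fixed sequence of pairs\<close>

text \<open>\<open>label es\<close> is constant on the components of the graph with edge list \<open>es\<close>; the head of the list
  is the first step in time and the last edge to be added.\<close>

primrec label :: "(nat \<times> nat) list \<Rightarrow> nat \<Rightarrow> nat" where
  "label [] = (\<lambda>k. k)"
| "label (e # es) = (\<lambda>k. if label es k = label es (snd e) then label es (fst e) else label es k)"

text \<open>For the difference \<open>D\<close> of squared coordinates, zero sums say that both
  states give the same mass to each class. The absolute sums are bounded class by class because
  their total over all classes may grow when a class splits, while this bound is inherited without
  loss.\<close>

definition balanced :: "nat \<Rightarrow> (nat \<Rightarrow> nat) \<Rightarrow> real \<Rightarrow> (nat \<Rightarrow> real) \<Rightarrow> bool" where
  "balanced n L \<epsilon> D \<longleftrightarrow> (\<forall>c. (\<Sum>k | k < n \<and> L k = c. D k) = 0 \<and> (\<Sum>k | k < n \<and> L k = c. \<bar>D k\<bar>) \<le> \<epsilon>)"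

lemma balanced_redistribute:
  assumes bal: "balanced n L \<epsilon> D" and ij: "i < n" "j < n" "i \<noteq> j" "L i = L j"
    and sum: "\<alpha> + \<beta> = D i + D j" "\<bar>\<alpha>\<bar> + \<bar>\<beta>\<bar> \<le> \<bar>D i\<bar> + \<bar>D j\<bar>"
  shows "balanced n L \<epsilon> (D(i := \<alpha>, j := \<beta>))"
  unfolding balanced_def
proof
  fix c
  let ?C = "{k. k < n \<and> L k = c}" and ?D = "D(i := \<alpha>, j := \<beta>)"
  have c: "sum D ?C = 0" "(\<Sum>k\<in>?C. \<bar>D k\<bar>) \<le> \<epsilon>" using bal by (auto simp: balanced_def)
  show "sum ?D ?C = 0 \<and> (\<Sum>k\<in>?C. \<bar>?D k\<bar>) \<le> \<epsilon>"
  proof (cases "c = L i")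
    case True
    have pair: "sum f ?C = sum f (?C - {i, j}) + f i + f j" for f :: "nat \<Rightarrow> real"
      using ij True by (intro sum_remove_pair) auto
    have rest: "sum ?D (?C - {i, j}) = sum D (?C - {i, j})" "(\<Sum>k\<in>?C - {i, j}. \<bar>?D k\<bar>) = (\<Sum>k\<in>?C - {i, j}. \<bar>D k\<bar>)"
      by (auto intro!: sum.cong)
    have ends: "?D i = \<alpha>" "?D j = \<beta>" using ij by auto
    have "sum ?D ?C = sum D ?C"
      unfolding pair[of ?D] pair[of D] rest ends using sum(1) by linarith
    moreover have "(\<Sum>k\<in>?C. \<bar>?D k\<bar>) \<le> (\<Sum>k\<in>?C. \<bar>D k\<bar>)"
      unfolding pair[of "\<lambda>k. \<bar>?D k\<bar>"] pair[of "\<lambda>k. \<bar>D k\<bar>"] rest ends using sum(2) by linarith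
    ultimately show ?thesis using c by linarith
  next
    case False
    hence "sum ?D ?C = sum D ?C" "(\<Sum>k\<in>?C. \<bar>?D k\<bar>) = (\<Sum>k\<in>?C. \<bar>D k\<bar>)"
      using ij by (auto intro!: sum.cong)
    thus ?thesis using c by simp
  qed
qed

text \<open>Both halves of a split class inherit the \<open>\<ell>\<^sup>1\<close> bound of the whole: the discrepancy moved
  into one half is the total discrepancy of the other one.\<close>

lemma balanced_split:
  assumes bal: "balanced n (\<lambda>k. if L k = L j then L i else L k) \<epsilon> D"
    and ij: "i < n" "j < n" "L i \<noteq> L j"
  defines "A \<equiv> \<Sum>k\<in>{k. k < n \<and> L k = L j} - {j}. D k" and "B \<equiv> \<Sum>k\<in>{k. k < n \<and> L k = L i} - {i}. D k"
  shows "balanced n L \<epsilon> (D(i := - B, j := - A))" and "\<bar>A\<bar> \<le> \<epsilon>" and "\<bar>B\<bar> \<le> \<epsilon>" and "A + B + D i + D j = 0"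
proof -
  let ?L = "\<lambda>k. if L k = L j then L i else L k" and ?D = "D(i := - B, j := - A)"
  let ?P = "{k. k < n \<and> L k = L i} - {i}" and ?Q = "{k. k < n \<and> L k = L j} - {j}"
  have fin: "finite ?P" "finite ?Q" by auto
  have ne: "i \<noteq> j" using ij by auto
  have split: "sum f {k. k < n \<and> ?L k = L i} = sum f ?P + sum f ?Q + f i + f j" for f :: "nat \<Rightarrow> real"
  proof -
    have eq: "{k. k < n \<and> ?L k = L i} - {i, j} = ?P \<union> ?Q" using ij ne by auto
    have "sum f {k. k < n \<and> ?L k = L i} = sum f (?P \<union> ?Q) + f i + f j"
      unfolding eq[symmetric] using ij ne by (intro sum_remove_pair) auto
    also have "sum f (?P \<union> ?Q) = sum f ?P + sum f ?Q"
      using ij by (intro sum.union_disjoint) auto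
    finally show ?thesis .
  qed
  have tot: "sum D {k. k < n \<and> ?L k = L i} = 0" "(\<Sum>k | k < n \<and> ?L k = L i. \<bar>D k\<bar>) \<le> \<epsilon>"
    using bal unfolding balanced_def by blast+
  show AB: "A + B + D i + D j = 0"
    using tot(1) split[of D] by (simp add: A_def B_def)
  define a where "a = (\<Sum>k\<in>?Q. \<bar>D k\<bar>)"
  define b where "b = (\<Sum>k\<in>?P. \<bar>D k\<bar>)"
  have le: "b + a + \<bar>D i\<bar> + \<bar>D j\<bar> \<le> \<epsilon>"
    using tot(2) split[of "\<lambda>k. \<bar>D k\<bar>"] by (simp add: a_def b_def)
  have Aa: "\<bar>A\<bar> \<le> a" "\<bar>B\<bar> \<le> b" unfolding A_def B_def a_def b_def by (rule sum_abs)+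
  have 0: "0 \<le> a" "0 \<le> b" unfolding a_def b_def by (auto intro: sum_nonneg)
  show "\<bar>A\<bar> \<le> \<epsilon>" "\<bar>B\<bar> \<le> \<epsilon>" using Aa le 0 by linarith+
  show "balanced n L \<epsilon> ?D"
    unfolding balanced_def
  proof
    fix c
    let ?C = "{k. k < n \<and> L k = c}"
    consider (i) "c = L i" | (j) "c = L j" | (other) "c \<noteq> L i" "c \<noteq> L j" by blast
    thus "sum ?D ?C = 0 \<and> (\<Sum>k\<in>?C. \<bar>?D k\<bar>) \<le> \<epsilon>"
    proof cases
      case i
      have rem: "sum f ?C = f i + sum f ?P" for f :: "nat \<Rightarrow> real"
        unfolding i using ij by (intro sum.remove) auto
      have "?D k = D k" if "k \<in> ?P" for k
        using that ij by auto
      hence "sum ?D ?P = sum D ?P" "(\<Sum>k\<in>?P. \<bar>?D k\<bar>) = b"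
        unfolding b_def by (auto intro!: sum.cong)
      hence "sum ?D ?P = B" "(\<Sum>k\<in>?P. \<bar>?D k\<bar>) = b"
        by (simp_all add: B_def)
      moreover have "?D i = - B" using ne by simp
      ultimately have "sum ?D ?C = - B + B" "(\<Sum>k\<in>?C. \<bar>?D k\<bar>) = \<bar>- B\<bar> + b"
        unfolding rem by simp_all
      thus ?thesis
        using AB Aa le by linarith
    next
      case j
      have rem: "sum f ?C = f j + sum f ?Q" for f :: "nat \<Rightarrow> real"
        unfolding j using ij by (intro sum.remove) auto
      have "?D k = D k" if "k \<in> ?Q" for k
        using that ij by auto
      hence "sum ?D ?Q = sum D ?Q" "(\<Sum>k\<in>?Q. \<bar>?D k\<bar>) = a"
        unfolding a_def by (auto intro!: sum.cong)
      hence "sum ?D ?Q = A" "(\<Sum>k\<in>?Q. \<bar>?D k\<bar>) = a"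
        by (simp_all add: A_def)
      moreover have "?D j = - A" using ne by simp
      ultimately have "sum ?D ?C = - A + A" "(\<Sum>k\<in>?C. \<bar>?D k\<bar>) = \<bar>- A\<bar> + a"
        unfolding rem by simp_all
      thus ?thesis
        using AB Aa le by linarith
    next
      case other
      have C: "?C = {k. k < n \<and> ?L k = c}" using other by auto
      have "sum D ?C = 0" "(\<Sum>k\<in>?C. \<bar>D k\<bar>) \<le> \<epsilon>"
        unfolding C using bal[unfolded balanced_def, rule_format, of c] by blast+
      moreover have "sum ?D ?C = sum D ?C" "(\<Sum>k\<in>?C. \<bar>?D k\<bar>) = (\<Sum>k\<in>?C. \<bar>D k\<bar>)"
        using other by (auto intro!: sum.cong)
      ultimately show ?thesis by simp
    qed
  qed
qed

text \<open>Only indices alone in their class are constrained: they take part in no later step,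
  whereas any other index receives fresh signs before it is isolated.\<close>

definition same_signs :: "nat \<Rightarrow> (nat \<Rightarrow> nat) \<Rightarrow> (nat \<Rightarrow> real) \<Rightarrow> (nat \<Rightarrow> real) \<Rightarrow> bool" where
  "same_signs n L x y \<longleftrightarrow> (\<forall>k<n. (\<forall>l<n. l \<noteq> k \<longrightarrow> L l \<noteq> L k) \<longrightarrow> 0 \<le> x k * y k)"

text \<open>An index other than \<open>i\<close> and \<open>j\<close> that is alone in the finer
  partition was already alone before the split and has not moved since.\<close>

lemma same_signs_upd:
  assumes "same_signs n (\<lambda>k. if L k = L j then L i else L k) x y" "i < n" "j < n" "0 \<le> u * u'" "0 \<le> v * v'"
  shows "same_signs n L (x(i := u, j := v)) (y(i := u', j := v'))"
  unfolding same_signs_def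
proof (intro allI impI)
  fix k assume k: "k < n" "\<forall>l<n. l \<noteq> k \<longrightarrow> L l \<noteq> L k"
  show "0 \<le> (x(i := u, j := v)) k * (y(i := u', j := v')) k"
  proof (cases "k = i \<or> k = j")
    case True
    thus ?thesis using assms by auto
  next
    case False
    hence "L k \<noteq> L i" "L k \<noteq> L j" using k assms(2,3) by metis+
    hence "\<forall>l<n. l \<noteq> k \<longrightarrow> (if L l = L j then L i else L l) \<noteq> (if L k = L j then L i else L k)"
      using k by auto
    thus ?thesis using assms(1) k False unfolding same_signs_def by auto
  qed
qed

text \<open>The summand \<open>1\<close> gives up on the steps at which \<open>y\<close> has a small coordinate, where the two
  arcsine laws need not be close.\<close>

primrec path_err :: "real \<Rightarrow> real \<Rightarrow> (nat \<times> nat) list \<Rightarrow> (nat \<Rightarrow> real) \<Rightarrow> ennreal" where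
  "path_err \<epsilon> \<delta> [] = (\<lambda>y. 0)"
| "path_err \<epsilon> \<delta> (e # es) = (\<lambda>y. rot_avg e (path_err \<epsilon> \<delta> es) y + ennreal (2 * sqrt (\<epsilon> / \<delta>))
      + (if (y (fst e))\<^sup>2 \<le> \<delta> then 1 else 0))"

lemma measurable_path_err:
  "set es \<subseteq> edges n \<Longrightarrow> path_err \<epsilon> \<delta> es \<in> borel_measurable (Rn n)"
proof (induction es)
  case (Cons e es)
  hence e: "e \<in> edges n" "fst e < n" by (auto simp: edges_def)
  have "rot_avg e (path_err \<epsilon> \<delta> es) \<in> borel_measurable (Rn n)"
    using Cons e by (intro measurable_rot_avg) auto
  moreover note Rn_component[OF e(2), measurable]
  ultimately show ?case by simp
qed simp

text \<open>This is the matching stage as an inequality between expectations. At each step the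
  angles of \<open>x\<close> and \<open>y\<close> are paired so that the invariant holds for the
  partition of the remaining pairs, and the induction hypothesis is integrated over the paired
  angles. The error follows \<open>y\<close> only, because its small coordinates will be controlled
  by the uniform measure.\<close>

lemma path_avg_matched:
  assumes f: "f \<in> borel_measurable (Rn n)" "\<And>x. f x \<le> 1"
    and \<epsilon>\<delta>: "0 \<le> \<epsilon>" "\<epsilon> \<le> \<delta>" "0 < \<delta>"
  shows "set es \<subseteq> edges n \<Longrightarrow> x \<in> space (Rn n) \<Longrightarrow> y \<in> space (Rn n)
    \<Longrightarrow> balanced n (label es) \<epsilon> (\<lambda>k. (x k)\<^sup>2 - (y k)\<^sup>2) \<Longrightarrow> same_signs n (label es) x y
    \<Longrightarrow> path_avg es f x \<le> path_avg es f y + path_err \<epsilon> \<delta> es y"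
proof (induction es arbitrary: x y)
  case Nil
  \<comment> \<open>With no pairs left all classes are singletons: zero sums make the squares equal,
    and matching signs make the coordinates equal.\<close>
  have "x k = y k" if k: "k < n" for k
  proof -
    have "{l. l < n \<and> l = k} = {k}" using k by auto
    moreover have "(\<Sum>l | l < n \<and> label [] l = k. (x l)\<^sup>2 - (y l)\<^sup>2) = 0"
      using Nil(4) unfolding balanced_def by blast
    ultimately have "(x k)\<^sup>2 - (y k)\<^sup>2 = 0" by simp
    moreover have "0 \<le> x k * y k" using Nil(5) k by (auto simp: same_signs_def)
    ultimately have "x k = y k \<or> x k = - y k" "0 \<le> x k * y k"
      by (simp_all add: power2_eq_iff)
    thus ?thesis
    proof (elim disjE)
      assume "x k = - y k" "0 \<le> x k * y k"
      moreover have "0 \<le> y k * y k" by simp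
      ultimately have "y k * y k = 0" by simp
      thus ?thesis using \<open>x k = - y k\<close> by simp
    qed
  qed
  hence "x = y" using Nil(2,3) by (auto simp: Rn_def space_PiM PiE_def intro!: extensionalityI)
  thus ?case by simp
next
  case (Cons e es)
  obtain i j where e: "e = (i, j)" by (cases e)
  have ij: "(i, j) \<in> edges n" "i < n" "j < n" "i \<noteq> j" and es: "set es \<subseteq> edges n"
    using Cons.prems(1) by (auto simp: e edges_def)
  let ?L = "label es"
  define D where "D k = (x k)\<^sup>2 - (y k)\<^sup>2" for k
  define r where "r = (x i)\<^sup>2 + (x j)\<^sup>2"
  define s where "s = (y i)\<^sup>2 + (y j)\<^sup>2"
  have rs0: "0 \<le> r" "0 \<le> s" by (auto simp: r_def s_def)
  have rs: "r - s = D i + D j" by (simp add: r_def s_def D_def)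
  have bal: "balanced n (\<lambda>k. if ?L k = ?L j then ?L i else ?L k) \<epsilon> D"
    and sgn: "same_signs n (\<lambda>k. if ?L k = ?L j then ?L i else ?L k) x y"
    using Cons.prems(4,5) unfolding e label.simps fst_conv snd_conv D_def[abs_def] by simp_all
  note mavg = measurable_path_avg[OF es f(1)] and merr = measurable_path_err[OF es, of \<epsilon> \<delta>]
  let ?F = "\<lambda>u v. path_avg es f (x(i := u, j := v))" and ?G = "\<lambda>u v. path_avg es f (y(i := u, j := v))"
    and ?H = "\<lambda>u v. path_err \<epsilon> \<delta> es (y(i := u, j := v))"
  note meas = measurable_upd_plane[OF ij(2,3) mavg Cons.prems(2)] measurable_upd_plane[OF ij(2,3) mavg Cons.prems(3)]
    measurable_upd_plane[OF ij(2,3) merr Cons.prems(3)]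
  have polar: "(\<lambda>\<theta>. g (sqrt c * cos \<theta>) (sqrt c * sin \<theta>)) \<in> borel_measurable borel"
    if g: "case_prod g \<in> borel_measurable (borel \<Otimes>\<^sub>M borel)" for g :: "real \<Rightarrow> real \<Rightarrow> ennreal" and c
    using measurable_compose[OF _ g, of "\<lambda>\<theta>. (sqrt c * cos \<theta>, sqrt c * sin \<theta>)" borel] by simp
  have step: "?F u v \<le> ?G u' v' + ?H u' v'"
    if bal': "balanced n ?L \<epsilon> (D(i := u\<^sup>2 - u'\<^sup>2, j := v\<^sup>2 - v'\<^sup>2))" and "0 \<le> u * u'" "0 \<le> v * v'" for u v u' v'
  proof (rule Cons.IH[OF es])
    have "(\<lambda>k. ((x(i := u, j := v)) k)\<^sup>2 - ((y(i := u', j := v')) k)\<^sup>2) = D(i := u\<^sup>2 - u'\<^sup>2, j := v\<^sup>2 - v'\<^sup>2)"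
      by (auto simp: D_def)
    thus "balanced n ?L \<epsilon> (\<lambda>k. ((x(i := u, j := v)) k)\<^sup>2 - ((y(i := u', j := v')) k)\<^sup>2)"
      using bal' by simp
    show "same_signs n ?L (x(i := u, j := v)) (y(i := u', j := v'))"
      by (rule same_signs_upd[OF sgn ij(2,3) that(2,3)])
  qed (intro space_Rn_upd Cons.prems ij)+
  have "rot_avg e (path_avg es f) x \<le> rot_avg e (path_avg es f) y + (rot_avg e (path_err \<epsilon> \<delta> es) y
      + ennreal (2 * sqrt (\<epsilon> / \<delta>)) + (if (y i)\<^sup>2 \<le> \<delta> then 1 else 0))"
  proof -
    have X: "rot_avg e (path_avg es f) x = (\<integral>\<^sup>+\<theta>. ?F (sqrt r * cos \<theta>) (sqrt r * sin \<theta>) \<partial>angle)"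
      unfolding e by (rule rot_avg_polar[OF ij(1) mavg Cons.prems(2) r_def])
    have Y: "rot_avg e (path_avg es f) y = (\<integral>\<^sup>+\<theta>. ?G (sqrt s * cos \<theta>) (sqrt s * sin \<theta>) \<partial>angle)"
      unfolding e by (rule rot_avg_polar[OF ij(1) mavg Cons.prems(3) s_def])
    have Z: "rot_avg e (path_err \<epsilon> \<delta> es) y = (\<integral>\<^sup>+\<theta>. ?H (sqrt s * cos \<theta>) (sqrt s * sin \<theta>) \<partial>angle)"
      unfolding e by (rule rot_avg_polar[OF ij(1) merr Cons.prems(3) s_def])
    show ?thesis
    proof (cases "?L i = ?L j")
      case True
      \<comment> \<open>Later pairs already connect \<open>i\<close> and \<open>j\<close>, so the
        partition stays as it is. Equal angles merely redistribute \<open>D i + D j\<close> with one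
        common sign, which cannot increase the absolute sum.\<close>
      have L: "(\<lambda>k. if ?L k = ?L j then ?L i else ?L k) = ?L" using True by auto
      have "?F (sqrt r * cos \<theta>) (sqrt r * sin \<theta>)
        \<le> ?G (sqrt s * cos \<theta>) (sqrt s * sin \<theta>) + ?H (sqrt s * cos \<theta>) (sqrt s * sin \<theta>)" for \<theta>
      proof (rule step)
        have *: "(sqrt r * cos \<theta>)\<^sup>2 - (sqrt s * cos \<theta>)\<^sup>2 = (r - s) * (cos \<theta>)\<^sup>2"
          "(sqrt r * sin \<theta>)\<^sup>2 - (sqrt s * sin \<theta>)\<^sup>2 = (r - s) * (sin \<theta>)\<^sup>2"
          using rs0 by (simp_all add: power_mult_distrib left_diff_distrib)
        have "balanced n ?L \<epsilon> (D(i := (r - s) * (cos \<theta>)\<^sup>2, j := (r - s) * (sin \<theta>)\<^sup>2))"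
        proof (rule balanced_redistribute[OF _ ij(2-4) True])
          show "balanced n ?L \<epsilon> D" using bal unfolding L .
          show "(r - s) * (cos \<theta>)\<^sup>2 + (r - s) * (sin \<theta>)\<^sup>2 = D i + D j"
            unfolding rs[symmetric] by (simp add: distrib_left[symmetric])
          have "\<bar>(r - s) * (cos \<theta>)\<^sup>2\<bar> + \<bar>(r - s) * (sin \<theta>)\<^sup>2\<bar> = \<bar>r - s\<bar> * ((cos \<theta>)\<^sup>2 + (sin \<theta>)\<^sup>2)"
            by (simp only: abs_mult abs_power2 distrib_left)
          also have "\<dots> = \<bar>D i + D j\<bar>" unfolding rs by simp
          finally show "\<bar>(r - s) * (cos \<theta>)\<^sup>2\<bar> + \<bar>(r - s) * (sin \<theta>)\<^sup>2\<bar> \<le> \<bar>D i\<bar> + \<bar>D j\<bar>" by linarith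
        qed
        thus "balanced n ?L \<epsilon> (D(i := (sqrt r * cos \<theta>)\<^sup>2 - (sqrt s * cos \<theta>)\<^sup>2, j := (sqrt r * sin \<theta>)\<^sup>2 - (sqrt s * sin \<theta>)\<^sup>2))"
          unfolding * .
        have "0 \<le> (sqrt r * sqrt s) * (cos \<theta>)\<^sup>2" "0 \<le> (sqrt r * sqrt s) * (sin \<theta>)\<^sup>2" using rs0 by simp_all
        thus "0 \<le> sqrt r * cos \<theta> * (sqrt s * cos \<theta>)" "0 \<le> sqrt r * sin \<theta> * (sqrt s * sin \<theta>)"
          by (simp_all add: power2_eq_square mult_ac)
      qed
      hence "rot_avg e (path_avg es f) x \<le> (\<integral>\<^sup>+\<theta>. ?G (sqrt s * cos \<theta>) (sqrt s * sin \<theta>)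
          + ?H (sqrt s * cos \<theta>) (sqrt s * sin \<theta>) \<partial>angle)"
        unfolding X by (intro nn_integral_mono)
      also have "\<dots> = rot_avg e (path_avg es f) y + rot_avg e (path_err \<epsilon> \<delta> es) y"
        unfolding Y Z by (rule nn_integral_add) (use polar[OF meas(2)] polar[OF meas(3)] in simp_all)
      also have "\<dots> \<le> rot_avg e (path_avg es f) y + (rot_avg e (path_err \<epsilon> \<delta> es) y
          + ennreal (2 * sqrt (\<epsilon> / \<delta>)) + (if (y i)\<^sup>2 \<le> \<delta> then 1 else 0))"
        by (intro add_left_mono) (simp add: add.assoc add_increasing2)
      finally show ?thesis .
    next
      case False
      show ?thesis
      proof (cases "(y i)\<^sup>2 \<le> \<delta>")
        case True
        have "rot_avg e (path_avg es f) x \<le> 1"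
          by (intro rot_avg_le_const path_avg_le_const f)
        thus ?thesis using True by (auto intro!: add_increasing)
      next
        case small: False
        \<comment> \<open>The masses of the half around \<open>j\<close> without \<open>j\<close>
          itself are the offsets of the two arcsine laws, so that both integration variables become
          total masses of this half.\<close>
        define a where "a = (\<Sum>k\<in>{k. k < n \<and> ?L k = ?L j} - {j}. (x k)\<^sup>2)"
        define b where "b = (\<Sum>k\<in>{k. k < n \<and> ?L k = ?L j} - {j}. (y k)\<^sup>2)"
        define A where "A = (\<Sum>k\<in>{k. k < n \<and> ?L k = ?L j} - {j}. D k)"
        define B where "B = (\<Sum>k\<in>{k. k < n \<and> ?L k = ?L i} - {i}. D k)"
        note split = balanced_split[OF bal ij(2,3) False, folded A_def B_def]
        have A: "A = a - b" by (simp add: A_def a_def b_def D_def sum_subtractf)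
        have B: "(a + r) - (b + s) = - B" using split(4) rs A by simp
        have s: "\<delta> < s" using small zero_le_power2[of "y j"] unfolding s_def by linarith
        have "\<bar>D i + D j\<bar> \<le> \<epsilon>"
        proof -
          let ?C = "{k. k < n \<and> (if ?L k = ?L j then ?L i else ?L k) = ?L i}"
          have "\<bar>D i\<bar> + \<bar>D j\<bar> \<le> (\<Sum>k\<in>?C. \<bar>D k\<bar>)"
            using ij sum_mono2[of ?C "{i, j}" "\<lambda>k. \<bar>D k\<bar>"] by simp
          also have "\<dots> \<le> \<epsilon>" using bal unfolding balanced_def by blast
          finally show ?thesis by linarith
        qed
        \<comment> \<open>The radii differ by at most \<epsilon> \<le> \<delta> < s, so the pair in
          \<open>x\<close> cannot vanish either.\<close>
        hence r: "0 < r" using rs s \<epsilon>\<delta> by linarith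
        have "rot_avg e (path_avg es f) x \<le> rot_avg e (path_avg es f) y + rot_avg e (path_err \<epsilon> \<delta> es) y
           + ennreal (2 * sqrt (\<epsilon> / s))"
          unfolding X Y Z
        proof (rule nn_integral_angle_swap[OF meas])
          show "0 < r" by (rule r)
          show "0 < s" using s \<epsilon>\<delta> by linarith
          show "?F u v \<le> 1" for u v by (intro path_avg_le_const f)
          show "\<bar>a - b\<bar> \<le> \<epsilon>" using split(2) A by simp
          show "\<bar>(a + r) - (b + s)\<bar> \<le> \<epsilon>" using split(3) B by simp
        next
          fix w \<sigma> \<tau> :: real
          assume st: "\<sigma> \<in> {1, -1}" "\<tau> \<in> {1, -1}" and w: "a < w" "w < a + r" "b < w" "w < b + s"
          have sq: "(\<sigma> * u)\<^sup>2 = u\<^sup>2" "(\<tau> * u)\<^sup>2 = u\<^sup>2" for u using st by auto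
          \<comment> \<open>At a common mass \<open>w\<close> the discrepancies become
            \<open>b - a = - A\<close> at \<open>j\<close> and \<open>- B\<close> at
            \<open>i\<close>, exactly the values that balance both halves; the common signs match
            the new coordinates.\<close>
          have "(\<sigma> * sqrt (a + r - w))\<^sup>2 - (\<sigma> * sqrt (b + s - w))\<^sup>2 = - B"
            "(\<tau> * sqrt (w - a))\<^sup>2 - (\<tau> * sqrt (w - b))\<^sup>2 = - A"
            unfolding sq using w A B by auto
          moreover have "0 \<le> \<sigma> * sqrt (a + r - w) * (\<sigma> * sqrt (b + s - w))"
            "0 \<le> \<tau> * sqrt (w - a) * (\<tau> * sqrt (w - b))"
            using st w by auto
          ultimately show "?F (\<sigma> * sqrt (a + r - w)) (\<tau> * sqrt (w - a))
            \<le> ?G (\<sigma> * sqrt (b + s - w)) (\<tau> * sqrt (w - b)) + ?H (\<sigma> * sqrt (b + s - w)) (\<tau> * sqrt (w - b))"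
            using split(1) by (intro step) simp_all
        qed
        also have "\<dots> \<le> rot_avg e (path_avg es f) y + rot_avg e (path_err \<epsilon> \<delta> es) y
           + ennreal (2 * sqrt (\<epsilon> / \<delta>))"
          using s \<epsilon>\<delta> by (intro add_left_mono ennreal_leI mult_left_mono real_sqrt_le_mono divide_left_mono) auto
        finally show ?thesis using small by (simp add: add.assoc)
      qed
    qed
  qed
  thus ?case by (simp add: e)
qed

text \<open>Invariance removes the averages over earlier rotations, so every step is charged as if
  \<open>y\<close> were freshly uniform.\<close>

lemma nn_integral_haar_path_err:
  assumes n: "2 \<le> n" and \<delta>: "0 \<le> \<delta>" "\<delta> < 1 / n" and es: "set es \<subseteq> edges n"
  shows "(\<integral>\<^sup>+y. path_err \<epsilon> \<delta> es y \<partial>haar n)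
    \<le> of_nat (length es) * (ennreal (2 * sqrt (\<epsilon> / \<delta>)) + ennreal (n * sqrt (n * \<delta>)))"
  using es
proof (induction es)
  case (Cons e es)
  interpret haar: prob_space "haar n" using n by (intro prob_space_haar) simp
  have e: "e \<in> edges n" "fst e < n" and es: "set es \<subseteq> edges n" using Cons.prems by (auto simp: edges_def)
  let ?B = "{y \<in> space (Rn n). (y (fst e))\<^sup>2 \<le> \<delta>}"
  note [measurable] = Rn_component[OF e(2)] measurable_rot_avg[OF e(1) measurable_path_err[OF es]] measurable_path_err[OF es]
  have B: "?B \<in> sets (Rn n)" by measurable
  have "(\<integral>\<^sup>+y. path_err \<epsilon> \<delta> (e # es) y \<partial>haar n)
     = (\<integral>\<^sup>+y. rot_avg e (path_err \<epsilon> \<delta> es) y \<partial>haar n) + (\<integral>\<^sup>+y. ennreal (2 * sqrt (\<epsilon> / \<delta>)) \<partial>haar n)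
       + (\<integral>\<^sup>+y. (if (y (fst e))\<^sup>2 \<le> \<delta> then 1 else 0) \<partial>haar n)"
    by (simp add: nn_integral_add)
  also have "(\<integral>\<^sup>+y. ennreal (2 * sqrt (\<epsilon> / \<delta>)) \<partial>haar n) = ennreal (2 * sqrt (\<epsilon> / \<delta>))"
    using haar.emeasure_space_1 by simp
  also have "(\<integral>\<^sup>+y. (if (y (fst e))\<^sup>2 \<le> \<delta> then 1 else 0) \<partial>haar n) = (\<integral>\<^sup>+y. indicator ?B y \<partial>haar n)"
    by (intro nn_integral_cong) (auto simp: indicator_def)
  also have "\<dots> = emeasure (haar n) ?B" using B by simp
  also have "(\<integral>\<^sup>+y. rot_avg e (path_err \<epsilon> \<delta> es) y \<partial>haar n) = (\<integral>\<^sup>+y. path_err \<epsilon> \<delta> es y \<partial>haar n)"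
    using n e by (intro nn_integral_haar_rot_avg) auto
  finally have "(\<integral>\<^sup>+y. path_err \<epsilon> \<delta> (e # es) y \<partial>haar n)
    = (\<integral>\<^sup>+y. path_err \<epsilon> \<delta> es y \<partial>haar n) + ennreal (2 * sqrt (\<epsilon> / \<delta>)) + emeasure (haar n) ?B" .
  also have "\<dots> \<le> of_nat (length es) * (ennreal (2 * sqrt (\<epsilon> / \<delta>)) + ennreal (n * sqrt (n * \<delta>)))
      + ennreal (2 * sqrt (\<epsilon> / \<delta>)) + ennreal (n * sqrt (n * \<delta>))"
    using n e \<delta> es by (intro add_mono Cons.IH haar_small_coordinate) auto
  finally show ?case by (simp add: algebra_simps)
qed simp

section \<open>Components of the random graph of pairs\<close>

definition excess :: "nat \<Rightarrow> (nat \<times> nat) list \<Rightarrow> nat" where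
  "excess n es = card (label es ` {..<n}) - 1"

lemma excess_Nil [simp]: "excess n [] = n - 1"
  by (simp add: excess_def)

lemma excess_Cons:
  assumes "i < n" "j < n"
  shows "real (excess n ((i, j) # es)) = real (excess n es) - (if label es i \<noteq> label es j then 1 else 0)"
proof (cases "label es i = label es j")
  case True
  have "label ((i, j) # es) = label es" using True by auto
  thus ?thesis using True by (simp add: excess_def)
next
  case False
  let ?L = "label es"
  have img: "label ((i, j) # es) ` {..<n} = ?L ` {..<n} - {?L j}"
  proof
    show "label ((i, j) # es) ` {..<n} \<subseteq> ?L ` {..<n} - {?L j}"
      using assms False by auto
    show "?L ` {..<n} - {?L j} \<subseteq> label ((i, j) # es) ` {..<n}"
    proof
      fix c assume "c \<in> ?L ` {..<n} - {?L j}"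
      then obtain k where "k < n" "c = ?L k" "?L k \<noteq> ?L j" by auto
      thus "c \<in> label ((i, j) # es) ` {..<n}"
        by (intro image_eqI[of _ _ k]) auto
    qed
  qed
  have "card {?L i, ?L j} \<le> card (?L ` {..<n})"
    using assms by (intro card_mono) auto
  hence "2 \<le> card (?L ` {..<n})" using False by simp
  moreover have "card (label ((i, j) # es) ` {..<n}) = card (?L ` {..<n}) - 1"
    unfolding img using assms by (intro card_Diff_singleton) auto
  ultimately show ?thesis using False by (simp add: excess_def of_nat_diff)
qed

text \<open>From each index, every foreign class contributes at least one partner, which gives
  \<open>excess n es\<close> partners per index; summing over the indices counts each pair
  twice.\<close>

lemma card_cross_edges:
  "real n * real (excess n es) \<le> 2 * real (card {(i, j) \<in> edges n. label es i \<noteq> label es j})"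
proof -
  let ?L = "label es"
  let ?X = "{(i, j) \<in> edges n. ?L i \<noteq> ?L j}"
  have fin: "finite ?X" by (rule finite_subset[OF _ finite_edges]) auto
  have "excess n es \<le> card {l. l < n \<and> ?L l \<noteq> ?L k}" if k: "k < n" for k
  proof -
    have "excess n es = card (?L ` {..<n} - {?L k})"
      unfolding excess_def using k by (subst card_Diff_singleton) auto
    also have "?L ` {..<n} - {?L k} = ?L ` {l. l < n \<and> ?L l \<noteq> ?L k}" by auto
    also have "card \<dots> \<le> card {l. l < n \<and> ?L l \<noteq> ?L k}" by (intro card_image_le) auto
    finally show ?thesis .
  qed
  hence "(\<Sum>k<n. excess n es) \<le> (\<Sum>k<n. card {l. l < n \<and> ?L l \<noteq> ?L k})"
    by (intro sum_mono) auto
  also have "\<dots> = card (SIGMA k:{..<n}. {l. l < n \<and> ?L l \<noteq> ?L k})"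
    by simp
  also have "\<dots> \<le> card (?X \<union> ?X\<inverse>)"
  proof (rule card_mono)
    show "(SIGMA k:{..<n}. {l. l < n \<and> ?L l \<noteq> ?L k}) \<subseteq> ?X \<union> ?X\<inverse>"
    proof
      fix p assume "p \<in> (SIGMA k:{..<n}. {l. l < n \<and> ?L l \<noteq> ?L k})"
      then obtain k l where "p = (k, l)" "k < n" "l < n" "?L l \<noteq> ?L k" by auto
      thus "p \<in> ?X \<union> ?X\<inverse>" by (cases k l rule: linorder_cases) (auto simp: edges_def)
    qed
  qed (use fin in simp)
  also have "\<dots> \<le> card ?X + card (?X\<inverse>)" by (rule card_Un_le)
  also have "\<dots> = 2 * card ?X" by simp
  finally have "n * excess n es \<le> 2 * card ?X" by simp
  hence "real (n * excess n es) \<le> real (2 * card ?X)" by (rule of_nat_mono)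
  thus ?thesis by simp
qed

text \<open>At least n/2 times the excess many pairs join two components, and there are at most
  n^2/2 pairs in all. Hence a random pair joins two components with probability at least
  excess/n.\<close>

lemma sum_excess_Cons:
  assumes n: "0 < n"
  shows "(\<Sum>e\<in>edges n. real (excess n (e # es))) \<le> card (edges n) * (1 - 1 / n) * real (excess n es)"
proof -
  let ?X = "{(i, j) \<in> edges n. label es i \<noteq> label es j}"
  have "(\<Sum>e\<in>edges n. real (excess n (e # es)))
      = (\<Sum>e\<in>edges n. real (excess n es) - (if e \<in> ?X then 1 else 0))"
  proof (rule sum.cong[OF refl])
    fix e assume "e \<in> edges n"
    moreover obtain i j where "e = (i, j)" by (cases e)
    ultimately show "real (excess n (e # es)) = real (excess n es) - (if e \<in> ?X then 1 else 0)"
      using excess_Cons[of i n j es] by (auto simp: edges_def)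
  qed
  also have "\<dots> = card (edges n) * real (excess n es) - card ?X"
  proof -
    have "edges n \<inter> ?X = ?X" by auto
    thus ?thesis by (simp add: sum_subtractf sum.If_cases)
  qed
  also have "\<dots> \<le> card (edges n) * real (excess n es) - n * real (excess n es) / 2"
    using card_cross_edges[of n es] by linarith
  finally have "(\<Sum>e\<in>edges n. real (excess n (e # es)))
    \<le> card (edges n) * real (excess n es) - n * real (excess n es) / 2" .
  moreover have "n * real (excess n es) / 2 \<ge> card (edges n) / n * real (excess n es)"
  proof -
    have "2 * real (card (edges n)) = n * real (n - 1)"
      using arg_cong[OF card_edges[of n], of real] by simp
    also have "\<dots> \<le> real n * real n" by (intro mult_left_mono) auto
    finally have "card (edges n) / n \<le> n / 2" using n by (simp add: field_simps)
    from mult_right_mono[OF this, of "real (excess n es)"] show ?thesis by simp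
  qed
  ultimately show ?thesis by (simp add: algebra_simps)
qed

text \<open>The mean excess decays geometrically from the initial value \<open>n - 1\<close>. As an
  integer that vanishes only for a single class, the excess dominates the indicator of a
  disconnected graph, so this first moment also bounds the share of disconnected paths.\<close>

lemma sum_excess_paths:
  assumes n: "0 < n"
  shows "(\<Sum>es\<in>paths n m. real (excess n es)) \<le> real (card (edges n)) ^ m * (1 - 1 / n) ^ m * n"
proof (induction m)
  case 0
  have "paths n 0 = {[]}" by (auto simp: paths_def)
  thus ?case by simp
next
  case (Suc m)
  have "(\<Sum>es\<in>paths n (Suc m). real (excess n es)) = (\<Sum>es\<in>paths n m. \<Sum>e\<in>edges n. real (excess n (e # es)))"
    by (subst sum_paths_Suc) (rule sum.swap)
  also have "\<dots> \<le> (\<Sum>es\<in>paths n m. card (edges n) * (1 - 1 / n) * real (excess n es))"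
    by (intro sum_mono sum_excess_Cons n)
  also have "\<dots> = card (edges n) * (1 - 1 / n) * (\<Sum>es\<in>paths n m. real (excess n es))"
    by (simp add: sum_distrib_left)
  also have "\<dots> \<le> card (edges n) * (1 - 1 / n) * (real (card (edges n)) ^ m * (1 - 1 / n) ^ m * n)"
    using n by (intro mult_left_mono Suc.IH mult_nonneg_nonneg) auto
  finally show ?case by (simp add: mult_ac)
qed

lemma card_paths: "card (paths n m) = card (edges n) ^ m"
  unfolding paths_def by (rule card_lists_length_eq) simp

definition coalesce_err :: "real \<Rightarrow> real \<Rightarrow> nat \<Rightarrow> nat \<Rightarrow> (nat \<Rightarrow> real) \<Rightarrow> ennreal" where
  "coalesce_err \<epsilon> \<delta> n m y = ennreal (1 / card (edges n)) ^ m * (\<Sum>es\<in>paths n m. path_err \<epsilon> \<delta> es y)"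

lemma measurable_coalesce_err [measurable]: "coalesce_err \<epsilon> \<delta> n m \<in> borel_measurable (Rn n)"
  unfolding coalesce_err_def[abs_def]
  by (intro borel_measurable_times_ennreal borel_measurable_sum)
     (auto simp: paths_def intro: measurable_path_err)

lemma ennreal_inverse_pow_mult:
  "0 < k \<Longrightarrow> ennreal (1 / real k) ^ m * ennreal (real k ^ m * c) = ennreal c"
proof -
  assume k: "0 < k"
  have "ennreal (1 / real k) ^ m * ennreal (real k ^ m * c) = ennreal ((1 / real k) ^ m * (real k ^ m * c))"
    by (subst ennreal_power, simp, subst ennreal_mult'[symmetric]) simp_all
  also have "(1 / real k) ^ m * (real k ^ m * c) = c"
    using k by (simp add: power_divide)
  finally show ?thesis .
qed

text \<open>If the graph of the path is connected, the only class is the full index set, and balance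
  follows from both states lying on the sphere and being \<epsilon>-close. Every other path is given
  up at cost 1, which is at most its excess.\<close>

lemma kac_op_coalesce:
  assumes n: "2 \<le> n" and f: "f \<in> borel_measurable (Rn n)" "\<And>x. f x \<le> 1"
    and \<epsilon>\<delta>: "0 \<le> \<epsilon>" "\<epsilon> \<le> \<delta>" "0 < \<delta>"
    and xy: "x \<in> sphere_n n" "y \<in> sphere_n n" "(\<Sum>k<n. \<bar>(x k)\<^sup>2 - (y k)\<^sup>2\<bar>) \<le> \<epsilon>"
  shows "(kac_op n ^^ m) f x \<le> (kac_op n ^^ m) f y + coalesce_err \<epsilon> \<delta> n m y + ennreal (n * (1 - 1 / n) ^ m)"
proof -
  let ?c = "ennreal (1 / card (edges n)) ^ m"
  have sp: "x \<in> space (Rn n)" "y \<in> space (Rn n)" using xy by (auto simp: sphere_n_def)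
  have path: "path_avg es f x \<le> path_avg es f y + path_err \<epsilon> \<delta> es y + ennreal (real (excess n es))"
    if es: "es \<in> paths n m" for es
  proof (cases "excess n es = 0")
    case True
    have "label es 0 \<in> label es ` {..<n}" using n by auto
    hence "0 < card (label es ` {..<n})" by (subst card_gt_0_iff) blast
    hence "card (label es ` {..<n}) = 1" using True unfolding excess_def by linarith
    then obtain c where "label es ` {..<n} = {c}" by (auto simp: card_1_singleton_iff)
    hence c: "label es k = c" if "k < n" for k using that by blast
    have "balanced n (label es) \<epsilon> (\<lambda>k. (x k)\<^sup>2 - (y k)\<^sup>2)"
      unfolding balanced_def
    proof
      fix d
      show "(\<Sum>k | k < n \<and> label es k = d. (x k)\<^sup>2 - (y k)\<^sup>2) = 0
        \<and> (\<Sum>k | k < n \<and> label es k = d. \<bar>(x k)\<^sup>2 - (y k)\<^sup>2\<bar>) \<le> \<epsilon>"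
      proof (cases "d = c")
        case True
        hence "{k. k < n \<and> label es k = d} = {..<n}" using c by auto
        thus ?thesis using xy by (simp add: sum_subtractf sphere_n_def sqnorm_def)
      next
        case False
        hence "{k. k < n \<and> label es k = d} = {}" using c by auto
        thus ?thesis using \<epsilon>\<delta> by (simp only: sum.empty simp_thms)
      qed
    qed
    moreover have "same_signs n (label es) x y"
      unfolding same_signs_def
    proof (intro allI impI)
      fix k assume k: "k < n" "\<forall>l<n. l \<noteq> k \<longrightarrow> label es l \<noteq> label es k"
      \<comment> \<open>A second index in the same class, available because n is at least 2; so no
        index is alone at the start and the signs of \<open>x\<close> and \<open>y\<close> are
        arbitrary.\<close>
      define l where "l = (if k = 0 then 1 else 0 :: nat)"
      have "l < n" "l \<noteq> k" using n by (auto simp: l_def)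
      thus "0 \<le> x k * y k" using k c by auto
    qed
    ultimately show ?thesis
      using path_avg_matched[OF f \<epsilon>\<delta> _ sp] es by (simp add: True paths_def)
  next
    case False
    have "path_avg es f x \<le> 1" by (intro path_avg_le_const f)
    also have "1 \<le> ennreal (real (excess n es))" using False by (simp add: ennreal_ge_1)
    finally show ?thesis by (rule order.trans) simp
  qed
  have "(kac_op n ^^ m) f x = ?c * (\<Sum>es\<in>paths n m. path_avg es f x)"
    by (rule kac_op_funpow[OF f(1) sp(1)])
  also have "\<dots> \<le> ?c * (\<Sum>es\<in>paths n m. path_avg es f y + path_err \<epsilon> \<delta> es y + ennreal (real (excess n es)))"
    by (intro mult_left_mono sum_mono path) auto
  also have "\<dots> = (kac_op n ^^ m) f y + coalesce_err \<epsilon> \<delta> n m y + ?c * ennreal (\<Sum>es\<in>paths n m. real (excess n es))"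
    unfolding kac_op_funpow[OF f(1) sp(2)] coalesce_err_def
    by (simp add: sum.distrib distrib_left)
  also have "?c * ennreal (\<Sum>es\<in>paths n m. real (excess n es))
      \<le> ?c * ennreal (real (card (edges n)) ^ m * (n * (1 - 1 / n) ^ m))"
    using sum_excess_paths[of n m] n by (intro mult_left_mono ennreal_leI) (auto simp: mult_ac)
  also have "\<dots> = ennreal (n * (1 - 1 / n) ^ m)"
    using card_edges_pos[OF n] by (rule ennreal_inverse_pow_mult)
  finally show ?thesis by (simp add: add_left_mono)
qed

lemma nn_integral_haar_coalesce_err:
  assumes n: "2 \<le> n" and \<delta>: "0 \<le> \<delta>" "\<delta> < 1 / n"
  shows "(\<integral>\<^sup>+y. coalesce_err \<epsilon> \<delta> n m y \<partial>haar n)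
    \<le> of_nat m * (ennreal (2 * sqrt (\<epsilon> / \<delta>)) + ennreal (n * sqrt (n * \<delta>)))"
proof -
  let ?c = "ennreal (1 / card (edges n)) ^ m"
  let ?b = "of_nat m * (ennreal (2 * sqrt (\<epsilon> / \<delta>)) + ennreal (n * sqrt (n * \<delta>)))"
  have meas: "path_err \<epsilon> \<delta> es \<in> borel_measurable (haar n)" if "es \<in> paths n m" for es
    using that measurable_path_err[of es n] by (simp add: paths_def cong: measurable_cong_sets)
  have "(\<integral>\<^sup>+y. coalesce_err \<epsilon> \<delta> n m y \<partial>haar n) = ?c * (\<Sum>es\<in>paths n m. \<integral>\<^sup>+y. path_err \<epsilon> \<delta> es y \<partial>haar n)"
    unfolding coalesce_err_def using meas
    by (simp add: nn_integral_cmult nn_integral_sum borel_measurable_sum)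
  also have "\<dots> \<le> ?c * (\<Sum>es\<in>paths n m. ?b)"
    using nn_integral_haar_path_err[OF n \<delta>] by (intro mult_left_mono sum_mono) (auto simp: paths_def)
  also have "\<dots> = ?c * of_nat (card (edges n) ^ m) * ?b"
    by (simp add: card_paths mult.assoc)
  also have "?c * of_nat (card (edges n) ^ m) = 1"
    using ennreal_inverse_mult_of_nat[OF card_edges_pos[OF n]] by (simp add: power_mult_distrib[symmetric])
  finally show ?thesis by simp
qed

section \<open>Contraction of the squared coordinates\<close>

lemma sum_edges: "(\<Sum>(i, j)\<in>edges n. g i j) = (\<Sum>j<n. \<Sum>i<j. g i j)"
proof -
  have "(\<Sum>(i, j)\<in>edges n. g i j) = (\<Sum>(j, i)\<in>(SIGMA j:{..<n}. {..<j}). g i j)"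
    by (rule sum.reindex_bij_witness[of _ "\<lambda>(j, i). (i, j)" "\<lambda>(i, j). (j, i)"]) (auto simp: edges_def)
  also have "\<dots> = (\<Sum>j<n. \<Sum>i<j. g i j)"
    by (rule sum.Sigma[symmetric]) auto
  finally show ?thesis .
qed

lemma sum_square_edges:
  fixes g :: "nat \<Rightarrow> nat \<Rightarrow> real"
  assumes "\<And>i j. g i j = g j i"
  shows "(\<Sum>i<n. \<Sum>j<n. g i j) = 2 * (\<Sum>(i, j)\<in>edges n. g i j) + (\<Sum>i<n. g i i)"
  unfolding sum_edges
proof (induction n)
  case (Suc n)
  have "(\<Sum>j<n. g n j) = (\<Sum>j<n. g j n)" by (intro sum.cong refl assms)
  thus ?case using Suc by (simp add: sum.distrib)
qed simp

definition sq_gap :: "nat \<Rightarrow> (nat \<Rightarrow> real) \<Rightarrow> (nat \<Rightarrow> real) \<Rightarrow> real" where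
  "sq_gap n x y = (\<Sum>k<n. ((x k)\<^sup>2 - (y k)\<^sup>2)\<^sup>2)"

lemma sq_gap_le_2:
  assumes "x \<in> sphere_n n" "y \<in> sphere_n n"
  shows "sq_gap n x y \<le> 2"
proof -
  have "((x k)\<^sup>2 - (y k)\<^sup>2)\<^sup>2 \<le> (x k)\<^sup>2 + (y k)\<^sup>2" if k: "k < n" for k
  proof -
    have "(x k)\<^sup>2 \<le> 1" "(y k)\<^sup>2 \<le> 1"
      using sqnorm_ge_component[OF k, of x] sqnorm_ge_component[OF k, of y] assms by (auto simp: sphere_n_def)
    hence "\<bar>(x k)\<^sup>2 - (y k)\<^sup>2\<bar> \<le> 1" "\<bar>(x k)\<^sup>2 - (y k)\<^sup>2\<bar> \<le> (x k)\<^sup>2 + (y k)\<^sup>2"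
      using zero_le_power2[of "x k"] zero_le_power2[of "y k"] by linarith+
    hence "\<bar>(x k)\<^sup>2 - (y k)\<^sup>2\<bar> * \<bar>(x k)\<^sup>2 - (y k)\<^sup>2\<bar> \<le> 1 * ((x k)\<^sup>2 + (y k)\<^sup>2)"
      by (intro mult_mono) auto
    thus ?thesis by (simp add: power2_eq_square[symmetric])
  qed
  hence "sq_gap n x y \<le> (\<Sum>k<n. (x k)\<^sup>2 + (y k)\<^sup>2)"
    unfolding sq_gap_def by (intro sum_mono) auto
  also have "\<dots> = 2" using assms by (simp add: sum.distrib sphere_n_def sqnorm_def)
  finally show ?thesis .
qed

text \<open>The angular average of \<open>cos\<^sup>4 + sin\<^sup>4\<close>, obtained from the shift by \<open>\<pi>/4\<close>.\<close>

lemma nn_integral_angle_fourth: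
  "(\<integral>\<^sup>+\<theta>. ennreal ((cos \<theta>) ^ 4 + (sin \<theta>) ^ 4) \<partial>angle) = ennreal (3 / 4)"
proof -
  let ?h = "\<lambda>\<theta>. (cos \<theta>) ^ 4 + (sin \<theta>) ^ 4 :: real"
  let ?J = "\<integral>\<^sup>+\<theta>. ennreal (?h \<theta>) \<partial>angle"
  \<comment> \<open>The function is one minus half the squared sine of the doubled angle, and the
    shift turns that sine into a cosine up to sign.\<close>
  have sum: "?h \<theta> + ?h (\<theta> + pi / 4) = 3 / 2" for \<theta>
  proof -
    define c where "c = cos \<theta>"
    define s where "s = sin \<theta>"
    have cs: "c\<^sup>2 + s\<^sup>2 = 1" by (simp add: c_def s_def)
    have shift: "cos (\<theta> + pi / 4) = sqrt 2 / 2 * (c - s)" "sin (\<theta> + pi / 4) = sqrt 2 / 2 * (c + s)"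
      by (simp_all add: cos_add sin_add cos_45 sin_45 c_def s_def algebra_simps)
    have fourth: "(sqrt 2 / 2) ^ 4 = (1 / 4 :: real)"
    proof -
      have "(sqrt 2 / 2 :: real) ^ 4 = ((sqrt 2 / 2)\<^sup>2)\<^sup>2" by simp
      also have "\<dots> = 1 / 4" by (simp add: power_divide power2_eq_square)
      finally show ?thesis .
    qed
    have "?h (\<theta> + pi / 4) = 1 / 4 * (c - s) ^ 4 + 1 / 4 * (c + s) ^ 4"
      unfolding shift power_mult_distrib fourth ..
    moreover have "c ^ 4 + s ^ 4 + (1 / 4 * (c - s) ^ 4 + 1 / 4 * (c + s) ^ 4) = 3 / 2 * (c\<^sup>2 + s\<^sup>2)\<^sup>2"
      by (simp add: power2_eq_square power4_eq_xxxx algebra_simps)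
    ultimately show ?thesis unfolding cs by (simp add: c_def s_def)
  qed
  have "(\<integral>\<^sup>+\<theta>. ennreal (?h (\<theta> + pi / 4)) \<partial>angle) = ?J"
    by (rule nn_integral_angle_shift[of "\<lambda>\<theta>. ennreal (?h \<theta>)"]) auto
  hence "?J + ?J = (\<integral>\<^sup>+\<theta>. ennreal (?h \<theta>) \<partial>angle) + (\<integral>\<^sup>+\<theta>. ennreal (?h (\<theta> + pi / 4)) \<partial>angle)" by simp
  also have "\<dots> = (\<integral>\<^sup>+\<theta>. ennreal (?h \<theta>) + ennreal (?h (\<theta> + pi / 4)) \<partial>angle)"
    by (rule nn_integral_add[symmetric]) simp_all
  also have "\<dots> = (\<integral>\<^sup>+\<theta>. ennreal (3 / 2) \<partial>angle)"
    by (subst ennreal_plus[symmetric]) (simp_all only: sum, simp_all)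
  also have "\<dots> = ennreal (3 / 2)" by (rule nn_integral_angle_const)
  finally have JJ: "?J + ?J = ennreal (3 / 2)" .
  then obtain j where j: "0 \<le> j" "?J = ennreal j" by (cases ?J) auto
  hence "j + j = 3 / 2" using JJ by (simp add: ennreal_plus[symmetric] del: ennreal_plus)
  thus ?thesis using j by simp
qed

text \<open>At equal angles the two new differences of squares are \<open>r - s\<close> times the
  squared cosine and sine, so the sum of their squares averages to
  \<open>3 / 4 * (r - s)\<^sup>2\<close>. The form of the hypothesis survives averaging;
  \<open>H\<close> carries the error of the stage that comes later in time.\<close>

lemma rot_avg_contract:
  assumes e: "(i, j) \<in> edges n" and G: "G \<in> borel_measurable (Rn n)" and H: "H \<in> borel_measurable (Rn n)"
    and \<kappa>: "0 \<le> \<kappa>" and xy: "x \<in> sphere_n n" "y \<in> sphere_n n"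
    and GH: "\<And>x y. x \<in> sphere_n n \<Longrightarrow> y \<in> sphere_n n \<Longrightarrow> G x \<le> G y + H y + ennreal (\<kappa> * sq_gap n x y)"
  defines "D \<equiv> \<lambda>k. (x k)\<^sup>2 - (y k)\<^sup>2"
  shows "rot_avg (i, j) G x \<le> rot_avg (i, j) G y + rot_avg (i, j) H y
    + ennreal (\<kappa> * (sq_gap n x y - (D i)\<^sup>2 - (D j)\<^sup>2 + 3 / 4 * (D i + D j)\<^sup>2))"
proof -
  have ij: "i < n" "j < n" "i \<noteq> j" using e by (auto simp: edges_def)
  have sp: "x \<in> space (Rn n)" "y \<in> space (Rn n)" using xy by (auto simp: sphere_n_def)
  define r where "r = (x i)\<^sup>2 + (x j)\<^sup>2"
  define s where "s = (y i)\<^sup>2 + (y j)\<^sup>2"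
  have rs0: "0 \<le> r" "0 \<le> s" by (auto simp: r_def s_def)
  have rs: "r - s = D i + D j" by (simp add: r_def s_def D_def)
  define M where "M = (\<Sum>k\<in>{..<n} - {i, j}. (D k)\<^sup>2)"
  have M0: "0 \<le> M" by (simp add: M_def sum_nonneg)
  have gap: "sq_gap n x y = M + (D i)\<^sup>2 + (D j)\<^sup>2"
    unfolding sq_gap_def M_def D_def using ij by (intro sum_remove_pair) auto
  let ?x = "\<lambda>\<theta>. x(i := sqrt r * cos \<theta>, j := sqrt r * sin \<theta>)"
  let ?y = "\<lambda>\<theta>. y(i := sqrt s * cos \<theta>, j := sqrt s * sin \<theta>)"
  have sph: "?x \<theta> \<in> sphere_n n" "?y \<theta> \<in> sphere_n n" for \<theta>
  proof -
    have "(sqrt c * cos \<theta>)\<^sup>2 + (sqrt c * sin \<theta>)\<^sup>2 = c" if "0 \<le> c" for c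
      using that by (simp add: power_mult_distrib distrib_left[symmetric])
    from this[OF rs0(1)] this[OF rs0(2)] show "?x \<theta> \<in> sphere_n n" "?y \<theta> \<in> sphere_n n"
      using xy ij by (auto simp: sphere_n_def sqnorm_upd_pair space_Rn_upd r_def s_def)
  qed
  have gap': "sq_gap n (?x \<theta>) (?y \<theta>) = M + (r - s)\<^sup>2 * ((cos \<theta>) ^ 4 + (sin \<theta>) ^ 4)" for \<theta>
  proof -
    have "sq_gap n (?x \<theta>) (?y \<theta>) = (\<Sum>k\<in>{..<n} - {i, j}. ((?x \<theta> k)\<^sup>2 - (?y \<theta> k)\<^sup>2)\<^sup>2)
       + ((?x \<theta> i)\<^sup>2 - (?y \<theta> i)\<^sup>2)\<^sup>2 + ((?x \<theta> j)\<^sup>2 - (?y \<theta> j)\<^sup>2)\<^sup>2"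
      unfolding sq_gap_def using ij by (intro sum_remove_pair) auto
    also have "(\<Sum>k\<in>{..<n} - {i, j}. ((?x \<theta> k)\<^sup>2 - (?y \<theta> k)\<^sup>2)\<^sup>2) = M"
      unfolding M_def D_def by (intro sum.cong) auto
    also have "(?x \<theta> i)\<^sup>2 - (?y \<theta> i)\<^sup>2 = (r - s) * (cos \<theta>)\<^sup>2"
      using ij rs0 by (simp add: power_mult_distrib left_diff_distrib)
    also have "(?x \<theta> j)\<^sup>2 - (?y \<theta> j)\<^sup>2 = (r - s) * (sin \<theta>)\<^sup>2"
      using ij rs0 by (simp add: power_mult_distrib left_diff_distrib)
    also have "M + ((r - s) * (cos \<theta>)\<^sup>2)\<^sup>2 + ((r - s) * (sin \<theta>)\<^sup>2)\<^sup>2 = M + (r - s)\<^sup>2 * ((cos \<theta>) ^ 4 + (sin \<theta>) ^ 4)"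
      by (simp add: power_mult_distrib distrib_left power_mult[symmetric])
    finally show ?thesis .
  qed
  have polar: "(\<lambda>\<theta>. g (z(i := sqrt c * cos \<theta>, j := sqrt c * sin \<theta>))) \<in> borel_measurable borel"
    if "g \<in> borel_measurable (Rn n)" "z \<in> space (Rn n)" for g :: "(nat \<Rightarrow> real) \<Rightarrow> ennreal" and c z
    using measurable_compose[OF _ measurable_upd_plane[OF ij(1,2) that], of "\<lambda>\<theta>. (sqrt c * cos \<theta>, sqrt c * sin \<theta>)" borel]
    by simp
  note [measurable] = polar[OF G sp(2)] polar[OF H sp(2)]
  have "rot_avg (i, j) G x = (\<integral>\<^sup>+\<theta>. G (?x \<theta>) \<partial>angle)"
    by (rule rot_avg_polar[OF e G sp(1) r_def])
  also have "\<dots> \<le> (\<integral>\<^sup>+\<theta>. G (?y \<theta>) + H (?y \<theta>) + (ennreal (\<kappa> * M) + ennreal (\<kappa> * (r - s)\<^sup>2) * ennreal ((cos \<theta>) ^ 4 + (sin \<theta>) ^ 4)) \<partial>angle)"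
  proof (rule nn_integral_mono)
    fix \<theta>
    have "ennreal (\<kappa> * sq_gap n (?x \<theta>) (?y \<theta>))
       = ennreal (\<kappa> * M) + ennreal (\<kappa> * (r - s)\<^sup>2) * ennreal ((cos \<theta>) ^ 4 + (sin \<theta>) ^ 4)"
      unfolding gap' using \<kappa> M0
      by (subst ennreal_mult[symmetric], simp, simp, subst ennreal_plus[symmetric]) (simp_all add: distrib_left mult.assoc)
    thus "G (?x \<theta>) \<le> G (?y \<theta>) + H (?y \<theta>) + (ennreal (\<kappa> * M) + ennreal (\<kappa> * (r - s)\<^sup>2) * ennreal ((cos \<theta>) ^ 4 + (sin \<theta>) ^ 4))"
      using GH[OF sph, of \<theta> \<theta>] by simp
  qed
  also have "\<dots> = (\<integral>\<^sup>+\<theta>. G (?y \<theta>) \<partial>angle) + (\<integral>\<^sup>+\<theta>. H (?y \<theta>) \<partial>angle)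
      + (ennreal (\<kappa> * M) + ennreal (\<kappa> * (r - s)\<^sup>2) * ennreal (3 / 4))"
    by (simp add: nn_integral_add nn_integral_cmult nn_integral_angle_fourth del: ennreal_plus)
  also have "(\<integral>\<^sup>+\<theta>. G (?y \<theta>) \<partial>angle) = rot_avg (i, j) G y"
    by (rule rot_avg_polar[OF e G sp(2) s_def, symmetric])
  also have "(\<integral>\<^sup>+\<theta>. H (?y \<theta>) \<partial>angle) = rot_avg (i, j) H y"
    by (rule rot_avg_polar[OF e H sp(2) s_def, symmetric])
  also have "ennreal (\<kappa> * M) + ennreal (\<kappa> * (r - s)\<^sup>2) * ennreal (3 / 4)
      = ennreal (\<kappa> * (sq_gap n x y - (D i)\<^sup>2 - (D j)\<^sup>2 + 3 / 4 * (D i + D j)\<^sup>2))"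
    unfolding gap rs using \<kappa> M0
    by (subst ennreal_mult[symmetric], simp, simp, subst ennreal_plus[symmetric]) (simp_all add: algebra_simps)
  finally show ?thesis .
qed

text \<open>Because \<open>D\<close> sums to zero, the mixed products cancel over all ordered pairs,
  and removing the diagonal leaves a gain of exactly (n+2)/4 times the sum of squares. Dividing by
  the number of pairs gives (n+2)/(2n(n-1)), rounded down to 1/(2n).\<close>

lemma sum_edges_contract:
  fixes D :: "nat \<Rightarrow> real"
  assumes n: "0 < n" and D: "(\<Sum>k<n. D k) = 0"
  shows "(\<Sum>(i, j)\<in>edges n. (\<Sum>k<n. (D k)\<^sup>2) - (D i)\<^sup>2 - (D j)\<^sup>2 + 3 / 4 * (D i + D j)\<^sup>2)
    \<le> card (edges n) * ((1 - 1 / (2 * real n)) * (\<Sum>k<n. (D k)\<^sup>2))"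
proof -
  define S where "S = (\<Sum>k<n. (D k)\<^sup>2)"
  have S0: "0 \<le> S" by (simp add: S_def sum_nonneg)
  define g where "g i j = - (D i)\<^sup>2 - (D j)\<^sup>2 + 3 / 4 * (D i + D j)\<^sup>2" for i j
  have g: "g i j = (- 1 / 4) * (D i)\<^sup>2 + (- 1 / 4) * (D j)\<^sup>2 + 3 / 2 * (D i * D j)" for i j
    by (simp add: g_def power2_eq_square algebra_simps)
  have "(\<Sum>i<n. \<Sum>j<n. g i j) = - (real n / 2) * S"
    unfolding g sum.distrib sum_distrib_left[symmetric] D
    by (simp add: S_def[symmetric] sum_distrib_left[symmetric])
  moreover have "(\<Sum>i<n. g i i) = S"
    unfolding g S_def by (intro sum.cong) (auto simp: power2_eq_square)
  moreover have "g i j = g j i" for i j by (simp add: g)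
  ultimately have "2 * (\<Sum>(i, j)\<in>edges n. g i j) = - (real n / 2) * S - S"
    using sum_square_edges[of g n] by simp
  hence edges: "(\<Sum>(i, j)\<in>edges n. g i j) = - ((n + 2) / 4) * S"
    by (simp add: field_simps)
  have "(\<Sum>(i, j)\<in>edges n. S - (D i)\<^sup>2 - (D j)\<^sup>2 + 3 / 4 * (D i + D j)\<^sup>2) = (\<Sum>(i, j)\<in>edges n. S + g i j)"
    by (simp add: g_def algebra_simps)
  also have "\<dots> = card (edges n) * S + (\<Sum>(i, j)\<in>edges n. g i j)"
    by (simp add: split_beta sum.distrib)
  also have "\<dots> = card (edges n) * S - ((n + 2) / 4) * S"
    unfolding edges by simp
  also have "\<dots> \<le> card (edges n) * S - card (edges n) / (2 * real n) * S"
  proof -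
    have "2 * real (card (edges n)) = n * real (n - 1)"
      using arg_cong[OF card_edges[of n], of real] by simp
    also have "\<dots> \<le> real n * real n" by (intro mult_left_mono) auto
    finally have "card (edges n) / (2 * real n) \<le> (n + 2) / 4" using n by (simp add: field_simps)
    from mult_right_mono[OF this S0] show ?thesis by simp
  qed
  finally show ?thesis unfolding S_def by (simp add: algebra_simps)
qed

lemma kac_op_contract:
  assumes n: "2 \<le> n" and G: "G \<in> borel_measurable (Rn n)" and H: "H \<in> borel_measurable (Rn n)"
    and \<kappa>: "0 \<le> \<kappa>" and xy: "x \<in> sphere_n n" "y \<in> sphere_n n"
    and GH: "\<And>x y. x \<in> sphere_n n \<Longrightarrow> y \<in> sphere_n n \<Longrightarrow> G x \<le> G y + H y + ennreal (\<kappa> * sq_gap n x y)"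
  shows "kac_op n G x \<le> kac_op n G y + kac_op n H y + ennreal (\<kappa> * (1 - 1 / (2 * real n)) * sq_gap n x y)"
proof -
  let ?c = "ennreal (1 / card (edges n))"
  define D where "D k = (x k)\<^sup>2 - (y k)\<^sup>2" for k
  define q where "q i j = sq_gap n x y - (D i)\<^sup>2 - (D j)\<^sup>2 + 3 / 4 * (D i + D j)\<^sup>2" for i j
  have q0: "0 \<le> q i j" if "(i, j) \<in> edges n" for i j
  proof -
    have "sq_gap n x y = (\<Sum>k\<in>{..<n} - {i, j}. (D k)\<^sup>2) + (D i)\<^sup>2 + (D j)\<^sup>2"
      unfolding sq_gap_def D_def using that by (intro sum_remove_pair) (auto simp: edges_def)
    thus ?thesis by (simp add: q_def sum_nonneg)
  qed
  have D0: "(\<Sum>k<n. D k) = 0"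
    using xy by (simp add: D_def sum_subtractf sphere_n_def sqnorm_def)
  have "(\<Sum>e\<in>edges n. q (fst e) (snd e)) \<le> card (edges n) * ((1 - 1 / (2 * real n)) * sq_gap n x y)"
    using sum_edges_contract[OF _ D0] n by (simp add: q_def D_def sq_gap_def split_beta)
  hence "\<kappa> * (\<Sum>e\<in>edges n. q (fst e) (snd e)) \<le> \<kappa> * (card (edges n) * ((1 - 1 / (2 * real n)) * sq_gap n x y))"
    by (rule mult_left_mono) (rule \<kappa>)
  also have "\<dots> = real (card (edges n)) ^ 1 * (\<kappa> * (1 - 1 / (2 * real n)) * sq_gap n x y)" by (simp add: mult_ac)
  finally have sum: "(\<Sum>e\<in>edges n. \<kappa> * q (fst e) (snd e)) \<le> real (card (edges n)) ^ 1 * (\<kappa> * (1 - 1 / (2 * real n)) * sq_gap n x y)"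
    by (simp add: sum_distrib_left)
  have "kac_op n G x \<le> ?c * (\<Sum>e\<in>edges n. rot_avg e G y + rot_avg e H y + ennreal (\<kappa> * q (fst e) (snd e)))"
    unfolding kac_op_def
  proof (intro mult_left_mono sum_mono)
    fix e assume e: "e \<in> edges n"
    obtain i j where ij: "e = (i, j)" by (cases e)
    show "rot_avg e G x \<le> rot_avg e G y + rot_avg e H y + ennreal (\<kappa> * q (fst e) (snd e))"
      using rot_avg_contract[OF e[unfolded ij] G H \<kappa> xy GH] by (simp add: ij q_def D_def)
  qed simp
  also have "\<dots> = kac_op n G y + kac_op n H y + ?c * (\<Sum>e\<in>edges n. ennreal (\<kappa> * q (fst e) (snd e)))"
    unfolding kac_op_def by (simp add: sum.distrib distrib_left)
  also have "(\<Sum>e\<in>edges n. ennreal (\<kappa> * q (fst e) (snd e))) = ennreal (\<Sum>e\<in>edges n. \<kappa> * q (fst e) (snd e))"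
    using q0 \<kappa> by (intro sum_ennreal) auto
  also have "?c * \<dots> \<le> ?c ^ 1 * ennreal (real (card (edges n)) ^ 1 * (\<kappa> * (1 - 1 / (2 * real n)) * sq_gap n x y))"
    unfolding power_one_right using sum by (intro mult_left_mono ennreal_leI) auto
  also have "\<dots> = ennreal (\<kappa> * (1 - 1 / (2 * real n)) * sq_gap n x y)"
    using card_edges_pos[OF n] by (rule ennreal_inverse_pow_mult)
  finally show ?thesis by (simp add: add_left_mono)
qed

lemma kac_op_funpow_contract:
  assumes n: "2 \<le> n" and G: "G \<in> borel_measurable (Rn n)" and H: "H \<in> borel_measurable (Rn n)"
    and \<kappa>: "0 \<le> \<kappa>"
    and GH: "\<And>x y. x \<in> sphere_n n \<Longrightarrow> y \<in> sphere_n n \<Longrightarrow> G x \<le> G y + H y + ennreal (\<kappa> * sq_gap n x y)"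
  shows "x \<in> sphere_n n \<Longrightarrow> y \<in> sphere_n n \<Longrightarrow>
    (kac_op n ^^ m) G x \<le> (kac_op n ^^ m) G y + (kac_op n ^^ m) H y + ennreal (\<kappa> * (1 - 1 / (2 * real n)) ^ m * sq_gap n x y)"
proof (induction m arbitrary: x y)
  case 0
  thus ?case using GH by simp
next
  case (Suc m)
  have "0 \<le> \<kappa> * (1 - 1 / (2 * real n)) ^ m" using n \<kappa> by (intro mult_nonneg_nonneg zero_le_power) auto
  from kac_op_contract[OF n measurable_kac_op_funpow[OF G] measurable_kac_op_funpow[OF H] this Suc.prems Suc.IH]
  have "kac_op n ((kac_op n ^^ m) G) x \<le> kac_op n ((kac_op n ^^ m) G) y + kac_op n ((kac_op n ^^ m) H) y
    + ennreal (\<kappa> * (1 - 1 / (2 * real n)) ^ m * (1 - 1 / (2 * real n)) * sq_gap n x y)" .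
  thus ?case by (simp only: funpow.simps o_apply power_Suc2 mult.assoc)
qed

lemma kac_op_funpow_le_1:
  assumes n: "2 \<le> n" and f: "f \<in> borel_measurable (Rn n)" "\<And>x. f x \<le> 1" and x: "x \<in> space (Rn n)"
  shows "(kac_op n ^^ m) f x \<le> 1"
proof -
  have "(kac_op n ^^ m) f x = ennreal (1 / card (edges n)) ^ m * (\<Sum>es\<in>paths n m. path_avg es f x)"
    by (rule kac_op_funpow[OF f(1) x])
  also have "\<dots> \<le> ennreal (1 / card (edges n)) ^ m * (\<Sum>es\<in>paths n m. 1)"
    by (intro mult_left_mono sum_mono path_avg_le_const f) auto
  also have "\<dots> = (ennreal (1 / card (edges n)) * of_nat (card (edges n))) ^ m"
    by (simp add: card_paths power_mult_distrib)
  also have "\<dots> = 1" using ennreal_inverse_mult_of_nat[OF card_edges_pos[OF n]] by simp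
  finally show ?thesis .
qed

text \<open>The outer \<open>l\<close> applications come first in time and contract; the inner
  \<open>m\<close> match. Whether the states are close enough for matching is decided inside the
  bound on \<open>G\<close>: closeness gives the matching estimate, and otherwise the gap term alone
  exceeds 1, which is Markov's inequality applied in advance.\<close>

lemma kac_op_upper_bound:
  assumes n: "2 \<le> n" and A: "A \<in> sets (Rn n)" and x: "x \<in> sphere_n n"
    and \<epsilon>\<delta>: "0 < \<epsilon>" "\<epsilon> \<le> \<delta>" "\<delta> < 1 / n"
  shows "(kac_op n ^^ (l + m)) (indicator A) x \<le> emeasure (haar n) A
    + ennreal (m * (2 * sqrt (\<epsilon> / \<delta>) + n * sqrt (n * \<delta>)) + n * (1 - 1 / n) ^ m
      + 2 * (n / \<epsilon>\<^sup>2) * (1 - 1 / (2 * real n)) ^ l)"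
proof -
  interpret haar: prob_space "haar n" using n by (intro prob_space_haar) simp
  have f: "(indicator A :: _ \<Rightarrow> ennreal) \<in> borel_measurable (Rn n)" "\<And>x. indicator A x \<le> (1 :: ennreal)"
    using A by (auto simp: indicator_def)
  let ?f = "indicator A :: (nat \<Rightarrow> real) \<Rightarrow> ennreal"
  define G where "G = (kac_op n ^^ m) ?f"
  define H where "H y = coalesce_err \<epsilon> \<delta> n m y + ennreal (n * (1 - 1 / n) ^ m)" for y
  have G: "G \<in> borel_measurable (Rn n)" unfolding G_def by (rule measurable_kac_op_funpow[OF f(1)])
  have H: "H \<in> borel_measurable (Rn n)" unfolding H_def[abs_def] by simp
  \<comment> \<open>By Cauchy-Schwarz the squared absolute sum is at most n times
    \<open>sq_gap\<close>, so this factor lifts the gap term to at least 1 once the absolute sum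
    exceeds \<epsilon>.\<close>
  define \<kappa> where "\<kappa> = n / \<epsilon>\<^sup>2"
  have \<kappa>: "0 \<le> \<kappa>" by (simp add: \<kappa>_def)
  have GH: "G x \<le> G y + H y + ennreal (\<kappa> * sq_gap n x y)" if xy: "x \<in> sphere_n n" "y \<in> sphere_n n" for x y
  proof (cases "(\<Sum>k<n. \<bar>(x k)\<^sup>2 - (y k)\<^sup>2\<bar>) \<le> \<epsilon>")
    case True
    have "G x \<le> G y + H y"
      unfolding G_def H_def using kac_op_coalesce[OF n f _ \<epsilon>\<delta>(2) _ xy True, of m] \<epsilon>\<delta> by (simp add: add.assoc)
    thus ?thesis by (rule order.trans) simp
  next
    case False
    have "\<epsilon>\<^sup>2 \<le> (\<Sum>k<n. \<bar>(x k)\<^sup>2 - (y k)\<^sup>2\<bar>)\<^sup>2"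
      using False \<epsilon>\<delta> by (intro power_mono) auto
    also have "\<dots> \<le> (\<Sum>k<n. \<bar>(x k)\<^sup>2 - (y k)\<^sup>2\<bar>\<^sup>2) * card {..<n}"
      by (rule sum_squared_le_sum_of_squares)
    also have "\<dots> = n * sq_gap n x y" by (simp add: sq_gap_def)
    finally have "1 \<le> \<kappa> * sq_gap n x y" using \<epsilon>\<delta> by (simp add: \<kappa>_def field_simps)
    hence one: "1 \<le> ennreal (\<kappa> * sq_gap n x y)" by (simp add: ennreal_ge_1)
    have "G x \<le> 1"
      unfolding G_def using xy by (intro kac_op_funpow_le_1[OF n f]) (simp add: sphere_n_def)
    also note one
    also have "ennreal (\<kappa> * sq_gap n x y) \<le> G y + H y + ennreal (\<kappa> * sq_gap n x y)"
      by simp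
    finally show ?thesis .
  qed
  let ?b = "ennreal (\<kappa> * (1 - 1 / (2 * real n)) ^ l * 2)"
  have AE: "AE y in haar n. (kac_op n ^^ l) G x \<le> (kac_op n ^^ l) G y + (kac_op n ^^ l) H y + ?b"
    using AE_haar_sphere
  proof (rule eventually_mono)
    show "0 < n" using n by simp
    fix y assume y: "y \<in> sphere_n n"
    have "(kac_op n ^^ l) G x \<le> (kac_op n ^^ l) G y + (kac_op n ^^ l) H y + ennreal (\<kappa> * (1 - 1 / (2 * real n)) ^ l * sq_gap n x y)"
      by (rule kac_op_funpow_contract[OF n G H \<kappa> GH x y])
    also have "ennreal (\<kappa> * (1 - 1 / (2 * real n)) ^ l * sq_gap n x y) \<le> ?b"
      using \<kappa> n sq_gap_le_2[OF x y]
      by (intro ennreal_leI mult_left_mono mult_nonneg_nonneg zero_le_power) auto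
    finally show "(kac_op n ^^ l) G x \<le> (kac_op n ^^ l) G y + (kac_op n ^^ l) H y + ?b"
      by (simp add: add_left_mono)
  qed
  have meas: "(kac_op n ^^ l) G \<in> borel_measurable (haar n)" "(kac_op n ^^ l) H \<in> borel_measurable (haar n)"
    using measurable_kac_op_funpow[OF G] measurable_kac_op_funpow[OF H] by (simp_all cong: measurable_cong_sets)
  \<comment> \<open>The left side is constant in \<open>y\<close>, so it may be averaged over a
    uniform \<open>y\<close>; stationarity then strips the operators from the terms in
    \<open>y\<close>.\<close>
  have "(kac_op n ^^ (l + m)) ?f x = (\<integral>\<^sup>+y. (kac_op n ^^ l) G x \<partial>haar n)"
    using haar.emeasure_space_1 by (simp add: G_def funpow_add)
  also have "\<dots> \<le> (\<integral>\<^sup>+y. (kac_op n ^^ l) G y + (kac_op n ^^ l) H y + ?b \<partial>haar n)"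
    by (rule nn_integral_mono_AE[OF AE])
  also have "\<dots> = (\<integral>\<^sup>+y. (kac_op n ^^ l) G y \<partial>haar n) + (\<integral>\<^sup>+y. (kac_op n ^^ l) H y \<partial>haar n) + ?b"
    using meas haar.emeasure_space_1 by (simp add: nn_integral_add)
  also have "(\<integral>\<^sup>+y. (kac_op n ^^ l) G y \<partial>haar n) = emeasure (haar n) A"
    using nn_integral_haar_kac_op_funpow[OF n G] nn_integral_haar_kac_op_funpow[OF n f(1)] A by (simp add: G_def)
  also have "(\<integral>\<^sup>+y. (kac_op n ^^ l) H y \<partial>haar n) = (\<integral>\<^sup>+y. H y \<partial>haar n)"
    by (rule nn_integral_haar_kac_op_funpow[OF n H])
  also have "\<dots> = (\<integral>\<^sup>+y. coalesce_err \<epsilon> \<delta> n m y \<partial>haar n) + ennreal (n * (1 - 1 / n) ^ m)"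
    unfolding H_def using haar.emeasure_space_1 by (simp add: nn_integral_add)
  also have "emeasure (haar n) A + \<dots> + ?b
    \<le> emeasure (haar n) A + (of_nat m * (ennreal (2 * sqrt (\<epsilon> / \<delta>)) + ennreal (n * sqrt (n * \<delta>))) + ennreal (n * (1 - 1 / n) ^ m)) + ?b"
    using \<epsilon>\<delta> by (intro add_mono order.refl nn_integral_haar_coalesce_err[OF n]) auto
  also have "\<dots> = emeasure (haar n) A + ennreal (m * (2 * sqrt (\<epsilon> / \<delta>) + n * sqrt (n * \<delta>)) + n * (1 - 1 / n) ^ m
      + 2 * (n / \<epsilon>\<^sup>2) * (1 - 1 / (2 * real n)) ^ l)"
  proof -
    have "of_nat m * (ennreal (2 * sqrt (\<epsilon> / \<delta>)) + ennreal (n * sqrt (n * \<delta>)))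
      = ennreal (m * (2 * sqrt (\<epsilon> / \<delta>) + n * sqrt (n * \<delta>)))"
      using \<epsilon>\<delta> by (simp add: ennreal_of_nat_eq_real_of_nat ennreal_mult)
    moreover have "0 \<le> (1 - 1 / real n) ^ m" "0 \<le> (1 - 1 / (2 * real n)) ^ l"
      using n by (auto intro!: zero_le_power)
    ultimately show ?thesis
      using \<epsilon>\<delta> by (simp add: \<kappa>_def mult_ac add.assoc)
  qed
  finally show ?thesis .
qed

section \<open>The law of the walk\<close>

lemma edges_nonempty: "2 \<le> n \<Longrightarrow> edges n \<noteq> {}"
  using card_edges_pos[of n] by auto

lemma kac_noise_eq: "kac_noise n = measure_pmf (pmf_of_set (edges n)) \<Otimes>\<^sub>M angle"
  by (simp add: kac_noise_def edges_def angle_def)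

lemma sets_kac_noise [measurable_cong]: "sets (kac_noise n) = sets (count_space UNIV \<Otimes>\<^sub>M borel)"
  unfolding kac_noise_eq by (intro sets_pair_measure_cong) auto

lemma prob_space_kac_noise: "prob_space (kac_noise n)"
proof -
  interpret angle: prob_space angle by (rule prob_space_angle)
  interpret pair_prob_space "measure_pmf (pmf_of_set (edges n))" angle ..
  show ?thesis unfolding kac_noise_eq by (rule prob_space_axioms)
qed

lemma AE_kac_noise:
  assumes "2 \<le> n"
  shows "AE p in kac_noise n. fst p \<in> edges n"
proof -
  interpret angle: prob_space angle by (rule prob_space_angle)
  interpret pair_prob_space "measure_pmf (pmf_of_set (edges n))" angle ..
  have "AE e in measure_pmf (pmf_of_set (edges n)). e \<in> edges n"
    using AE_measure_pmf[of "pmf_of_set (edges n)"] edges_nonempty[OF assms] by simp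
  hence "AE e in measure_pmf (pmf_of_set (edges n)). AE \<theta> in angle. fst (e, \<theta>) \<in> edges n"
    by (rule eventually_mono) simp
  thus ?thesis
    unfolding kac_noise_eq by (rule AE_pair_measure[rotated]) simp
qed

text \<open>Standing still at impossible pairs keeps the state in the space of \<open>Rn n\<close>
  for every noise value, which makes the trajectory a measurable map. Almost surely nothing
  changes.\<close>

definition safe_rot :: "nat \<Rightarrow> nat \<times> nat \<Rightarrow> real \<Rightarrow> (nat \<Rightarrow> real) \<Rightarrow> (nat \<Rightarrow> real)" where
  "safe_rot n e \<theta> x = (if e \<in> edges n then kac_rot e \<theta> x else x)"

lemma measurable_safe_rot:
  assumes f: "f \<in> M \<rightarrow>\<^sub>M Rn n" and g: "g \<in> M \<rightarrow>\<^sub>M kac_noise n"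
  shows "(\<lambda>\<omega>. safe_rot n (fst (g \<omega>)) (snd (g \<omega>)) (f \<omega>)) \<in> M \<rightarrow>\<^sub>M Rn n"
proof -
  have g': "g \<in> M \<rightarrow>\<^sub>M count_space UNIV \<Otimes>\<^sub>M borel" using g unfolding measurable_cong_sets[OF refl sets_kac_noise] .
  have "(\<lambda>\<omega>. safe_rot n e (snd (g \<omega>)) (f \<omega>)) \<in> M \<rightarrow>\<^sub>M Rn n" for e
  proof (cases "e \<in> edges n")
    case True
    have "(\<lambda>\<omega>. (f \<omega>, snd (g \<omega>))) \<in> M \<rightarrow>\<^sub>M Rn n \<Otimes>\<^sub>M borel"
      using f g' by measurable
    from measurable_compose[OF this measurable_kac_rot[OF True]] show ?thesis
      using True by (simp add: safe_rot_def)
  next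
    case False
    thus ?thesis using f by (simp add: safe_rot_def)
  qed
  thus ?thesis
    by (rule measurable_compose_countable) (use g' in measurable)
qed

lemma nn_integral_kac_noise:
  assumes n: "2 \<le> n" and f: "f \<in> borel_measurable (Rn n)" and x: "x \<in> space (Rn n)"
  shows "(\<integral>\<^sup>+p. f (safe_rot n (fst p) (snd p) x) \<partial>kac_noise n) = kac_op n f x"
proof -
  interpret angle: prob_space angle by (rule prob_space_angle)
  have "(\<lambda>p. safe_rot n (fst p) (snd p) x) \<in> kac_noise n \<rightarrow>\<^sub>M Rn n"
    by (rule measurable_safe_rot) (use x in auto)
  hence meas: "(\<lambda>p. f (safe_rot n (fst p) (snd p) x)) \<in> borel_measurable (measure_pmf (pmf_of_set (edges n)) \<Otimes>\<^sub>M angle)"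
    using f unfolding kac_noise_eq[symmetric] by (rule measurable_compose)
  have "(\<integral>\<^sup>+p. f (safe_rot n (fst p) (snd p) x) \<partial>kac_noise n)
    = (\<integral>\<^sup>+e. \<integral>\<^sup>+\<theta>. f (safe_rot n e \<theta> x) \<partial>angle \<partial>measure_pmf (pmf_of_set (edges n)))"
    unfolding kac_noise_eq by (subst angle.nn_integral_fst[OF meas, symmetric]) simp
  also have "\<dots> = (\<Sum>e\<in>edges n. \<integral>\<^sup>+\<theta>. f (safe_rot n e \<theta> x) \<partial>angle) / card (edges n)"
    by (rule nn_integral_pmf_of_set[OF edges_nonempty[OF n] finite_edges])
  also have "(\<Sum>e\<in>edges n. \<integral>\<^sup>+\<theta>. f (safe_rot n e \<theta> x) \<partial>angle) = (\<Sum>e\<in>edges n. rot_avg e f x)"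
    by (intro sum.cong) (auto simp: safe_rot_def rot_avg_def)
  also have "\<dots> / of_nat (card (edges n)) = \<dots> * inverse (ennreal (real (card (edges n))))"
    by (simp only: divide_ennreal_def ennreal_of_nat_eq_real_of_nat)
  also have "inverse (ennreal (real (card (edges n)))) = ennreal (1 / card (edges n))"
    using card_edges_pos[OF n] by (subst inverse_ennreal) (auto simp: inverse_eq_divide)
  finally show ?thesis
    unfolding kac_op_def by (simp only: mult.commute)
qed

primrec safe_traj :: "nat \<Rightarrow> (nat \<Rightarrow> (nat \<times> nat) \<times> real) \<Rightarrow> (nat \<Rightarrow> real) \<Rightarrow> nat \<Rightarrow> (nat \<Rightarrow> real)" where
  "safe_traj n \<omega> x 0 = x"
| "safe_traj n \<omega> x (Suc t) = safe_rot n (fst (\<omega> t)) (snd (\<omega> t)) (safe_traj n \<omega> x t)"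

lemma safe_traj_upd: "t \<le> s \<Longrightarrow> safe_traj n (fun_upd \<omega> s p) x t = safe_traj n \<omega> x t"
  by (induction t) auto

lemma safe_traj_eq: "(\<And>s. s < t \<Longrightarrow> fst (\<omega> s) \<in> edges n) \<Longrightarrow> safe_traj n \<omega> x t = kac_traj \<omega> x t"
  by (induction t) (auto simp: safe_rot_def)

lemma measurable_safe_traj:
  assumes x: "x \<in> space (Rn n)"
  shows "{..<t} \<subseteq> I \<Longrightarrow> (\<lambda>\<omega>. safe_traj n \<omega> x t) \<in> PiM I (\<lambda>_. kac_noise n) \<rightarrow>\<^sub>M Rn n"
proof (induction t)
  case 0
  thus ?case using x by simp
next
  case (Suc t)
  hence "{..<t} \<subseteq> I" "t \<in> I" by auto
  thus ?case
    unfolding safe_traj.simps using Suc.IH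
    by (intro measurable_safe_rot measurable_component_singleton) auto
qed

text \<open>Integrating the last noise coordinate first replaces \<open>f\<close> by
  \<open>kac_op n f\<close> and leaves a shorter trajectory; hence the induction keeps
  \<open>f\<close> arbitrary.\<close>

lemma nn_integral_safe_traj:
  assumes n: "2 \<le> n" and x: "x \<in> space (Rn n)"
  shows "f \<in> borel_measurable (Rn n) \<Longrightarrow>
    (\<integral>\<^sup>+\<omega>. f (safe_traj n \<omega> x t) \<partial>PiM {..<t} (\<lambda>_. kac_noise n)) = (kac_op n ^^ t) f x"
proof (induction t arbitrary: f)
  case 0
  interpret empty: prob_space "PiM {..<0::nat} (\<lambda>_. kac_noise n)"
    by (intro prob_space_PiM prob_space_kac_noise)
  show ?case using empty.emeasure_space_1 by simp
next
  case (Suc t)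
  interpret noise: prob_space "kac_noise n" by (rule prob_space_kac_noise)
  interpret product_sigma_finite "\<lambda>_::nat. kac_noise n" by standard
  have I: "{..<Suc t} = insert t {..<t}" by auto
  have meas: "(\<lambda>\<omega>. f (safe_traj n \<omega> x (Suc t))) \<in> borel_measurable (PiM (insert t {..<t}) (\<lambda>_. kac_noise n))"
    by (rule measurable_compose[OF measurable_safe_traj[OF x] Suc.prems]) auto
  have "(\<integral>\<^sup>+\<omega>. f (safe_traj n \<omega> x (Suc t)) \<partial>PiM {..<Suc t} (\<lambda>_. kac_noise n))
      = (\<integral>\<^sup>+\<omega>. \<integral>\<^sup>+p. f (safe_traj n (fun_upd \<omega> t p) x (Suc t)) \<partial>kac_noise n \<partial>PiM {..<t} (\<lambda>_. kac_noise n))"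
    unfolding I by (rule product_nn_integral_insert[OF _ _ meas]) auto
  also have "\<dots> = (\<integral>\<^sup>+\<omega>. kac_op n f (safe_traj n \<omega> x t) \<partial>PiM {..<t} (\<lambda>_. kac_noise n))"
    using measurable_space[OF measurable_safe_traj[OF x order.refl]]
    by (intro nn_integral_cong) (simp add: safe_traj_upd nn_integral_kac_noise[OF n Suc.prems])
  also have "\<dots> = (kac_op n ^^ t) (kac_op n f) x"
    by (rule Suc.IH) (rule measurable_kac_op[OF Suc.prems])
  finally show ?case by (simp only: funpow_Suc_right o_apply)
qed

lemma measurable_kac_traj_component:
  "{..<t} \<subseteq> I \<Longrightarrow> (\<lambda>\<omega>. kac_traj \<omega> x t k) \<in> borel_measurable (PiM I (\<lambda>_. kac_noise n))"
proof (induction t arbitrary: k)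
  case (Suc t)
  let ?M = "PiM I (\<lambda>_. kac_noise n)"
  have t: "{..<t} \<subseteq> I" "t \<in> I" using Suc.prems by auto
  have "(\<lambda>\<omega>. \<omega> t) \<in> ?M \<rightarrow>\<^sub>M kac_noise n" using t by (intro measurable_component_singleton)
  hence \<omega>: "(\<lambda>\<omega>. \<omega> t) \<in> ?M \<rightarrow>\<^sub>M count_space UNIV \<Otimes>\<^sub>M borel"
    unfolding measurable_cong_sets[OF refl sets_kac_noise] .
  note traj = Suc.IH[OF t(1)]
  have "(\<lambda>\<omega>. snd (\<omega> t)) \<in> borel_measurable ?M"
    by (rule measurable_compose[OF \<omega> measurable_snd])
  hence trig: "(\<lambda>\<omega>. cos (snd (\<omega> t))) \<in> borel_measurable ?M" "(\<lambda>\<omega>. sin (snd (\<omega> t))) \<in> borel_measurable ?M"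
    by (rule measurable_compose; simp)+
  have "(\<lambda>\<omega>. kac_rot e (snd (\<omega> t)) (kac_traj \<omega> x t) k) \<in> borel_measurable ?M" for e
  proof -
    obtain i j where e: "e = (i, j)" by (cases e)
    consider (j) "k = j" | (i) "k \<noteq> j" "k = i" | (other) "k \<noteq> j" "k \<noteq> i" by blast
    thus ?thesis
      by cases (simp_all add: e kac_rot_def borel_measurable_add borel_measurable_diff borel_measurable_times traj trig)
  qed
  thus ?case
    unfolding kac_traj.simps
    by (rule measurable_compose_countable) (rule measurable_compose[OF \<omega> measurable_fst])
qed simp

text \<open>For index pairs outside \<open>edges n\<close> the trajectory may leave the space of \<open>Rn n\<close>, so
  \<open>kac_traj\<close> is not a measurable map into \<open>Rn n\<close>; its preimages of measurable sets are measurable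
  nevertheless, which is all that \<open>distr\<close> needs.\<close>

lemma kac_traj_preimage:
  assumes A: "A \<in> sets (Rn n)"
  shows "(\<lambda>\<omega>. kac_traj \<omega> x t) -` A \<inter> space (PiM {..<t} (\<lambda>_. kac_noise n)) \<in> sets (PiM {..<t} (\<lambda>_. kac_noise n))"
proof -
  let ?M = "PiM {..<t} (\<lambda>_. kac_noise n)"
  let ?R = "\<lambda>\<omega>. restrict (kac_traj \<omega> x t) {..<n}"
  note [measurable] = measurable_kac_traj_component[OF order.refl, of x t _ n]
  have R: "?R \<in> ?M \<rightarrow>\<^sub>M Rn n"
    unfolding Rn_def by (intro measurable_restrict) simp
  \<comment> \<open>Elements of \<open>A\<close> are extensional, so membership means that the
    restriction lies in \<open>A\<close> and that every coordinate from n on has the default value.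
    These are countably many measurable conditions.\<close>
  have "z \<in> A \<longleftrightarrow> restrict z {..<n} \<in> A \<and> (\<forall>k\<in>{n..}. z k = undefined)" for z
  proof -
    have ext: "w \<in> extensional {..<n}" if "w \<in> A" for w
      using that sets.sets_into_space[OF A] by (auto simp: Rn_def space_PiM PiE_def)
    have "restrict z {..<n} = z" if "\<forall>k\<in>{n..}. z k = undefined"
      using that by (auto simp: fun_eq_iff restrict_def not_less)
    thus ?thesis using ext[of z] by (auto simp: extensional_restrict extensional_def)
  qed
  hence "(\<lambda>\<omega>. kac_traj \<omega> x t) -` A \<inter> space ?M
    = (?R -` A \<inter> space ?M) \<inter> {\<omega> \<in> space ?M. \<forall>k\<in>{n..}. kac_traj \<omega> x t k = undefined}"
    by auto
  also have "\<dots> \<in> sets ?M"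
    using measurable_sets[OF R A] by measurable
  finally show ?thesis .
qed

text \<open>The push-forward depends only on the measures of preimages, so almost sure agreement
  with the measurable trajectory identifies the two laws.\<close>

lemma emeasure_kac_law:
  assumes n: "2 \<le> n" and x: "x \<in> space (Rn n)" and A: "A \<in> sets (Rn n)"
  shows "emeasure (kac_law n x t) A = (kac_op n ^^ t) (indicator A) x"
proof -
  let ?M = "PiM {..<t} (\<lambda>_. kac_noise n)"
  have safe[measurable]: "(\<lambda>\<omega>. safe_traj n \<omega> x t) \<in> ?M \<rightarrow>\<^sub>M Rn n"
    by (rule measurable_safe_traj[OF x]) simp
  have "AE \<omega> in ?M. \<forall>s\<in>{..<t}. fst (\<omega> s) \<in> edges n"
    using AE_kac_noise[OF n] prob_space_kac_noise
    by (intro AE_finite_allI AE_PiM_component[where P = "\<lambda>p. fst p \<in> edges n"]) auto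
  hence AE: "AE \<omega> in ?M. safe_traj n \<omega> x t = kac_traj \<omega> x t"
    by (rule eventually_mono) (simp add: safe_traj_eq)
  have "kac_law n x t = distr ?M (Rn n) (\<lambda>\<omega>. safe_traj n \<omega> x t)"
    unfolding kac_law_def distr_def
  proof (rule measure_of_eq[OF sets.space_closed])
    fix B assume "B \<in> sigma_sets (space (Rn n)) (sets (Rn n))"
    hence B: "B \<in> sets (Rn n)" by (simp add: sets.sigma_sets_eq)
    show "emeasure ?M ((\<lambda>\<omega>. kac_traj \<omega> x t) -` B \<inter> space ?M) = emeasure ?M ((\<lambda>\<omega>. safe_traj n \<omega> x t) -` B \<inter> space ?M)"
      using kac_traj_preimage[OF B] measurable_sets[OF safe B]
      by (intro emeasure_eq_AE) (use AE in \<open>auto elim!: eventually_mono\<close>)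
  qed
  hence "emeasure (kac_law n x t) A = (\<integral>\<^sup>+z. indicator A z \<partial>distr ?M (Rn n) (\<lambda>\<omega>. safe_traj n \<omega> x t))"
    using A by simp
  also have "\<dots> = (\<integral>\<^sup>+\<omega>. indicator A (safe_traj n \<omega> x t) \<partial>?M)"
    by (rule nn_integral_distr[OF safe]) (use A in simp)
  also have "\<dots> = (kac_op n ^^ t) (indicator A) x"
    by (rule nn_integral_safe_traj[OF n x]) (use A in simp)
  finally show ?thesis .
qed

section \<open>Untouched coordinates\<close>

lemma path_avg_eq_1:
  assumes i: "i < n" and f: "\<And>w. w \<in> space (Rn n) \<Longrightarrow> w i = c \<Longrightarrow> f w = 1"
  shows "set es \<subseteq> edges n \<Longrightarrow> (\<And>e. e \<in> set es \<Longrightarrow> fst e \<noteq> i \<and> snd e \<noteq> i) \<Longrightarrow> z \<in> space (Rn n) \<Longrightarrow> z i = c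
    \<Longrightarrow> path_avg es f z = 1"
proof (induction es arbitrary: z)
  case (Cons e es)
  have e: "e \<in> edges n" "fst e \<noteq> i" "snd e \<noteq> i" using Cons.prems by auto
  have "path_avg es f (kac_rot e \<theta> z) = 1" for \<theta>
  proof (rule Cons.IH)
    show "kac_rot e \<theta> z \<in> space (Rn n)" using e Cons.prems by (intro space_kac_rot)
    show "kac_rot e \<theta> z i = c" using e Cons.prems(4) by (simp add: kac_rot_def split_beta)
  qed (use Cons.prems in auto)
  thus ?case by (simp add: rot_avg_def)
qed (use f in simp)

section \<open>Counting paths that leave given indices alone\<close>

definition edges_at :: "nat \<Rightarrow> nat \<Rightarrow> (nat \<times> nat) set" where
  "edges_at n i = {e \<in> edges n. fst e = i \<or> snd e = i}"

lemma card_edges_at: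
  assumes i: "i < n"
  shows "card (edges_at n i) = n - 1"
proof -
  have "bij_betw (\<lambda>k. (min i k, max i k)) ({..<n} - {i}) (edges_at n i)"
  proof (rule bij_betw_byWitness[where f' = "\<lambda>e. if fst e = i then snd e else fst e"])
  qed (use i in \<open>auto simp: edges_at_def edges_def min_def max_def split: if_splits\<close>)
  from bij_betw_same_card[OF this] show ?thesis using i by simp
qed

lemma edges_at_Int:
  assumes "i < n" "k < n" "i \<noteq> k"
  shows "edges_at n i \<inter> edges_at n k = {(min i k, max i k)}"
  using assms by (auto simp: edges_at_def edges_def min_def max_def)

definition avoiding :: "nat \<Rightarrow> nat \<Rightarrow> nat set \<Rightarrow> (nat \<times> nat) list set" where
  "avoiding n m I = {es \<in> paths n m. \<forall>i\<in>I. set es \<inter> edges_at n i = {}}"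

lemma card_avoiding: "card (avoiding n m I) = (card (edges n - (\<Union>i\<in>I. edges_at n i))) ^ m"
proof -
  have "avoiding n m I = {es. set es \<subseteq> edges n - (\<Union>i\<in>I. edges_at n i) \<and> length es = m}"
    by (auto simp: avoiding_def paths_def)
  thus ?thesis by (simp add: card_lists_length_eq)
qed

lemma real_card_edges: "2 \<le> n \<Longrightarrow> 2 * real (card (edges n)) = real n * (real n - 1)"
  using arg_cong[OF card_edges[of n], of real] by (simp add: of_nat_diff)

lemma card_avoiding_1:
  assumes n: "2 \<le> n" and i: "i < n"
  shows "real (card (avoiding n m {i})) = (card (edges n) * (1 - 2 / n)) ^ m"
proof -
  have "card (edges n - edges_at n i) = card (edges n) - (n - 1)"
    using card_edges_at[OF i] by (subst card_Diff_subset) (auto simp: edges_at_def)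
  moreover have "n - 1 \<le> card (edges n)"
    unfolding card_edges_at[OF i, symmetric] by (intro card_mono) (auto simp: edges_at_def)
  ultimately have "real (card (edges n - edges_at n i)) = card (edges n) - (real n - 1)"
    using n by (simp add: of_nat_diff)
  also have "\<dots> = card (edges n) * (1 - 2 / n)"
    using real_card_edges[OF n] n by (simp add: field_simps)
  finally show ?thesis by (simp add: card_avoiding)
qed

text \<open>Being left alone is negatively correlated for two indices. Relative to removing 2(n-1)
  pairs, the one shared pair adds 1 back, while the squared factor on the right adds back 2(n-1)/n,
  which is at least 1.\<close>

lemma card_avoiding_2:
  assumes n: "2 \<le> n" and ik: "i < n" "k < n" "i \<noteq> k"
  shows "real (card (avoiding n m {i, k})) \<le> (card (edges n) * (1 - 2 / n)\<^sup>2) ^ m"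
proof -
  let ?U = "edges_at n i \<union> edges_at n k"
  have fin: "finite (edges_at n i)" "finite (edges_at n k)"
    by (auto simp: edges_at_def)
  have sub: "?U \<subseteq> edges n" by (auto simp: edges_at_def)
  have "card (edges_at n i) + card (edges_at n k) = card ?U + card (edges_at n i \<inter> edges_at n k)"
    by (rule card_Un_Int[OF fin])
  hence U: "real (card ?U) = 2 * (real n - 1) - 1"
    using ik n by (simp add: card_edges_at edges_at_Int of_nat_diff)
  have "card (edges n - ?U) = card (edges n) - card ?U"
    using fin sub by (intro card_Diff_subset) auto
  moreover have "card ?U \<le> card (edges n)" using sub by (intro card_mono) auto
  ultimately have "real (card (edges n - ?U)) = card (edges n) - (2 * (real n - 1) - 1)"
    using U by (simp add: of_nat_diff)
  also have "\<dots> \<le> card (edges n) * (1 - 2 / n)\<^sup>2"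
  proof -
    define N where "N = real (card (edges n))"
    have N: "N = real n * (real n - 1) / 2" using real_card_edges[OF n] by (simp add: N_def)
    have "N * (1 - 2 / n)\<^sup>2 = N - 2 * (real n - 1) + 2 * (real n - 1) / n"
      unfolding N using n by (simp add: field_simps power2_eq_square)
    moreover have "1 \<le> 2 * (real n - 1) / n" using n by (simp add: field_simps)
    ultimately show ?thesis unfolding N_def[symmetric] by linarith
  qed
  finally show ?thesis
    by (simp add: card_avoiding power_mono)
qed

text \<open>Second moment method for the number of coordinates that no edge of the path touches.\<close>

lemma card_covering_paths:
  assumes n: "3 \<le> n"
  shows "real (card {es \<in> paths n m. \<forall>i<n. set es \<inter> edges_at n i \<noteq> {}})
    \<le> real (card (edges n)) ^ m / (n * (1 - 2 / n) ^ m)"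
proof -
  define P where "P = paths n m"
  define M where "M = real (card (edges n)) ^ m"
  define q where "q = 1 - 2 / real n"
  define v where "v = n * q ^ m"
  \<comment> \<open>For n = 2 the only pair touches both indices and \<open>q\<close> would vanish;
    hence n is at least 3.\<close>
  have q: "0 < q" using n by (simp add: q_def)
  have v: "0 < v" using q n by (simp add: v_def)
  have n2: "2 \<le> n" using n by simp
  have finP: "finite P" by (simp add: P_def)
  define h where "h es i = (if set es \<inter> edges_at n i = {} then 1 else 0 :: real)" for es i
  define V where "V es = (\<Sum>i<n. h es i)" for es
  have cardP: "real (card P) = M" by (simp add: P_def M_def card_paths)
  have one: "(\<Sum>es\<in>P. h es i) = M * q ^ m" if "i < n" for i
  proof -
    have "(\<Sum>es\<in>P. h es i) = real (card (avoiding n m {i}))"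
      unfolding h_def P_def avoiding_def by (simp add: sum.If_cases Int_def)
    thus ?thesis using card_avoiding_1[OF n2 that] by (simp add: M_def q_def power_mult_distrib)
  qed
  have two: "(\<Sum>es\<in>P. h es i * h es k) \<le> M * (q ^ m)\<^sup>2" if "i < n" "k < n" "i \<noteq> k" for i k
  proof -
    have "(\<Sum>es\<in>P. h es i * h es k) = (\<Sum>es\<in>P. if es \<in> avoiding n m {i, k} then 1 else 0)"
      unfolding h_def P_def avoiding_def by (intro sum.cong) auto
    also have "\<dots> = real (card (P \<inter> avoiding n m {i, k}))"
      using finP by (simp add: sum.If_cases)
    also have "P \<inter> avoiding n m {i, k} = avoiding n m {i, k}" by (auto simp: P_def avoiding_def)
    finally show ?thesis using card_avoiding_2[OF n2 that]
      by (simp add: M_def q_def power_mult_distrib power_mult[symmetric] mult.commute)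
  qed
  have EV: "(\<Sum>es\<in>P. V es) = M * v"
    unfolding V_def by (subst sum.swap) (simp add: one v_def mult_ac)
  \<comment> \<open>The diagonal gives the mean and the rest, by negative correlation, at most its
    square: the variance is bounded by the mean.\<close>
  have EV2: "(\<Sum>es\<in>P. (V es)\<^sup>2) \<le> M * v + M * v\<^sup>2"
  proof -
    have "(\<Sum>es\<in>P. (V es)\<^sup>2) = (\<Sum>i<n. \<Sum>k<n. \<Sum>es\<in>P. h es i * h es k)"
      unfolding V_def power2_eq_square sum_product
      by (subst sum.swap, rule sum.cong, simp, subst sum.swap, simp)
    also have "\<dots> \<le> (\<Sum>i<n. \<Sum>k<n. (if k = i then M * q ^ m else 0) + M * (q ^ m)\<^sup>2)"
    proof (intro sum_mono)
      fix i k assume ik: "i \<in> {..<n}" "k \<in> {..<n}"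
      show "(\<Sum>es\<in>P. h es i * h es k) \<le> (if k = i then M * q ^ m else 0) + M * (q ^ m)\<^sup>2"
      proof (cases "k = i")
        case True
        have "(\<Sum>es\<in>P. h es i * h es i) = (\<Sum>es\<in>P. h es i)"
          by (intro sum.cong) (auto simp: h_def)
        moreover have "0 \<le> M * (q ^ m)\<^sup>2" by (simp add: M_def)
        ultimately show ?thesis using True one ik by simp
      next
        case False
        thus ?thesis using two ik by auto
      qed
    qed
    also have "\<dots> = M * v + M * v\<^sup>2"
      by (simp add: sum.distrib v_def power_mult_distrib power2_eq_square distrib_left mult_ac)
    finally show ?thesis .
  qed
  let ?Z = "{es \<in> P. \<forall>i<n. set es \<inter> edges_at n i \<noteq> {}}"
  \<comment> \<open>Chebyshev's inequality: on a covering path the count is 0, a full mean away from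
    \<open>v\<close>.\<close>
  have "real (card ?Z) * v\<^sup>2 = (\<Sum>es\<in>?Z. (V es - v)\<^sup>2)"
  proof -
    have "V es = 0" if "es \<in> ?Z" for es
      unfolding V_def h_def using that by (intro sum.neutral) auto
    thus ?thesis by simp
  qed
  also have "\<dots> \<le> (\<Sum>es\<in>P. (V es - v)\<^sup>2)"
    using finP by (intro sum_mono2) auto
  also have "\<dots> = (\<Sum>es\<in>P. (V es)\<^sup>2) - 2 * v * (\<Sum>es\<in>P. V es) + M * v\<^sup>2"
  proof -
    have "(V es - v)\<^sup>2 = (V es)\<^sup>2 - 2 * v * V es + v\<^sup>2" for es
      by (simp add: power2_diff)
    thus ?thesis
      by (simp add: sum.distrib sum_subtractf sum_distrib_left[symmetric] cardP)
  qed
  also have "\<dots> \<le> M * v"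
    using EV2 unfolding EV by (simp add: power2_eq_square algebra_simps)
  finally have "real (card ?Z) * v * v \<le> M * v" by (simp add: power2_eq_square mult.assoc)
  hence "real (card ?Z) * v \<le> M" using v by simp
  hence "real (card ?Z) \<le> M / v" using v by (simp add: field_simps)
  thus ?thesis by (simp add: P_def M_def v_def q_def)
qed

definition touches :: "nat \<Rightarrow> (nat \<Rightarrow> real) \<Rightarrow> (nat \<Rightarrow> real) set" where
  "touches n x = (\<Union>i<n. {z \<in> space (Rn n). z i = x i})"

lemma sets_touches: "touches n x \<in> sets (Rn n)"
  unfolding touches_def
proof (rule sets.finite_UN)
  fix i assume "i \<in> {..<n}"
  hence "(\<lambda>x. x i) \<in> borel_measurable (Rn n)" by (intro Rn_component) simp
  thus "{z \<in> space (Rn n). z i = x i} \<in> sets (Rn n)" by measurable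
qed simp

lemma haar_touches:
  assumes "2 \<le> n"
  shows "emeasure (haar n) (touches n x) = 0"
proof -
  have "{z \<in> space (Rn n). z i = x i} \<in> sets (Rn n)" if "i < n" for i
    using Rn_component[OF that] by measurable
  hence "(\<Union>i\<in>{..<n}. {z \<in> space (Rn n). z i = x i}) \<in> null_sets (haar n)"
    using haar_hyperplane[OF assms] by (intro null_sets.finite_UN null_setsI) auto
  thus ?thesis by (simp add: touches_def null_sets_def)
qed

text \<open>A path that misses an index keeps that coordinate whatever the angles are, so its
  average of the indicator is exactly 1. Only the covering paths can lose mass.\<close>

lemma kac_law_touches:
  assumes n: "3 \<le> n" and x: "x \<in> space (Rn n)"
  shows "ennreal (1 - 1 / (n * (1 - 2 / n) ^ t)) \<le> emeasure (kac_law n x t) (touches n x)"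
proof -
  let ?f = "indicator (touches n x) :: (nat \<Rightarrow> real) \<Rightarrow> ennreal"
  define N where "N = real (card (edges n)) ^ t"
  have pos: "0 < card (edges n)" using card_edges_pos[of n] n by simp
  hence N: "0 < N" by (simp add: N_def)
  let ?Z = "{es \<in> paths n t. \<forall>i<n. set es \<inter> edges_at n i \<noteq> {}}"
  have Z: "?Z \<subseteq> paths n t" by auto
  have c: "ennreal (1 / card (edges n)) ^ t = ennreal (1 / N)"
    by (simp add: ennreal_power N_def power_divide)
  have "path_avg es ?f x = 1" if es: "es \<in> paths n t - ?Z" for es
  proof -
    obtain i where i: "i < n" "set es \<inter> edges_at n i = {}" using es by auto
    show ?thesis
    proof (rule path_avg_eq_1[OF i(1)])
      show "set es \<subseteq> edges n" using es by (auto simp: paths_def)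
      thus "fst e \<noteq> i \<and> snd e \<noteq> i" if "e \<in> set es" for e
        using i(2) that by (auto simp: edges_at_def)
      show "?f w = 1" if "w \<in> space (Rn n)" "w i = x i" for w
      proof -
        have "w \<in> touches n x" using that i(1) by (auto simp: touches_def)
        thus ?thesis by simp
      qed
    qed (use x in auto)
  qed
  hence "(\<Sum>es\<in>paths n t - ?Z. path_avg es ?f x) = of_nat (card (paths n t - ?Z))" by simp
  moreover have "(\<Sum>es\<in>paths n t - ?Z. path_avg es ?f x) \<le> (\<Sum>es\<in>paths n t. path_avg es ?f x)"
    by (intro sum_mono2) auto
  moreover have "card (paths n t - ?Z) = card (paths n t) - card ?Z"
    using Z by (intro card_Diff_subset) (auto intro: finite_subset)
  moreover have "card ?Z \<le> card (paths n t)" using Z by (intro card_mono) auto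
  ultimately have "ennreal (N - card ?Z) \<le> (\<Sum>es\<in>paths n t. path_avg es ?f x)"
    by (simp add: ennreal_of_nat_eq_real_of_nat of_nat_diff card_paths N_def)
  hence "ennreal (1 / N) * ennreal (N - card ?Z) \<le> emeasure (kac_law n x t) (touches n x)"
    using n x sets_touches
    by (simp add: emeasure_kac_law kac_op_funpow c mult_left_mono)
  moreover have "ennreal (1 - 1 / (n * (1 - 2 / n) ^ t)) \<le> ennreal (1 / N) * ennreal (N - card ?Z)"
  proof -
    have "1 / N * card ?Z \<le> 1 / N * (N / (n * (1 - 2 / n) ^ t))"
      using card_covering_paths[OF n, of t] N by (intro mult_left_mono) (auto simp: N_def)
    hence "1 - 1 / (n * (1 - 2 / n) ^ t) \<le> 1 / N * (N - card ?Z)"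
      using N by (simp add: right_diff_distrib)
    thus ?thesis using N by (subst ennreal_mult'[symmetric]) (auto intro: ennreal_leI)
  qed
  ultimately show ?thesis by (rule order.trans[rotated])
qed

section \<open>Total variation bounds\<close>

lemma tv_dist_bounds:
  assumes n: "2 \<le> n" and x: "x \<in> space (Rn n)"
  shows "A \<in> sets (Rn n) \<Longrightarrow> measure (kac_law n x t) A - measure (haar n) A \<le> tv_dist (kac_law n x t) (haar n)"
    and "tv_dist (kac_law n x t) (haar n) \<le> 1" and "0 \<le> tv_dist (kac_law n x t) (haar n)"
    and "(\<And>A. A \<in> sets (Rn n) \<Longrightarrow> emeasure (kac_law n x t) A \<le> emeasure (haar n) A + ennreal b) \<Longrightarrow> 0 \<le> b
      \<Longrightarrow> tv_dist (kac_law n x t) (haar n) \<le> b"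
proof -
  interpret haar: prob_space "haar n" using n by (intro prob_space_haar) simp
  have sets: "sets (kac_law n x t) = sets (Rn n)" by (simp add: kac_law_def)
  have le1: "emeasure (kac_law n x t) A \<le> 1" if "A \<in> sets (Rn n)" for A
    using kac_op_funpow_le_1[OF n _ _ x, of "indicator A" t] that
    by (simp add: emeasure_kac_law[OF n x that] indicator_def)
  hence m1: "measure (kac_law n x t) A \<le> 1" if "A \<in> sets (Rn n)" for A
    using that enn2real_mono[of _ 1] by (fastforce simp: measure_def)
  have diff: "measure (kac_law n x t) A - measure (haar n) A \<le> 1" if "A \<in> sets (Rn n)" for A
    using m1[OF that] measure_nonneg[of "haar n" A] by linarith
  have bdd: "bdd_above ((\<lambda>A. measure (kac_law n x t) A - measure (haar n) A) ` sets (Rn n))"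
    using diff by (intro bdd_aboveI[of _ 1]) auto
  show upper: "measure (kac_law n x t) A - measure (haar n) A \<le> tv_dist (kac_law n x t) (haar n)" if "A \<in> sets (Rn n)" for A
    unfolding tv_dist_def sets by (rule cSUP_upper[OF that bdd])
  show "tv_dist (kac_law n x t) (haar n) \<le> 1"
    unfolding tv_dist_def sets using diff by (intro cSUP_least) auto
  show "0 \<le> tv_dist (kac_law n x t) (haar n)"
    using upper[of "{}"] by simp
  show "tv_dist (kac_law n x t) (haar n) \<le> b"
    if b: "\<And>A. A \<in> sets (Rn n) \<Longrightarrow> emeasure (kac_law n x t) A \<le> emeasure (haar n) A + ennreal b" "0 \<le> b"
    unfolding tv_dist_def sets
  proof (rule cSUP_least)
    fix A assume A: "A \<in> sets (Rn n)"
    have "emeasure (kac_law n x t) A \<le> ennreal (measure (haar n) A + b)"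
      using b(1)[OF A] b(2) by (simp add: haar.emeasure_eq_measure)
    hence "measure (kac_law n x t) A \<le> measure (haar n) A + b"
      unfolding measure_def[of "kac_law n x t"] using b(2)
      by (metis enn2real_ennreal enn2real_mono ennreal_less_top add_nonneg_nonneg measure_nonneg)
    thus "measure (kac_law n x t) A - measure (haar n) A \<le> b" by simp
  qed auto
qed

lemma sphere_n_nonempty:
  assumes "0 < n"
  shows "sphere_n n \<noteq> {}"
proof -
  define z where "z k = (if k < n then if k = 0 then 1 else 0 else undefined :: real)" for k
  have "sqnorm n z = (\<Sum>k<n. if k = 0 then 1 else 0)"
    unfolding sqnorm_def z_def by (intro sum.cong) auto
  hence "sqnorm n z = 1" using assms by simp
  moreover have "z \<in> space (Rn n)"
    by (auto simp: Rn_def space_PiM PiE_def extensional_def z_def)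
  ultimately have "z \<in> sphere_n n" by (simp add: sphere_n_def)
  thus ?thesis by blast
qed

text \<open>The power with exponent \<open>t\<close> decreases in \<open>t\<close>, so the integer
  time may be replaced by its real upper bound. This leaves one explicit sequence, free of the
  starting point and of the chosen times.\<close>

lemma kac_lower_bound:
  assumes n: "3 \<le> n" and t: "real t \<le> C * n * ln n"
  shows "1 - 1 / (n * (1 - 2 / n) powr (C * n * ln n)) \<le> (INF x\<in>sphere_n n. tv_dist (kac_law n x t) (haar n))"
proof (rule cINF_greatest)
  show "sphere_n n \<noteq> {}" using n by (intro sphere_n_nonempty) simp
  fix x assume "x \<in> sphere_n n"
  hence x: "x \<in> space (Rn n)" by (simp add: sphere_n_def)
  have q: "0 < 1 - 2 / real n" "1 - 2 / real n \<le> 1" using n by auto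
  have "(1 - 2 / n) powr (C * n * ln n) \<le> (1 - 2 / real n) ^ t"
    using q t by (subst powr_realpow[symmetric]) (auto intro: powr_mono')
  hence "n * (1 - 2 / n) powr (C * n * ln n) \<le> n * (1 - 2 / real n) ^ t"
    by (rule mult_left_mono) simp
  moreover have "0 < n * (1 - 2 / n) powr (C * n * ln n)" using n q by simp
  ultimately have "1 / (n * (1 - 2 / real n) ^ t) \<le> 1 / (n * (1 - 2 / n) powr (C * n * ln n))"
    by (intro divide_left_mono) auto
  hence "1 - 1 / (n * (1 - 2 / n) powr (C * n * ln n)) \<le> 1 - 1 / (n * (1 - 2 / real n) ^ t)" by simp
  also have "\<dots> \<le> measure (kac_law n x t) (touches n x)"
  proof -
    have "emeasure (kac_law n x t) (touches n x) \<le> 1"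
      using kac_op_funpow_le_1[OF _ _ _ x, of "indicator (touches n x)" t] n sets_touches[of n x]
      by (simp add: emeasure_kac_law[OF _ x] indicator_def)
    hence "emeasure (kac_law n x t) (touches n x) = ennreal (measure (kac_law n x t) (touches n x))"
      by (intro emeasure_eq_ennreal_measure) (auto simp: top_unique)
    thus ?thesis using kac_law_touches[OF n x, of t] by (simp add: ennreal_le_iff)
  qed
  also have "\<dots> = measure (kac_law n x t) (touches n x) - measure (haar n) (touches n x)"
    using n haar_touches[of n x] by (simp add: measure_def)
  also have "\<dots> \<le> tv_dist (kac_law n x t) (haar n)"
    using n by (intro tv_dist_bounds x sets_touches) simp
  finally show "1 - 1 / (n * (1 - 2 / n) powr (C * n * ln n)) \<le> tv_dist (kac_law n x t) (haar n)" .
qed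

lemma kac_upper_bound:
  assumes n: "2 \<le> n" and t: "200 * real n * ln (real n) \<le> real t"
  shows "(SUP x\<in>sphere_n n. tv_dist (kac_law n x t) (haar n))
    \<le> 100 * real n * ln (real n) * (2 * sqrt ((1 / real n ^ 16) / (1 / real n ^ 8)) + real n * sqrt (real n * (1 / real n ^ 8)))
      + real n * exp (- (100 * real n * ln (real n) - 1) / real n)
      + 2 * (real n / (1 / real n ^ 16)\<^sup>2) * exp (- (100 * real n * ln (real n)) / (2 * real n))"
    (is "_ \<le> ?b")
proof (rule cSUP_least)
  show "sphere_n n \<noteq> {}" using n by (intro sphere_n_nonempty) simp
  fix x assume x: "x \<in> sphere_n n"
  hence xs: "x \<in> space (Rn n)" by (simp add: sphere_n_def)
  \<comment> \<open>Up to logarithms the matching stage needs \<epsilon>/\<delta> far below n^-2 and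
    \<delta> far below n^-5, since its errors add up over order n ln n steps. The contraction stage
    must beat n/\<epsilon>^2 = n^33 and supplies a factor n^-50.\<close>
  define \<epsilon> where "\<epsilon> = 1 / real n ^ 16"
  define \<delta> where "\<delta> = 1 / real n ^ 8"
  have \<epsilon>\<delta>: "0 < \<epsilon>" "\<epsilon> \<le> \<delta>" "\<delta> < 1 / n"
  proof -
    show "0 < \<epsilon>" using n by (simp add: \<epsilon>_def)
    show "\<epsilon> \<le> \<delta>" unfolding \<epsilon>_def \<delta>_def using n by (intro divide_left_mono power_increasing) auto
    have "real n ^ 1 < real n ^ 8" using n by (intro power_strict_increasing) auto
    thus "\<delta> < 1 / n" unfolding \<delta>_def using n by (intro divide_strict_left_mono) auto
  qed
  define L where "L = 100 * real n * ln (real n)"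
  have L: "0 \<le> L" using n by (simp add: L_def)
  \<comment> \<open>Rounding down costs at most one matching step, seen as the \<open>- 1\<close> in
    the final exponent. All surplus time goes to the contraction stage, where longer only
    helps.\<close>
  define m where "m = nat \<lfloor>L\<rfloor>"
  have m: "real m \<le> L" "L - 1 \<le> real m" using L by (auto simp: m_def)
  have mt: "m \<le> t" using m t L by (simp add: L_def)
  define l where "l = t - m"
  have l: "L \<le> real l" using m t mt by (simp add: l_def L_def of_nat_diff)
  have decay: "(1 - u) ^ k \<le> exp (- (real k * u))" if "0 \<le> u" "u \<le> 1" for u k
  proof -
    have "(1 - u) ^ k \<le> (exp (- u)) ^ k"
      using that exp_ge_add_one_self[of "- u"] by (intro power_mono) auto
    thus ?thesis by (simp add: exp_of_nat_mult[symmetric])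
  qed
  have e1: "(1 - 1 / real n) ^ m \<le> exp (- (L - 1) / n)"
  proof -
    have "(1 - 1 / real n) ^ m \<le> exp (- (real m * (1 / n)))" using n by (intro decay) auto
    also have "\<dots> \<le> exp (- (L - 1) / n)" using m n by (simp add: field_simps)
    finally show ?thesis .
  qed
  have e2: "(1 - 1 / (2 * real n)) ^ l \<le> exp (- L / (2 * real n))"
  proof -
    have "(1 - 1 / (2 * real n)) ^ l \<le> exp (- (real l * (1 / (2 * real n))))" using n by (intro decay) auto
    also have "\<dots> \<le> exp (- L / (2 * real n))" using l n by (simp add: divide_right_mono)
    finally show ?thesis .
  qed
  let ?c = "m * (2 * sqrt (\<epsilon> / \<delta>) + n * sqrt (n * \<delta>)) + n * (1 - 1 / n) ^ m
      + 2 * (n / \<epsilon>\<^sup>2) * (1 - 1 / (2 * real n)) ^ l"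
  have "0 \<le> (1 - 1 / real n) ^ m" "0 \<le> (1 - 1 / (2 * real n)) ^ l"
    using n by (auto intro!: zero_le_power)
  hence c0: "0 \<le> ?c" using \<epsilon>\<delta> by (intro add_nonneg_nonneg mult_nonneg_nonneg) auto
  have "tv_dist (kac_law n x t) (haar n) \<le> ?c"
  proof (rule tv_dist_bounds(4)[OF n xs _ c0])
    fix A assume A: "A \<in> sets (Rn n)"
    have "t = l + m" using mt by (simp add: l_def)
    thus "emeasure (kac_law n x t) A \<le> emeasure (haar n) A + ennreal ?c"
      using kac_op_upper_bound[OF n A x \<epsilon>\<delta>, of l m] by (simp only: emeasure_kac_law[OF n xs A])
  qed
  also have "?c \<le> L * (2 * sqrt (\<epsilon> / \<delta>) + n * sqrt (n * \<delta>)) + n * exp (- (L - 1) / n)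
      + 2 * (n / \<epsilon>\<^sup>2) * exp (- L / (2 * real n))"
    using m(1) e1 e2 \<epsilon>\<delta> by (intro add_mono mult_right_mono mult_left_mono) auto
  finally show "tv_dist (kac_law n x t) (haar n) \<le> ?b"
    by (simp only: L_def \<epsilon>_def \<delta>_def)
qed

text \<open>The denominator is the expected number of untouched coordinates at the real time bound;
  it behaves like n^(1 - 2C), and this is the origin of the threshold 1/2.\<close>

lemma lower_asymp:
  fixes C :: real
  assumes "C < 1 / 2"
  shows "(\<lambda>n. 1 - 1 / (real n * (1 - 2 / real n) powr (C * real n * ln (real n)))) \<longlonglongrightarrow> 1"
  using assms by real_asymp

text \<open>Up to constants the terms have orders n^-3 ln n, n^(-3/2) ln n, n^-99 and n^-17.\<close>

lemma upper_asymp: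
  "(\<lambda>n. 100 * real n * ln (real n) * (2 * sqrt ((1 / real n ^ 16) / (1 / real n ^ 8)) + real n * sqrt (real n * (1 / real n ^ 8)))
      + real n * exp (- (100 * real n * ln (real n) - 1) / real n)
      + 2 * (real n / (1 / real n ^ 16)\<^sup>2) * exp (- (100 * real n * ln (real n)) / (2 * real n))) \<longlonglongrightarrow> 0"
  by real_asymp

theorem theorem1p1:
  fixes C1 C2 :: real and T1 T2 :: "nat \<Rightarrow> nat"
  shows "(C1 < 1/2 \<and> (\<forall>n\<ge>2. real (T1 n) < C1 * real n * ln (real n)) \<longrightarrow>
            (\<lambda>n. INF x0 \<in> sphere_n n. tv_dist (kac_law n x0 (T1 n)) (haar n))
              \<longlonglongrightarrow> 1)
       \<and> (C2 > 200 \<and> (\<forall>n\<ge>2. real (T2 n) > C2 * real n * ln (real n)) \<longrightarrow>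
            (\<lambda>n. SUP x0 \<in> sphere_n n. tv_dist (kac_law n x0 (T2 n)) (haar n))
              \<longlonglongrightarrow> 0)"
proof (intro conjI impI; elim conjE)
  assume C: "C1 < 1/2" and T: "\<forall>n\<ge>2. real (T1 n) < C1 * real n * ln (real n)"
  show "(\<lambda>n. INF x0 \<in> sphere_n n. tv_dist (kac_law n x0 (T1 n)) (haar n)) \<longlonglongrightarrow> 1"
  proof (rule tendsto_sandwich[OF _ _ lower_asymp[OF C] tendsto_const])
    show "\<forall>\<^sub>F n in sequentially. 1 - 1 / (real n * (1 - 2 / real n) powr (C1 * real n * ln (real n)))
        \<le> (INF x0 \<in> sphere_n n. tv_dist (kac_law n x0 (T1 n)) (haar n))"
      using eventually_ge_at_top[of 3]
    proof (rule eventually_mono)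
      fix n :: nat assume n: "3 \<le> n"
      show "1 - 1 / (real n * (1 - 2 / real n) powr (C1 * real n * ln (real n)))
        \<le> (INF x0 \<in> sphere_n n. tv_dist (kac_law n x0 (T1 n)) (haar n))"
        by (rule kac_lower_bound[OF n less_imp_le]) (use T n in simp)
    qed
    show "\<forall>\<^sub>F n in sequentially. (INF x0 \<in> sphere_n n. tv_dist (kac_law n x0 (T1 n)) (haar n)) \<le> 1"
      using eventually_ge_at_top[of 2]
    proof (rule eventually_mono)
      fix n :: nat assume n: "2 \<le> n"
      obtain z where z: "z \<in> sphere_n n" using sphere_n_nonempty[of n] n by auto
      have sp: "x \<in> space (Rn n)" if "x \<in> sphere_n n" for x using that by (simp add: sphere_n_def)
      have "(INF x0 \<in> sphere_n n. tv_dist (kac_law n x0 (T1 n)) (haar n)) \<le> tv_dist (kac_law n z (T1 n)) (haar n)"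
        using tv_dist_bounds(3)[OF n sp] z by (intro cINF_lower bdd_belowI[of _ 0]) auto
      also have "\<dots> \<le> 1" by (rule tv_dist_bounds(2)[OF n sp[OF z]])
      finally show "(INF x0 \<in> sphere_n n. tv_dist (kac_law n x0 (T1 n)) (haar n)) \<le> 1" .
    qed
  qed
next
  assume C: "200 < C2" and T: "\<forall>n\<ge>2. C2 * real n * ln (real n) < real (T2 n)"
  show "(\<lambda>n. SUP x0 \<in> sphere_n n. tv_dist (kac_law n x0 (T2 n)) (haar n)) \<longlonglongrightarrow> 0"
  proof (rule tendsto_sandwich[OF _ _ tendsto_const upper_asymp])
    show "\<forall>\<^sub>F n in sequentially. 0 \<le> (SUP x0 \<in> sphere_n n. tv_dist (kac_law n x0 (T2 n)) (haar n))"
      using eventually_ge_at_top[of 2]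
    proof (rule eventually_mono)
      fix n :: nat assume n: "2 \<le> n"
      obtain z where z: "z \<in> sphere_n n" using sphere_n_nonempty[of n] n by auto
      have sp: "x \<in> space (Rn n)" if "x \<in> sphere_n n" for x using that by (simp add: sphere_n_def)
      have "0 \<le> tv_dist (kac_law n z (T2 n)) (haar n)" by (rule tv_dist_bounds(3)[OF n sp[OF z]])
      also have "\<dots> \<le> (SUP x0 \<in> sphere_n n. tv_dist (kac_law n x0 (T2 n)) (haar n))"
        using tv_dist_bounds(2)[OF n sp] z by (intro cSUP_upper bdd_aboveI[of _ 1]) auto
      finally show "0 \<le> (SUP x0 \<in> sphere_n n. tv_dist (kac_law n x0 (T2 n)) (haar n))" .
    qed
    show "\<forall>\<^sub>F n in sequentially. (SUP x0 \<in> sphere_n n. tv_dist (kac_law n x0 (T2 n)) (haar n))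
      \<le> 100 * real n * ln (real n) * (2 * sqrt ((1 / real n ^ 16) / (1 / real n ^ 8)) + real n * sqrt (real n * (1 / real n ^ 8)))
      + real n * exp (- (100 * real n * ln (real n) - 1) / real n)
      + 2 * (real n / (1 / real n ^ 16)\<^sup>2) * exp (- (100 * real n * ln (real n)) / (2 * real n))"
      using eventually_ge_at_top[of 2]
    proof (rule eventually_mono)
      fix n :: nat assume n: "2 \<le> n"
      have "200 * (real n * ln (real n)) \<le> C2 * (real n * ln (real n))"
        using C n by (intro mult_right_mono) auto
      moreover have "C2 * (real n * ln (real n)) < real (T2 n)" using T n by (simp add: mult.assoc)
      ultimately have "200 * real n * ln (real n) \<le> real (T2 n)" by (simp add: mult.assoc)
      thus "(SUP x0 \<in> sphere_n n. tv_dist (kac_law n x0 (T2 n)) (haar n))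
      \<le> 100 * real n * ln (real n) * (2 * sqrt ((1 / real n ^ 16) / (1 / real n ^ 8)) + real n * sqrt (real n * (1 / real n ^ 8)))
      + real n * exp (- (100 * real n * ln (real n) - 1) / real n)
      + 2 * (real n / (1 / real n ^ 16)\<^sup>2) * exp (- (100 * real n * ln (real n)) / (2 * real n))"
        using kac_upper_bound[OF n] by simp
    qed
  qed
qed

end
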